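(* Let $P=(P_t)_{t\ge 0}$ be exponential Brownian motion with $P_0=1$, i.e. the solution of $dP_t = P_t\,dB_t$ with $B$ a standard Brownian motion, and for $t \geq 0$ let $\nu_t$ denote the law of $P_t$ (so $\nu_0=\delta_1$ and, for $t>0$, $\nu_t$ has density $p_t(x) = \frac{1}{\sqrt{2\pi}}\,\frac{e^{-t/8}}{t^{1/2}}\,\frac{e^{-(\ln x)^2/(2t)}}{x^{3/2}}$ on $(0,\infty)$). Then there exists a martingale $\tilde P=(\tilde P_t)_{t\ge 0}$ with continuous paths such that $\tilde P_t$ has law $\nu_t$ for every $t\ge 0$, and $\tilde P$ is distinct from exponential Brownian motion.
   Context: Here "distinct from exponential Brownian motion" means that the law of $\tilde P$ as a process differs from the law of $P$ as a process (only the one-dimensional marginal laws coincide). The martingale property of $\tilde P$ is with respect to some filtration to which it is adapted (e.g. its own). $\delta_x$ denotes the unit mass at $x$. *)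

theory Defs
  imports "HOL-Probability.Probability"
begin

text \<open>Processes are indexed by all of \<^typ>\<open>real\<close>, but only times \<open>t \<ge> 0\<close> are ever used. A filtration
  on \<open>[0,\<infinity>)\<close> fits the library locale, whose index is the whole type, by putting \<open>F t = F 0\<close> for
  \<open>t < 0\<close>.\<close>

definition filtration_on :: "'a measure \<Rightarrow> (real \<Rightarrow> 'a measure) \<Rightarrow> bool" where
  "filtration_on M F \<longleftrightarrow> filtration (space M) F \<and> (\<forall>t. subalgebra M (F t))"

definition adapted :: "(real \<Rightarrow> 'a measure) \<Rightarrow> (real \<Rightarrow> 'a \<Rightarrow> real) \<Rightarrow> bool" where
  "adapted F X \<longleftrightarrow> (\<forall>t\<ge>0. X t \<in> borel_measurable (F t))"

definition martingale :: "'a measure \<Rightarrow> (real \<Rightarrow> 'a measure) \<Rightarrow> (real \<Rightarrow> 'a \<Rightarrow> real) \<Rightarrow> bool" where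
  "martingale M F X \<longleftrightarrow>
     prob_space M \<and> filtration_on M F \<and> adapted F X \<and>
     (\<forall>t\<ge>0. integrable M (X t)) \<and>
     (\<forall>s t. 0 \<le> s \<and> s \<le> t \<longrightarrow> (AE \<omega> in M. real_cond_exp M (F s) (X t) \<omega> = X s \<omega>))"

definition standard_brownian_motion ::
  "'a measure \<Rightarrow> (real \<Rightarrow> 'a measure) \<Rightarrow> (real \<Rightarrow> 'a \<Rightarrow> real) \<Rightarrow> bool" where
  "standard_brownian_motion M F B \<longleftrightarrow>
     prob_space M \<and> filtration_on M F \<and> adapted F B \<and>
     (AE \<omega> in M. B 0 \<omega> = 0) \<and>
     (AE \<omega> in M. continuous_on {0..} (\<lambda>t. B t \<omega>)) \<and>
     (\<forall>s t. 0 \<le> s \<and> s < t \<longrightarrow>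
        distributed M lborel (\<lambda>\<omega>. B t \<omega> - B s \<omega>) (normal_density 0 (sqrt (t - s))) \<and>
        prob_space.indep_set M (sets (F s))
          (sets (vimage_algebra (space M) (\<lambda>\<omega>. B t \<omega> - B s \<omega>) borel)))"

definition partition_mesh_less :: "real \<Rightarrow> real \<Rightarrow> nat \<Rightarrow> (nat \<Rightarrow> real) \<Rightarrow> bool" where
  "partition_mesh_less t \<delta> n p \<longleftrightarrow>
     p 0 = 0 \<and> p n = t \<and> (\<forall>i<n. p i \<le> p (Suc i) \<and> p (Suc i) - p i < \<delta>)"

text \<open>For an adapted integrand \<open>H\<close> with continuous paths (the only case used below) the It\^o integral
  \<open>I = \<integral>\<^sub>0\<^sup>t H dB\<close> is the limit in probability, as the mesh tends to 0, of the Riemann sums with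
  left endpoints. It is determined up to almost sure equality.\<close>

definition has_ito_integral ::
  "'a measure \<Rightarrow> (real \<Rightarrow> 'a \<Rightarrow> real) \<Rightarrow> (real \<Rightarrow> 'a \<Rightarrow> real) \<Rightarrow> real \<Rightarrow> ('a \<Rightarrow> real) \<Rightarrow> bool" where
  "has_ito_integral M B H t I \<longleftrightarrow>
     I \<in> borel_measurable M \<and>
     (\<forall>\<epsilon>>0. \<exists>\<delta>>0. \<forall>n p. partition_mesh_less t \<delta> n p \<longrightarrow>
        measure M {\<omega> \<in> space M.
          \<epsilon> < \<bar>(\<Sum>i<n. H (p i) \<omega> * (B (p (Suc i)) \<omega> - B (p i) \<omega>)) - I \<omega>\<bar>} < \<epsilon>)"

text \<open>\<open>P\<close> solves \<open>dP\<^sub>t = P\<^sub>t dB\<^sub>t\<close>, \<open>P\<^sub>0 = 1\<close>, where \<open>B\<close> is a Brownian motion relative to \<open>F\<close>.\<close>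

definition exponential_brownian_motion ::
  "'a measure \<Rightarrow> (real \<Rightarrow> 'a measure) \<Rightarrow> (real \<Rightarrow> 'a \<Rightarrow> real) \<Rightarrow> (real \<Rightarrow> 'a \<Rightarrow> real) \<Rightarrow> bool" where
  "exponential_brownian_motion M F B P \<longleftrightarrow>
     standard_brownian_motion M F B \<and> adapted F P \<and>
     (AE \<omega> in M. P 0 \<omega> = 1) \<and>
     (AE \<omega> in M. continuous_on {0..} (\<lambda>t. P t \<omega>)) \<and>
     (\<forall>t\<ge>0. has_ito_integral M B P t (\<lambda>\<omega>. P t \<omega> - P 0 \<omega>))"

text \<open>The law of a process on \<open>\<real>\<^bsup>[0,\<infinity>)\<^esup>\<close> with its product (cylinder) sigma-algebra.\<close>

definition process_law ::
  "'a measure \<Rightarrow> (real \<Rightarrow> 'a \<Rightarrow> real) \<Rightarrow> (real \<Rightarrow> real) measure" where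
  "process_law M X =
     distr M (PiM {0..} (\<lambda>_. borel)) (\<lambda>\<omega>. restrict (\<lambda>t. X t \<omega>) {0..})"

definition exp_bm_density :: "real \<Rightarrow> real \<Rightarrow> real" where
  "exp_bm_density t x =
     (if 0 < x
      then 1 / sqrt (2 * pi) * (exp (- t / 8) / t powr (1 / 2)) *
           (exp (- (ln x)\<^sup>2 / (2 * t)) / x powr (3 / 2))
      else 0)"

end

theory Submission
  imports Defs "HOL-Probability.Probability" "HOL-Real_Asymp.Real_Asymp"
begin

text \<open>
  Put \<open>Z = (P - 1) / (P + 1)\<close>. Under the change of measure with density \<open>(1 + P) / 2 = 1 / (1 - Z)\<close>,
  exponential Brownian motion turns into a martingale \<open>Z\<close> in \<open>(-1, 1)\<close> whose marginal laws are symmetric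
  and, for \<open>t \<le> 1\<close>, unimodal. By Khinchine's theorem the law of \<open>Z\<^sub>t\<close> is the mixture, over \<open>h\<close> uniform in
  \<open>(0, 1)\<close>, of the uniform laws on \<open>[- R\<^sub>t(h), R\<^sub>t(h)]\<close>, where \<open>R\<^sub>t(h)\<close> is the quantile of a radius law.
  A derivative computation shows that \<open>R\<^sub>t(h)\<close> increases with \<open>t\<close>.

  The fake process agrees with exponential Brownian motion up to time \<open>1/2\<close> and has its multiplicative
  increments after time \<open>1\<close>. In between, conditionally on \<open>h\<close>, it is given by \<open>Z\<^sub>t = R\<^sub>t(h) x\<^sub>t\<close>, where \<open>x\<^sub>t\<close>
  is the first coordinate of a uniform point of the unit sphere that is rotated in a plane containing the
  first axis, by an independent Brownian angle \<open>W\<close> at time \<open>s = 2 ln (R\<^sub>t(h) / R\<^sub>1\<^sub>/\<^sub>2(h))\<close>. Rotations keep \<open>x\<^sub>t\<close>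
  uniform on \<open>[-1, 1]\<close>, so the marginal laws are right, and \<open>Z\<close> is a martingale because
  \<open>exp (s / 2) cos W\<^sub>s\<close> and \<open>exp (s / 2) sin W\<^sub>s\<close> are.

  The second coordinate of the point, on which the conditional variance of \<open>Z\<^sub>t\<close> depends, is correlated with
  a sign that is a function of the path before time \<open>1/2\<close>. Exchanging two increments flips the sign and
  fixes \<open>P\<^sub>1\<^sub>/\<^sub>2\<close>, so this does not affect the marginal laws; but for exponential Brownian motion the future
  after \<open>1/2\<close> does not depend on the sign, hence the two process laws differ.

  That \<open>P\<^sub>t = exp (B\<^sub>t - t / 2)\<close> almost surely follows from Gronwall's inequality for the truncated second
  moment of the difference, estimated by Riemann sums along dyadic partitions.
\<close>

section \<open>The marginal laws as mixtures of uniform laws\<close>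

text \<open>The density \<open>(1 + P) / 2\<close> is chosen because it turns the law of
  \<open>ln P\<close>, a Gaussian with drift, into an even mixture of two opposite drifts: only a
  symmetric law can be a mixture of centred intervals. Unimodality of \<open>Z\<close> holds exactly
  for \<open>t <= 4 / 3\<close>, so the new dynamics occupy a bounded stretch of time, and
  exponential Brownian increments take over at time 1. The sphere is the two-dimensional one because
  only there is a coordinate uniform on an interval, which is what the mixture asks for. Averaging
  over the rotation shrinks a coordinate by \<open>exp (- s / 2)\<close>, and the clock
  \<open>s\<close> is the one on which the radius grows by the inverse factor; a radius that
  decreased in \<open>t\<close> would leave no such clock. The sign serves to reduce the comparison
  of two process laws to one computable integral that involves only the times 1/4, 1/2 and 1. The
  computations use nonnegative integrals throughout: \<open>1 + Z\<close> and \<open>1 - Z\<close>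
  are nonnegative martingales with quotient \<open>P\<close>, so weighting \<open>P\<close> by
  \<open>1 - Z\<close> gives \<open>1 + Z\<close>.\<close>

text \<open>Heat kernel, in the coordinate \<open>u = y / 2\<close>, of Brownian motion killed at rate \<open>1 / 8\<close>. The martingale
  \<open>Z\<close> above is \<open>tanh u\<close> at time \<open>t\<close>, where \<open>u\<close> has the density \<open>2 cosh u killed_kernel t u\<close>;
  \<open>tanh_density t u\<close> is the density of \<open>Z\<close> at the point \<open>tanh u\<close>.\<close>

definition killed_kernel :: "real \<Rightarrow> real \<Rightarrow> real" where
  "killed_kernel t u = exp (- t / 8) / sqrt (2 * pi * t) * exp (- 2 * u\<^sup>2 / t)"

definition tanh_density :: "real \<Rightarrow> real \<Rightarrow> real" where
  "tanh_density t u = 2 * cosh u ^ 3 * killed_kernel t u"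

definition tanh_density_slope :: "real \<Rightarrow> real \<Rightarrow> real" where
  "tanh_density_slope t u = 2 * killed_kernel t u * (cosh u)\<^sup>2 * (4 * u * cosh u / t - 3 * sinh u)"

text \<open>Khinchine's radius density \<open>- 2 * r * f'(r)\<close> for the density
  \<open>f\<close> of \<open>Z\<close>, in the coordinate \<open>r = tanh u\<close>; there
  \<open>f'(r) dr\<close> becomes \<open>- tanh_density_slope t u du\<close>.\<close>

definition radius_density :: "real \<Rightarrow> real \<Rightarrow> real" where
  "radius_density t u = 2 * tanh u * tanh_density_slope t u"

lemma killed_kernel_pos: "0 < t \<Longrightarrow> 0 < killed_kernel t u"
  by (simp add: killed_kernel_def)

lemma killed_kernel_minus[simp]: "killed_kernel t (- u) = killed_kernel t u"
  by (simp add: killed_kernel_def)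

lemma killed_kernel_deriv: "0 < t \<Longrightarrow> (killed_kernel t has_real_derivative - (4 * u / t) * killed_kernel t u) (at u)"
  unfolding killed_kernel_def by (auto intro!: derivative_eq_intros simp: field_simps)

lemma killed_kernel_deriv_time: "0 < t \<Longrightarrow>
   ((\<lambda>t. killed_kernel t u) has_real_derivative killed_kernel t u * (- 1 / 8 - 1 / (2 * t) + 2 * u\<^sup>2 / t\<^sup>2)) (at t)"
  unfolding killed_kernel_def
  by (auto intro!: derivative_eq_intros simp: divide_simps real_sqrt_mult power2_eq_square)
     (simp add: algebra_simps)?

lemma killed_kernel_measurable[measurable]: "killed_kernel t \<in> borel_measurable borel"
  unfolding killed_kernel_def by measurable

lemma sinh_cosh_measurable[measurable]:
  "(sinh :: real \<Rightarrow> real) \<in> borel_measurable borel" "(cosh :: real \<Rightarrow> real) \<in> borel_measurable borel"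
  "(tanh :: real \<Rightarrow> real) \<in> borel_measurable borel"
  by (auto intro!: borel_measurable_continuous_onI continuous_intros)

lemma tanh_density_slope_measurable[measurable]: "tanh_density_slope t \<in> borel_measurable borel"
  unfolding tanh_density_slope_def by measurable

lemma radius_density_measurable[measurable]: "radius_density t \<in> borel_measurable borel"
  unfolding radius_density_def by measurable

lemma sinh_le_mult_cosh: "0 \<le> u \<Longrightarrow> sinh u \<le> u * cosh (u::real)"
proof -
  assume u: "0 \<le> u"
  have "(\<lambda>u. u * cosh u - sinh u) 0 \<le> (\<lambda>u. u * cosh u - sinh (u::real)) u"
    by (rule DERIV_nonneg_imp_nondecreasing[OF u])
       (auto intro!: derivative_eq_intros exI)
  then show ?thesis by simp
qed

text \<open>Unimodality. Near \<open>u = 0\<close> the last factor of the slope behaves like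
  \<open>(4 / t - 3) * u\<close>, which limits \<open>t\<close> to at most 4/3; for
  \<open>t <= 1\<close> the bound \<open>sinh u <= u * cosh u\<close> suffices.\<close>

lemma tanh_density_slope_pos: assumes "0 < t" "t \<le> 1" "0 < u" shows "0 < tanh_density_slope t u"
proof -
  have "3 * sinh u < 4 * sinh u" using assms by simp
  also have "\<dots> \<le> 4 * (u * cosh u)" using sinh_le_mult_cosh[of u] assms by simp
  also have "\<dots> \<le> 4 * u * cosh u / t"
    using assms by (simp add: divide_simps mult_le_cancel_left1)
  finally show ?thesis using killed_kernel_pos[of t u] assms by (simp add: tanh_density_slope_def)
qed

lemma tanh_density_slope_nonneg: "0 < t \<Longrightarrow> t \<le> 1 \<Longrightarrow> 0 \<le> u \<Longrightarrow> 0 \<le> tanh_density_slope t u"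
  using tanh_density_slope_pos[of t u] by (cases "u = 0") (auto simp: tanh_density_slope_def)

lemma tanh_density_deriv: "0 < t \<Longrightarrow> (tanh_density t has_real_derivative - tanh_density_slope t u) (at u)"
  unfolding tanh_density_def tanh_density_slope_def
  by (auto intro!: derivative_eq_intros killed_kernel_deriv simp: field_simps power2_eq_square power3_eq_cube)

lemma tanh_density_lim: "0 < t \<Longrightarrow> (tanh_density t \<longlongrightarrow> 0) at_top"
  unfolding tanh_density_def killed_kernel_def cosh_field_def by real_asymp

lemma nn_integral_tanh_density_slope:
  assumes t: "0 < t" "t \<le> 1" and a: "0 \<le> a"
  shows "(\<integral>\<^sup>+s. ennreal (tanh_density_slope t s) * indicator {a..} s \<partial>lborel) = ennreal (tanh_density t a)"
proof -
  have "(\<integral>\<^sup>+s. ennreal (tanh_density_slope t s) * indicator {a..} s \<partial>lborel) = ennreal (0 - - tanh_density t a)"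
  proof (rule nn_integral_FTC_atLeast)
    show "((\<lambda>x. - tanh_density t x) \<longlongrightarrow> 0) at_top" using tendsto_minus[OF tanh_density_lim[OF t(1)]] by simp
    show "((\<lambda>x. - tanh_density t x) has_real_derivative tanh_density_slope t x) (at x)" for x
      using DERIV_minus[OF tanh_density_deriv[OF t(1), of x]] by simp
  qed (use tanh_density_slope_nonneg t a in auto)
  then show ?thesis by simp
qed

section \<open>Distribution function of the radius and its decrease in time\<close>

definition std_normal_primitive :: "real \<Rightarrow> real" where
  "std_normal_primitive = (SOME F. \<forall>x. (F has_real_derivative std_normal_density x) (at x))"

lemma std_normal_primitive_deriv: "(std_normal_primitive has_real_derivative std_normal_density x) (at x)"
proof -
  have "\<exists>F. \<forall>x::real. -\<infinity> < ereal x \<longrightarrow> ereal x < \<infinity> \<longrightarrow> (F has_vector_derivative std_normal_density x) (at x)"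
    by (rule einterval_antiderivative) (auto intro!: continuous_intros simp: std_normal_density_def)
  then have "\<exists>F. \<forall>x. (F has_real_derivative std_normal_density x) (at x)"
    by (auto simp: has_real_derivative_iff_has_vector_derivative)
  from someI_ex[OF this] show ?thesis unfolding std_normal_primitive_def by blast
qed

text \<open>Closed form of the distribution function of the radius, in the coordinate artanh, at time \<open>t\<close>.\<close>

definition radius_cdf :: "real \<Rightarrow> real \<Rightarrow> real" where
  "radius_cdf t u = std_normal_primitive (2 * u / sqrt t - sqrt t / 2) - std_normal_primitive (- 2 * u / sqrt t - sqrt t / 2)
            - 4 * sinh u * (cosh u)\<^sup>2 * killed_kernel t u"

text \<open>Completing the square moves the drift into the factor \<open>exp u\<close>. Together
  with the reflected point, which gives \<open>exp (- u)\<close>, the two Gaussian terms of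
  \<open>radius_cdf\<close> combine to hyperbolic functions.\<close>

lemma std_normal_density_eq_killed_kernel:
  assumes "0 < t"
  shows "std_normal_density (2 * u / sqrt t - sqrt t / 2) = sqrt t * killed_kernel t u * exp u"
proof -
  have "(2 * u / sqrt t - sqrt t / 2)\<^sup>2 = 4 * u\<^sup>2 / t + t / 4 - 2 * u"
    using assms by (simp add: power2_diff power_divide) 
  then have e: "- (2 * u / sqrt t - sqrt t / 2)\<^sup>2 / 2 = - t / 8 + - 2 * u\<^sup>2 / t + u"
    by (simp add: field_simps)
  show ?thesis
    using assms unfolding std_normal_density_def killed_kernel_def e exp_add by (simp add: real_sqrt_mult)
qed

lemma radius_cdf_0[simp]: "radius_cdf t 0 = 0" by (simp add: radius_cdf_def)

text \<open>Integration by parts of \<open>2 * tanh u * tanh_density_slope t u\<close>: the boundary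
  term is \<open>- 2 * tanh u * tanh_density t u\<close>, the last summand of
  \<open>radius_cdf\<close>, and the Gaussian difference is the mass of \<open>{- u..u}\<close>
  under the density \<open>2 * cosh u * killed_kernel t u\<close>.\<close>

lemma radius_cdf_deriv: assumes t: "0 < t" shows "(radius_cdf t has_real_derivative radius_density t u) (at u)"
proof -
  have 1: "std_normal_density (- 2 * u / sqrt t - sqrt t / 2) = sqrt t * killed_kernel t u * exp (- u)"
    using std_normal_density_eq_killed_kernel[OF t, of "-u"] by simp
  have c2: "(cosh u)\<^sup>2 = (sinh u)\<^sup>2 + 1" by (simp add: cosh_square_eq)
  have "(radius_cdf t has_real_derivative
     std_normal_density (2 * u / sqrt t - sqrt t / 2) * (2 / sqrt t)
     - std_normal_density (- 2 * u / sqrt t - sqrt t / 2) * (- 2 / sqrt t)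
     - (4 * cosh u * (cosh u)\<^sup>2 * killed_kernel t u + 4 * sinh u * (2 * cosh u * sinh u) * killed_kernel t u
        + 4 * sinh u * (cosh u)\<^sup>2 * (- (4 * u / t) * killed_kernel t u))) (at u)"
    unfolding radius_cdf_def
  proof (intro DERIV_diff DERIV_chain2[OF std_normal_primitive_deriv])
    show "((\<lambda>u. 2 * u / sqrt t - sqrt t / 2) has_real_derivative 2 / sqrt t) (at u)"
      "((\<lambda>u. - 2 * u / sqrt t - sqrt t / 2) has_real_derivative - 2 / sqrt t) (at u)"
      using t by (auto intro!: derivative_eq_intros simp: field_simps)
    show "((\<lambda>u. 4 * sinh u * (cosh u)\<^sup>2 * killed_kernel t u) has_real_derivative
       4 * cosh u * (cosh u)\<^sup>2 * killed_kernel t u + 4 * sinh u * (2 * cosh u * sinh u) * killed_kernel t u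
        + 4 * sinh u * (cosh u)\<^sup>2 * (- (4 * u / t) * killed_kernel t u)) (at u)"
      by (auto intro!: derivative_eq_intros killed_kernel_deriv t simp: algebra_simps)
  qed
  moreover have "std_normal_density (2 * u / sqrt t - sqrt t / 2) * (2 / sqrt t)
     - std_normal_density (- 2 * u / sqrt t - sqrt t / 2) * (- 2 / sqrt t) = 4 * cosh u * killed_kernel t u"
    unfolding 1 std_normal_density_eq_killed_kernel[OF t] using t by (simp add: cosh_def field_simps)
  moreover have "4 * cosh u * killed_kernel t u - (4 * cosh u * (cosh u)\<^sup>2 * killed_kernel t u + 4 * sinh u * (2 * cosh u * sinh u) * killed_kernel t u
        + 4 * sinh u * (cosh u)\<^sup>2 * (- (4 * u / t) * killed_kernel t u)) = radius_density t u"
  proof -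
    have "4 * cosh u * killed_kernel t u - (4 * cosh u * (cosh u)\<^sup>2 * killed_kernel t u + 4 * sinh u * (2 * cosh u * sinh u) * killed_kernel t u
        + 4 * sinh u * (cosh u)\<^sup>2 * (- (4 * u / t) * killed_kernel t u))
      = 4 * killed_kernel t u * sinh u * cosh u * (4 * u * cosh u / t - 3 * sinh u)
        + 4 * cosh u * killed_kernel t u * ((sinh u)\<^sup>2 + 1 - (cosh u)\<^sup>2)"
      using t by (simp add: field_simps power2_eq_square)
    also have "\<dots> = radius_density t u"
      using cosh_real_pos[of u]
      by (simp only: c2[symmetric] diff_self mult_zero_right add_0_right)
         (simp add: radius_density_def tanh_density_slope_def tanh_def power2_eq_square)
    finally show ?thesis .
  qed
  ultimately show ?thesis by simp
qed

text \<open>Factored with a negative prefactor, so that the question of sign concerns only the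
  bracket.\<close>

definition radius_cdf_dt :: "real \<Rightarrow> real \<Rightarrow> real" where
  "radius_cdf_dt t u = - (killed_kernel t u / (2 * t\<^sup>2)) * (16 * u\<^sup>2 * sinh u * (cosh u)\<^sup>2
     + 4 * t * (u * cosh u - sinh u * (cosh u)\<^sup>2) - t\<^sup>2 * sinh u * ((cosh u)\<^sup>2 - 1))"

lemma radius_cdf_deriv_time: assumes t: "0 < t" shows "((\<lambda>t. radius_cdf t u) has_real_derivative radius_cdf_dt t u) (at t)"
proof -
  have 1: "std_normal_density (- 2 * u / sqrt t - sqrt t / 2) = sqrt t * killed_kernel t u * exp (- u)"
    using std_normal_density_eq_killed_kernel[OF t, of "-u"] by simp
  define r where "r = sqrt t"
  have r: "0 < r" "t = r\<^sup>2" using t by (auto simp: r_def)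
  have d: "((\<lambda>t. c / sqrt t - sqrt t / 2) has_real_derivative - c / (2 * r ^ 3) - 1 / (4 * r)) (at t)" for c
    using t r by (auto intro!: derivative_eq_intros simp: r_def[symmetric] field_simps power3_eq_cube power2_eq_square)
  have "((\<lambda>t. radius_cdf t u) has_real_derivative
     std_normal_density (2 * u / sqrt t - sqrt t / 2) * (- (2 * u) / (2 * r ^ 3) - 1 / (4 * r))
     - std_normal_density (- 2 * u / sqrt t - sqrt t / 2) * (- (- 2 * u) / (2 * r ^ 3) - 1 / (4 * r))
     - 4 * sinh u * (cosh u)\<^sup>2 * (killed_kernel t u * (- 1 / 8 - 1 / (2 * t) + 2 * u\<^sup>2 / t\<^sup>2))) (at t)"
    unfolding radius_cdf_def using t
    by (intro DERIV_diff DERIV_chain2[OF std_normal_primitive_deriv d] DERIV_cmult killed_kernel_deriv_time)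
  moreover have "std_normal_density (2 * u / sqrt t - sqrt t / 2) * (- (2 * u) / (2 * r ^ 3) - 1 / (4 * r))
     - std_normal_density (- 2 * u / sqrt t - sqrt t / 2) * (- (- 2 * u) / (2 * r ^ 3) - 1 / (4 * r))
     = - killed_kernel t u / 2 * (4 * u * cosh u / t + sinh u)"
    unfolding 1 std_normal_density_eq_killed_kernel[OF t] unfolding r_def[symmetric] r(2) using r(1)
    by (simp add: cosh_def sinh_def field_simps power2_eq_square power3_eq_cube)
  moreover have "- killed_kernel t u / 2 * (4 * u * cosh u / t + sinh u)
     - 4 * sinh u * (cosh u)\<^sup>2 * (killed_kernel t u * (- 1 / 8 - 1 / (2 * t) + 2 * u\<^sup>2 / t\<^sup>2)) = radius_cdf_dt t u"
    unfolding radius_cdf_dt_def using t by (simp add: field_simps power2_eq_square)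
  ultimately show ?thesis by simp
qed

text \<open>The two terms of the bracket that carry a power of \<open>t\<close> are nonpositive, so
  \<open>t = 1\<close> is the worst case. There \<open>S <= u * C\<close> bounds the leading term
  below by \<open>16 * S ^ 3\<close>, against a loss of \<open>5 * S ^ 3\<close> from the
  rest.\<close>

lemma radius_cdf_dt_neg: assumes t: "0 < t" "t \<le> 1" and u: "0 < u" shows "radius_cdf_dt t u < 0"
proof -
  define S C where "S = sinh u" and "C = cosh u"
  have S: "0 < S" and C: "1 \<le> C" and SC: "C\<^sup>2 = S\<^sup>2 + 1" and uC: "S \<le> u * C"
    using u sinh_le_mult_cosh[of u] cosh_real_ge_1[of u]
    by (auto simp: S_def C_def cosh_square_eq)
  have "C \<le> C\<^sup>2" using C by (simp add: power2_eq_square)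
  have uS: "u \<le> S"
  proof -
    have "(\<lambda>u. sinh u - u) 0 \<le> (\<lambda>u. sinh u - u) u"
      by (rule DERIV_nonneg_imp_nondecreasing)
         (use u cosh_real_ge_1 in \<open>auto intro!: derivative_eq_intros exI\<close>)
    then show ?thesis by (simp add: S_def)
  qed
  have a: "S\<^sup>2 \<le> u\<^sup>2 * C\<^sup>2" using power_mono[OF uC, of 2] S by (simp add: power_mult_distrib)
  have n1: "0 \<le> S * C\<^sup>2 - u * C"
  proof -
    have "u * C \<le> S * C" using uS C by simp
    also have "\<dots> \<le> S * C\<^sup>2" using \<open>C \<le> C\<^sup>2\<close> S by simp
    finally show ?thesis by simp
  qed
  have "16 * u\<^sup>2 * S * C\<^sup>2 + 4 * t * (u * C - S * C\<^sup>2) - t\<^sup>2 * S * (C\<^sup>2 - 1)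
      \<ge> 16 * u\<^sup>2 * S * C\<^sup>2 + 4 * (u * C - S * C\<^sup>2) - S * (C\<^sup>2 - 1)"
  proof -
    have "t * (S * C\<^sup>2 - u * C) \<le> 1 * (S * C\<^sup>2 - u * C)" by (rule mult_right_mono) (use t n1 in auto)
    moreover have "t\<^sup>2 * (S * S\<^sup>2) \<le> 1 * (S * S\<^sup>2)"
      by (rule mult_right_mono) (use t S in \<open>auto simp: power_le_one\<close>)
    ultimately show ?thesis unfolding SC by (simp add: algebra_simps)
  qed
  moreover have "16 * u\<^sup>2 * S * C\<^sup>2 + 4 * (u * C - S * C\<^sup>2) - S * (C\<^sup>2 - 1)
     = 16 * (S * (u\<^sup>2 * C\<^sup>2)) + 4 * (u * C - S) - 5 * (S * S\<^sup>2)"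
    unfolding SC by (simp add: algebra_simps power2_eq_square)
  moreover have "S * (u\<^sup>2 * C\<^sup>2) \<ge> S * S\<^sup>2" using a S by simp
  moreover have "0 < S * S\<^sup>2" using S by simp
  ultimately have "0 < 16 * u\<^sup>2 * S * C\<^sup>2 + 4 * t * (u * C - S * C\<^sup>2) - t\<^sup>2 * S * (C\<^sup>2 - 1)"
    using uC by (smt (verit))
  then show ?thesis
    unfolding radius_cdf_dt_def S_def[symmetric] C_def[symmetric] using killed_kernel_pos[OF t(1), of u] t
    by (simp add: zero_less_mult_iff)
qed

lemma radius_cdf_strict_antimono_time:
  assumes "0 < s" "s < t" "t \<le> 1" "0 < u" shows "radius_cdf t u < radius_cdf s u"
proof -
  have "- radius_cdf s u < - radius_cdf t u"
  proof (rule DERIV_pos_imp_increasing[OF assms(2), of "\<lambda>t. - radius_cdf t u"])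
    fix x assume x: "s \<le> x" "x \<le> t"
    show "\<exists>y. ((\<lambda>t. - radius_cdf t u) has_real_derivative y) (at x) \<and> 0 < y"
      using DERIV_minus[OF radius_cdf_deriv_time[of x u]] radius_cdf_dt_neg[of x u] x assms
      by (intro exI[of _ "- radius_cdf_dt x u"]) auto
  qed
  then show ?thesis by simp
qed

section \<open>Mixtures of uniform laws on symmetric intervals\<close>

lemma nn_integral_tanh:
  fixes f :: "real \<Rightarrow> ennreal"
  assumes f[measurable]: "f \<in> borel_measurable borel" and U: "0 < U"
  shows "(\<integral>\<^sup>+z. f z * indicator {- tanh U..tanh U} z \<partial>lborel)
    = (\<integral>\<^sup>+u. f (tanh u) * ennreal (1 / (cosh u)\<^sup>2) * indicator {- U..U} u \<partial>lborel)"
proof -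
  have "(\<integral>\<^sup>+z. f z * indicator {tanh (- U)..tanh U} z \<partial>lborel)
    = (\<integral>\<^sup>+u. f (tanh u) * ennreal (1 / (cosh u)\<^sup>2) * indicator {- U..U} u \<partial>lborel)"
  proof (rule nn_integral_substitution_aux[where g = tanh])
    show "(tanh has_real_derivative 1 / (cosh x)\<^sup>2) (at x)" for x :: real
    proof -
      have "1 - (tanh x)\<^sup>2 = 1 / (cosh x)\<^sup>2"
      proof -
        have "1 - (tanh x)\<^sup>2 = ((cosh x)\<^sup>2 - (sinh x)\<^sup>2) / (cosh x)\<^sup>2"
          by (simp add: tanh_def power_divide diff_divide_distrib)
        then show ?thesis by (simp add: cosh_square_eq)
      qed
      then show ?thesis
        by (auto intro!: derivative_eq_intros)
    qed
    show "continuous_on {- U..U} (\<lambda>x. 1 / (cosh x)\<^sup>2)"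
      by (auto intro!: continuous_intros)
  qed (use U in auto)
  then show ?thesis by simp
qed

lemma nn_integral_scale:
  fixes f :: "real \<Rightarrow> ennreal"
  assumes f[measurable]: "f \<in> borel_measurable borel" and R: "0 < R"
  shows "(\<integral>\<^sup>+z. f z * indicator {- R..R} z \<partial>lborel)
    = ennreal R * (\<integral>\<^sup>+x. f (R * x) * indicator {- 1..1} x \<partial>lborel)"
proof -
  have "(\<integral>\<^sup>+z. f z * indicator {- R..R} z \<partial>lborel)
    = \<bar>R\<bar> * (\<integral>\<^sup>+x. f (0 + R * x) * indicator {- R..R} (0 + R * x) \<partial>lborel)"
    by (rule nn_integral_real_affine) (use R in auto)
  also have "(\<lambda>x. indicator {- R..R} (0 + R * x) :: ennreal) = indicator {- 1..1}"
  proof -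
    have "(- R \<le> R * x) = (- 1 \<le> x)" "(R * x \<le> R) = (x \<le> 1)" for x
      using mult_le_cancel_left_pos[OF R, of "- 1" x] mult_le_cancel_left_pos[OF R, of x 1] by auto
    then show ?thesis by (auto simp: indicator_def fun_eq_iff)
  qed
  finally show ?thesis using R by simp
qed

lemma nn_integral_uniform_tanh:
  fixes g :: "real \<Rightarrow> ennreal"
  assumes g[measurable]: "g \<in> borel_measurable borel" and U: "0 < U"
  shows "(\<integral>\<^sup>+x. g (tanh U * x) * indicator {- 1..1} x \<partial>lborel)
    = ennreal (1 / tanh U) * (\<integral>\<^sup>+u. g (tanh u) * ennreal (1 / (cosh u)\<^sup>2) * indicator {- U..U} u \<partial>lborel)"
proof -
  have "ennreal (1 / tanh U) * (ennreal (tanh U) * (\<integral>\<^sup>+x. g (tanh U * x) * indicator {- 1..1} x \<partial>lborel))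
    = (\<integral>\<^sup>+x. g (tanh U * x) * indicator {- 1..1} x \<partial>lborel)"
    using U by (simp add: mult.assoc[symmetric] ennreal_mult[symmetric])
  then show ?thesis
    using nn_integral_tanh[OF g U] nn_integral_scale[OF g, of "tanh U"] U by simp
qed

definition uniform_mean :: "(real \<Rightarrow> ennreal) \<Rightarrow> ennreal" where
  "uniform_mean g = ennreal (1 / 2) * (\<integral>\<^sup>+x. g x * indicator {- 1..1} x \<partial>lborel)"

text \<open>Khinchine's decomposition: the law of tanh under \<open>2 cosh u killed_kernel t u du\<close> is a mixture of uniform laws on
  symmetric intervals.\<close>

lemma nn_integral_mixture:
  fixes g :: "real \<Rightarrow> ennreal"
  assumes t: "0 < t" "t \<le> 1" and g[measurable]: "g \<in> borel_measurable borel"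
  shows "(\<integral>\<^sup>+s. ennreal (radius_density t s) * indicator {0<..} s * uniform_mean (\<lambda>x. g (tanh s * x)) \<partial>lborel)
    = (\<integral>\<^sup>+u. g (tanh u) * ennreal (2 * cosh u * killed_kernel t u) \<partial>lborel)"
proof -
  let ?h = "\<lambda>u. g (tanh u) * ennreal (1 / (cosh u)\<^sup>2)"
  have "(\<integral>\<^sup>+s. ennreal (radius_density t s) * indicator {0<..} s * uniform_mean (\<lambda>x. g (tanh s * x)) \<partial>lborel)
    = (\<integral>\<^sup>+s. \<integral>\<^sup>+u. ?h u * (ennreal (tanh_density_slope t s) * indicator {\<bar>u\<bar>..} s) \<partial>lborel \<partial>lborel)"
  proof (rule nn_integral_cong)
    fix s :: real
    show "ennreal (radius_density t s) * indicator {0<..} s * uniform_mean (\<lambda>x. g (tanh s * x))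
      = (\<integral>\<^sup>+u. ?h u * (ennreal (tanh_density_slope t s) * indicator {\<bar>u\<bar>..} s) \<partial>lborel)"
    proof (cases "0 < s")
      case True
      have i: "indicator {\<bar>u\<bar>..} s = (indicator {- s..s} u :: ennreal)" for u
        by (auto simp: indicator_def)
      have "ennreal (radius_density t s) * indicator {0<..} s * uniform_mean (\<lambda>x. g (tanh s * x))
        = ennreal (radius_density t s) * (ennreal (1/2) * (ennreal (1 / tanh s) * (\<integral>\<^sup>+u. ?h u * indicator {- s..s} u \<partial>lborel)))"
        unfolding uniform_mean_def nn_integral_uniform_tanh[OF g True] using True by simp
      also have "\<dots> = ennreal (radius_density t s * (1/2) * (1 / tanh s)) * (\<integral>\<^sup>+u. ?h u * indicator {- s..s} u \<partial>lborel)"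
      proof -
        have "0 \<le> radius_density t s" using True tanh_density_slope_nonneg[of t s] t by (simp add: radius_density_def)
        then have "ennreal (radius_density t s * (1/2) * (1 / tanh s)) = ennreal (radius_density t s) * ennreal (1/2) * ennreal (1 / tanh s)"
          by (subst ennreal_mult', simp)+ (rule refl)
        then show ?thesis by (simp only: mult.assoc)
      qed
      also have "radius_density t s * (1/2) * (1 / tanh s) = tanh_density_slope t s" using True by (simp add: radius_density_def)
      also have "ennreal (tanh_density_slope t s) * (\<integral>\<^sup>+u. ?h u * indicator {- s..s} u \<partial>lborel)
         = (\<integral>\<^sup>+u. ennreal (tanh_density_slope t s) * (?h u * indicator {- s..s} u) \<partial>lborel)"
        by (rule nn_integral_cmult[symmetric]) simp
      finally show ?thesis unfolding i by (simp add: mult_ac)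
    next
      case False
      have z: "?h u * (ennreal (tanh_density_slope t s) * indicator {\<bar>u\<bar>..} s) = 0" for u
        using False by (cases "s = 0") (auto simp: tanh_density_slope_def indicator_def)
      show ?thesis unfolding z using False by simp
    qed
  qed
  \<comment> \<open>Fubini on the region \<open>\<bar>u\<bar> \<le> s\<close>: the slope integrated
    over \<open>s\<close> from \<open>\<bar>u\<bar>\<close> to infinity gives back the density at
    \<open>u\<close>.\<close>
  also have "\<dots> = (\<integral>\<^sup>+u. \<integral>\<^sup>+s. ?h u * (ennreal (tanh_density_slope t s) * indicator {\<bar>u\<bar>..} s) \<partial>lborel \<partial>lborel)"
  proof (rule lborel_pair.Fubini')
    have i: "indicator {\<bar>u\<bar>..} s = (indicator {0..} (s - \<bar>u\<bar>) :: ennreal)" for s u :: real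
      by (auto simp: indicator_def)
    show "(\<lambda>(u, s). ?h u * (ennreal (tanh_density_slope t s) * indicator {\<bar>u\<bar>..} s)) \<in> borel_measurable (lborel \<Otimes>\<^sub>M lborel)"
      unfolding i by measurable
  qed
  also have "\<dots> = (\<integral>\<^sup>+u. ?h u * ennreal (tanh_density t \<bar>u\<bar>) \<partial>lborel)"
    by (rule nn_integral_cong) (subst nn_integral_cmult; simp add: nn_integral_tanh_density_slope[OF t])
  also have "\<dots> = (\<integral>\<^sup>+u. g (tanh u) * ennreal (2 * cosh u * killed_kernel t u) \<partial>lborel)"
  proof (rule nn_integral_cong)
    fix u :: real
    have "1 / (cosh u)\<^sup>2 * tanh_density t \<bar>u\<bar> = 2 * cosh u * killed_kernel t u"
      using cosh_real_pos[of u] by (cases "0 \<le> u") (simp_all add: tanh_density_def field_simps power2_eq_square power3_eq_cube)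
    then show "?h u * ennreal (tanh_density t \<bar>u\<bar>) = g (tanh u) * ennreal (2 * cosh u * killed_kernel t u)"
      using killed_kernel_pos[OF t(1), of "\<bar>u\<bar>"] by (simp add: mult.assoc ennreal_mult''[symmetric] tanh_density_def)
  qed
  finally show ?thesis .
qed

text \<open>The Gaussian is the law of half of \<open>ln P\<close> at time \<open>t\<close>, and the
  factor \<open>1 - tanh u\<close> undoes the change of measure. Through this identity statements
  about \<open>Z\<close> return to \<open>P\<close>.\<close>

lemma normal_density_eq_killed_kernel:
  assumes t: "0 < t"
  shows "normal_density (- t / 4) (sqrt t / 2) u = (1 - tanh u) * (2 * cosh u * killed_kernel t u)"
proof -
  have "normal_density (- t / 4) (sqrt t / 2) u = 2 * exp (- u) * killed_kernel t u"
  proof -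
    have "- (u - - t / 4)\<^sup>2 / (2 * (sqrt t / 2)\<^sup>2) = - u + (- t / 8 + - 2 * u\<^sup>2 / t)"
      using t by (simp add: field_simps power2_eq_square power_divide)
    moreover have "sqrt (2 * pi * (sqrt t / 2)\<^sup>2) = sqrt (2 * pi * t) / 2"
    proof -
      have "2 * pi * (sqrt t / 2)\<^sup>2 = 2 * pi * t / 2\<^sup>2" using t by (simp add: power_divide)
      then show ?thesis by (simp only: real_sqrt_divide real_sqrt_abs)
    qed
    ultimately show ?thesis unfolding normal_density_def killed_kernel_def by (simp only: exp_add) (simp add: mult_ac)
  qed
  also have "exp (- u) = (1 - tanh u) * cosh u"
    using cosh_real_pos[of u] by (simp add: tanh_def left_diff_distrib cosh_minus_sinh)
  finally show ?thesis by simp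
qed

text \<open>Averaging the Gaussian with its reflection removes the odd part of
  \<open>1 - tanh u\<close>, so the total mass is that of the Gaussian.\<close>

lemma nn_integral_cosh_killed_kernel:
  assumes t: "0 < t"
  shows "(\<integral>\<^sup>+u. ennreal (2 * cosh u * killed_kernel t u) \<partial>lborel) = 1"
proof -
  have n: "2 * cosh u * killed_kernel t u = normal_density (- t / 4) (sqrt t / 2) u / 2 + normal_density (- t / 4) (sqrt t / 2) (- u) / 2" for u
    unfolding normal_density_eq_killed_kernel[OF t] by (simp add: field_simps)
  have 1: "(\<integral>\<^sup>+u. ennreal (normal_density (- t / 4) (sqrt t / 2) u) \<partial>lborel) = 1"
    using prob_space.emeasure_space_1[OF prob_space_normal_density[of "sqrt t / 2" "- t / 4"]] t
    by (simp add: emeasure_density)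
  have 2: "(\<integral>\<^sup>+u. ennreal (normal_density (- t / 4) (sqrt t / 2) (- u)) \<partial>lborel) = 1"
    using nn_integral_real_affine[of "\<lambda>u. ennreal (normal_density (- t / 4) (sqrt t / 2) u)" "-1" 0] 1 by simp
  have "(\<integral>\<^sup>+u. ennreal (2 * cosh u * killed_kernel t u) \<partial>lborel)
     = (\<integral>\<^sup>+u. ennreal (1/2) * ennreal (normal_density (- t / 4) (sqrt t / 2) u) + ennreal (1/2) * ennreal (normal_density (- t / 4) (sqrt t / 2) (- u)) \<partial>lborel)"
  proof (rule nn_integral_cong)
    fix u
    have "ennreal (a / 2 + b / 2) = ennreal (1/2) * ennreal a + ennreal (1/2) * ennreal b"
      if "0 \<le> a" "0 \<le> b" for a b :: real
      using that by (subst (1 2) ennreal_mult'[symmetric]) (auto simp flip: ennreal_plus)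
    then show "ennreal (2 * cosh u * killed_kernel t u) = ennreal (1/2) * ennreal (normal_density (- t / 4) (sqrt t / 2) u)
        + ennreal (1/2) * ennreal (normal_density (- t / 4) (sqrt t / 2) (- u))"
      unfolding n by simp
  qed
  also have "\<dots> = ennreal (1/2) + ennreal (1/2)"
    by (subst nn_integral_add, simp, simp, subst (1 2) nn_integral_cmult, simp, simp, unfold 1 2, simp)
  also have "\<dots> = 1" by (subst ennreal_plus[symmetric]) simp_all
  finally show ?thesis .
qed

section \<open>Radius laws and their quantile functions\<close>

definition radius_law :: "real \<Rightarrow> real measure" where
  "radius_law t = density lborel (\<lambda>s. ennreal (radius_density t s) * indicator {0<..} s)"

lemma sets_radius_law[simp, measurable_cong]: "sets (radius_law t) = sets borel" by (simp add: radius_law_def)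

lemma space_radius_law[simp]: "space (radius_law t) = UNIV" by (simp add: radius_law_def)

lemma uniform_mean_const: "uniform_mean (\<lambda>x. c) = c"
proof -
  have "uniform_mean (\<lambda>x. c) = ennreal (1/2) * (c * 2)"
    unfolding uniform_mean_def by (simp add: nn_integral_cmult)
  also have "\<dots> = c * (ennreal (1/2) * ennreal 2)" by (simp add: mult_ac)
  also have "ennreal (1/2) * ennreal 2 = ennreal ((1/2) * 2)" by (rule ennreal_mult'[symmetric]) simp
  finally show ?thesis by simp
qed

lemma real_distribution_radius_law:
  assumes t: "0 < t" "t \<le> 1" shows "real_distribution (radius_law t)"
proof -
  have "emeasure (radius_law t) (space (radius_law t)) = 1"
    unfolding radius_law_def
    using nn_integral_mixture[OF t, of "\<lambda>_. 1"] nn_integral_cosh_killed_kernel[OF t(1)]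
    by (simp add: emeasure_density uniform_mean_const)
  then show ?thesis
    by (intro real_distribution.intro prob_spaceI real_distribution_axioms.intro) auto
qed

lemma cdf_radius_law:
  assumes t: "0 < t" "t \<le> 1"
  shows "cdf (radius_law t) x = (if x \<le> 0 then 0 else radius_cdf t x)"
proof (cases "x \<le> 0")
  case True
  have z: "ennreal (radius_density t s) * indicator {0<..} s * indicator {..x} s = 0" for s
    using True by (auto simp: indicator_def)
  have "emeasure (radius_law t) {..x} = 0"
    unfolding radius_law_def by (subst emeasure_density) (auto simp only: z nn_integral_const mult_zero_left, auto)
  then show ?thesis using True by (simp add: cdf_def measure_def)
next
  case False
  have nn: "0 \<le> radius_density t s" if "0 \<le> s" for s using tanh_density_slope_nonneg[OF t that] that by (simp add: radius_density_def)
  have "radius_cdf t 0 \<le> radius_cdf t x"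
    by (rule DERIV_nonneg_imp_nondecreasing) (use False radius_cdf_deriv[OF t(1)] nn in \<open>auto intro!: exI\<close>)
  have "emeasure (radius_law t) {..x} = (\<integral>\<^sup>+s. ennreal (radius_density t s) * indicator {0..x} s \<partial>lborel)"
    unfolding radius_law_def
    by (subst emeasure_density) (auto intro!: nn_integral_cong simp: indicator_def radius_density_def)
  also have "\<dots> = ennreal (radius_cdf t x - radius_cdf t 0)"
    by (rule nn_integral_FTC_Icc)
       (use False nn radius_cdf_deriv[OF t(1)] in \<open>auto simp: has_field_derivative_at_within\<close>)
  finally show ?thesis using False \<open>radius_cdf t 0 \<le> radius_cdf t x\<close> by (simp add: cdf_def measure_def)
qed

lemma radius_cdf_strict_mono: assumes t: "0 < t" "t \<le> 1" and "0 \<le> x" "x < y" shows "radius_cdf t x < radius_cdf t y"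
proof (rule DERIV_pos_imp_increasing_open[OF assms(4)])
  fix u assume "x < u" "u < y"
  then show "\<exists>y. (radius_cdf t has_real_derivative y) (at u) \<and> 0 < y"
    using radius_cdf_deriv[OF t(1), of u] tanh_density_slope_pos[OF t, of u] assms(3) by (intro exI[of _ "radius_density t u"]) (auto simp: radius_density_def)
qed (use radius_cdf_deriv[OF t(1)] in \<open>meson DERIV_isCont continuous_at_imp_continuous_on\<close>)

text \<open>The default 1 outside \<open>{0<..<1}\<close> is positive and independent of
  \<open>t\<close>, so positivity and monotonicity in time hold for every real
  \<open>h\<close>.\<close>

definition radius_quantile :: "real \<Rightarrow> real \<Rightarrow> real" where
  "radius_quantile t h = (if h \<in> {0<..<1} then Inf {x. h \<le> cdf (radius_law t) x} else 1)"

context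
  fixes t h :: real
  assumes t: "0 < t" "t \<le> 1" and h: "0 < h" "h < 1"
begin

lemma radius_quantile_le_iff: "radius_quantile t h \<le> x \<longleftrightarrow> h \<le> cdf (radius_law t) x"
proof -
  interpret R: real_distribution "radius_law t" by (rule real_distribution_radius_law[OF t])
  interpret cdf_distribution "radius_law t" ..
  show ?thesis using pseudoinverse[of h x] h by (simp add: radius_quantile_def)
qed

lemma radius_quantile_pos: "0 < radius_quantile t h"
  using radius_quantile_le_iff[of 0] h cdf_radius_law[OF t, of 0] by simp

text \<open>One inequality is the Galois connection at the quantile itself; the other is a limit
  from the left, by continuity of \<open>radius_cdf\<close> in the space variable.\<close>

lemma radius_cdf_radius_quantile: "radius_cdf t (radius_quantile t h) = h"
proof (rule antisym)
  show "h \<le> radius_cdf t (radius_quantile t h)"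
    using radius_quantile_le_iff[of "radius_quantile t h"] radius_quantile_pos cdf_radius_law[OF t, of "radius_quantile t h"] by simp
  have "((\<lambda>x. radius_cdf t x) \<longlongrightarrow> radius_cdf t (radius_quantile t h)) (at_left (radius_quantile t h))"
    using DERIV_isCont[OF radius_cdf_deriv[OF t(1)], unfolded isCont_def]
    by (rule tendsto_within_subset) simp
  moreover have "eventually (\<lambda>x. radius_cdf t x \<le> h) (at_left (radius_quantile t h))"
  proof -
    have "eventually (\<lambda>x. x \<in> {0<..<radius_quantile t h}) (at_left (radius_quantile t h))"
      using radius_quantile_pos by (rule eventually_at_leftI[rotated]) auto
    then show ?thesis
    proof eventually_elim
      case (elim x)
      then show ?case using radius_quantile_le_iff[of x] cdf_radius_law[OF t, of x] by auto
    qed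
  qed
  ultimately show "radius_cdf t (radius_quantile t h) \<le> h"
    by (rule tendsto_upperbound) simp
qed

end

text \<open>A distribution function that decreases strictly in time pushes its quantiles to the
  right. This growth lets the rotation clock run forward.\<close>

lemma radius_quantile_strict_mono_time:
  assumes "0 < s" "s < t" "t \<le> 1" "0 < h" "h < 1" shows "radius_quantile s h < radius_quantile t h"
proof -
  have "radius_cdf t (radius_quantile s h) < radius_cdf s (radius_quantile s h)"
    using assms by (intro radius_cdf_strict_antimono_time radius_quantile_pos) auto
  then have "cdf (radius_law t) (radius_quantile s h) < h"
    using assms radius_cdf_radius_quantile[of s h] radius_quantile_pos[of s h] by (simp add: cdf_radius_law)
  then show ?thesis using radius_quantile_le_iff[of t h "radius_quantile s h"] assms by auto
qed

text \<open>A quantile lies between two points once the distribution function is below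
  \<open>h\<close> at the left one and above \<open>h\<close> at the right one. Strictness in space
  gives these inequalities at time \<open>t\<close>, and continuity in time carries them to nearby
  times.\<close>

lemma radius_quantile_continuous:
  assumes h: "0 < h" "h < 1" shows "continuous_on {0<..1} (\<lambda>t. radius_quantile t h)"
  unfolding continuous_on_def
proof
  fix t :: real assume t': "t \<in> {0<..1}" then have t: "0 < t" "t \<le> 1" by auto
  have ev: "eventually (\<lambda>s. 0 < s \<and> s \<le> 1) (at t within {0<..1})"
    by (auto simp: eventually_at_filter)
  have lim: "((\<lambda>s. radius_cdf s x) \<longlongrightarrow> radius_cdf t x) (at t within {0<..1})" for x
    using DERIV_isCont[OF radius_cdf_deriv_time[OF t(1), of x], unfolded isCont_def]
    by (rule tendsto_within_subset) simp
  show "((\<lambda>t. radius_quantile t h) \<longlongrightarrow> radius_quantile t h) (at t within {0<..1})"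
  proof (rule order_tendstoI)
    fix a assume a: "a < radius_quantile t h"
    show "eventually (\<lambda>s. a < radius_quantile s h) (at t within {0<..1})"
    proof (cases "0 < a")
      case True
      then have "radius_cdf t a < h" using radius_cdf_strict_mono[OF t, of a "radius_quantile t h"] a radius_cdf_radius_quantile[OF t h] by simp
      from order_tendstoD(2)[OF lim this] ev show ?thesis
      proof eventually_elim
        case (elim s)
        then show ?case using radius_quantile_le_iff[of s h a] h True by (auto simp: cdf_radius_law not_le[symmetric])
      qed
    next
      case False
      from ev show ?thesis
      proof eventually_elim
        case (elim s)
        then show ?case using radius_quantile_pos[of s h] h False by auto
      qed
    qed
  next
    fix a assume a: "radius_quantile t h < a"
    obtain b where b: "radius_quantile t h < b" "b < a" using a dense by blast
    have "0 < b" using radius_quantile_pos[OF t h] b by simp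
    have "h < radius_cdf t b" using radius_cdf_strict_mono[OF t _ b(1)] radius_quantile_pos[OF t h] radius_cdf_radius_quantile[OF t h] by simp
    from order_tendstoD(1)[OF lim this] ev show "eventually (\<lambda>s. radius_quantile s h < a) (at t within {0<..1})"
    proof eventually_elim
      case (elim s)
      then have "radius_quantile s h \<le> b" using radius_quantile_le_iff[of s h b] h \<open>0 < b\<close> by (auto simp: cdf_radius_law)
      then show ?case using b by simp
    qed
  qed
qed

lemma radius_quantile_measurable[measurable]:
  assumes t: "0 < t" "t \<le> 1" shows "radius_quantile t \<in> borel_measurable borel"
proof -
  interpret R: real_distribution "radius_law t" by (rule real_distribution_radius_law[OF t])
  interpret cdf_distribution "radius_law t" ..
  have "(\<lambda>h. indicator {0<..<1} h *\<^sub>R I h) \<in> borel_measurable borel"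
    using measurable_CI by (subst (asm) borel_measurable_restrict_space_iff) auto
  then have "(\<lambda>h. indicator {0<..<1} h *\<^sub>R I h + (1 - indicator {0<..<1} h)) \<in> borel_measurable borel"
    by simp
  moreover have "radius_quantile t = (\<lambda>h. indicator {0<..<1} h *\<^sub>R I h + (1 - indicator {0<..<1} h))"
    by (auto simp: radius_quantile_def fun_eq_iff indicator_def)
  ultimately show ?thesis by simp
qed

abbreviation U01 :: "real measure" where "U01 \<equiv> restrict_space lborel {0<..<1}"

lemma prob_space_U01: "prob_space U01"
  by (auto simp: emeasure_restrict_space space_restrict_space intro!: prob_spaceI)

lemma distr_radius_quantile:
  assumes t: "0 < t" "t \<le> 1" shows "distr U01 borel (radius_quantile t) = radius_law t"
proof -
  interpret R: real_distribution "radius_law t" by (rule real_distribution_radius_law[OF t])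
  interpret cdf_distribution "radius_law t" ..
  have "distr U01 borel (radius_quantile t) = distr U01 borel I"
    by (rule distr_cong) (auto simp: radius_quantile_def space_restrict_space)
  then show ?thesis using distr_I_eq_M by simp
qed

lemma uniform_mean_measurable:
  fixes g :: "'b \<Rightarrow> real \<Rightarrow> ennreal"
  assumes [measurable]: "case_prod g \<in> borel_measurable (N \<Otimes>\<^sub>M borel)"
  shows "(\<lambda>y. uniform_mean (g y)) \<in> borel_measurable N"
  unfolding uniform_mean_def by measurable

lemma nn_integral_radius_quantile:
  fixes g :: "real \<Rightarrow> ennreal"
  assumes t: "0 < t" "t \<le> 1" and g[measurable]: "g \<in> borel_measurable borel"
  shows "(\<integral>\<^sup>+h. uniform_mean (\<lambda>x. g (tanh (radius_quantile t h) * x)) \<partial>U01)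
    = (\<integral>\<^sup>+u. g (tanh u) * ennreal (2 * cosh u * killed_kernel t u) \<partial>lborel)"
proof -
  have m[measurable]: "(\<lambda>s. uniform_mean (\<lambda>x. g (tanh s * x))) \<in> borel_measurable borel"
    by (rule uniform_mean_measurable) measurable
  have "(\<integral>\<^sup>+h. uniform_mean (\<lambda>x. g (tanh (radius_quantile t h) * x)) \<partial>U01)
    = (\<integral>\<^sup>+s. uniform_mean (\<lambda>x. g (tanh s * x)) \<partial>distr U01 borel (radius_quantile t))"
    using radius_quantile_measurable[OF t] by (subst nn_integral_distr) (auto intro: measurable_restrict_space1)
  also have "\<dots> = (\<integral>\<^sup>+s. ennreal (radius_density t s) * indicator {0<..} s * uniform_mean (\<lambda>x. g (tanh s * x)) \<partial>lborel)"
    unfolding distr_radius_quantile[OF t] radius_law_def by (subst nn_integral_density) auto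
  finally show ?thesis using nn_integral_mixture[OF t g] by simp
qed

section \<open>Rotation invariance of the uniform law\<close>

text \<open>For a law on \<open>[-1, 1]\<close> the Taylor remainder of the characteristic function
  is at most \<open>2 * \<bar>t\<bar> ^ n / fact n\<close>, which tends to 0 for every
  \<open>t\<close>; so the moments determine the characteristic function.\<close>

lemma bounded_moments_unique:
  assumes M: "real_distribution M" and N: "real_distribution N"
    and bM: "AE x in M. \<bar>x\<bar> \<le> 1" and bN: "AE x in N. \<bar>x\<bar> \<le> 1"
    and eq: "\<And>k. (\<integral>x. x ^ k \<partial>M) = (\<integral>x. x ^ k \<partial>N)"
  shows "M = N"
proof (rule Levy_uniqueness[OF M N], rule ext)
  fix t :: real
  have approx: "cmod (char L t - (\<Sum>k\<le>n. ((\<i> * t) ^ k / fact k) * (\<integral>x. x ^ k \<partial>L))) \<le> 2 * \<bar>t\<bar> ^ n / fact n"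
    if L: "real_distribution L" and b: "AE x in L. \<bar>x\<bar> \<le> 1" for L n
  proof -
    interpret real_distribution L by fact
    have i: "integrable L (\<lambda>x. x ^ k)" for k
      by (rule integrable_const_bound[where B = 1])
         (use b in \<open>auto simp: power_abs power_le_one elim!: eventually_mono\<close>)
    have "(\<integral>x. \<bar>x\<bar> ^ n \<partial>L) \<le> (\<integral>x. 1 \<partial>L)"
      by (rule integral_mono_AE) (use b i[of n, THEN integrable_abs] in \<open>auto simp: power_abs power_le_one elim!: eventually_mono\<close>)
    then have "(2 * \<bar>t\<bar> ^ n / fact n) * (\<integral>x. \<bar>x\<bar> ^ n \<partial>L) \<le> (2 * \<bar>t\<bar> ^ n / fact n) * 1"
      using prob_space by (intro mult_left_mono) auto
    then show ?thesis using char_approx1[of n t] i by (smt (verit) mult.right_neutral)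
  qed
  have "cmod (char M t - char N t) \<le> 4 * (\<bar>t\<bar> ^ n / fact n)" for n
    using approx[OF M bM, of n] approx[OF N bN, of n] norm_triangle_ineq4[of
      "char M t - (\<Sum>k\<le>n. ((\<i> * t) ^ k / fact k) * (\<integral>x. x ^ k \<partial>M))"
      "char N t - (\<Sum>k\<le>n. ((\<i> * t) ^ k / fact k) * (\<integral>x. x ^ k \<partial>M))"]
    by (simp add: eq)
  moreover have "(\<lambda>n. 4 * (\<bar>t\<bar> ^ n / fact n)) \<longlonglongrightarrow> 4 * 0"
    using summable_LIMSEQ_zero[OF summable_exp_generic[of "\<bar>t\<bar>"]]
    by (intro tendsto_mult_left) (simp add: field_simps)
  ultimately have "cmod (char M t - char N t) \<le> 4 * 0"
    by (intro LIMSEQ_le_const) auto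
  then show "char M t = char N t" by simp
qed

section \<open>Moments of the two coordinates of a uniform point of the sphere\<close>

definition cos_moment :: "nat \<Rightarrow> real" where
  "cos_moment k = (\<integral>v. cos (pi * v) ^ k \<partial>U01)"

definition uniform_pm :: "real measure" where
  "uniform_pm = density lborel (\<lambda>x. ennreal (indicator {- 1..1} x / 2))"

definition interval_moment :: "nat \<Rightarrow> nat \<Rightarrow> real" where
  "interval_moment i j = (\<integral>x. x ^ i * (1 - x\<^sup>2) ^ j \<partial>uniform_pm)"

lemma sets_uniform_pm[simp, measurable_cong]: "sets uniform_pm = sets borel" by (simp add: uniform_pm_def)
lemma space_uniform_pm[simp]: "space uniform_pm = UNIV" by (simp add: uniform_pm_def)

lemma nn_integral_uniform_pm:
  assumes [measurable]: "g \<in> borel_measurable borel"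
  shows "(\<integral>\<^sup>+x. g x \<partial>uniform_pm) = uniform_mean g"
proof -
  have "(\<integral>\<^sup>+x. g x \<partial>uniform_pm) = (\<integral>\<^sup>+x. ennreal (1/2) * (g x * indicator {- 1..1} x) \<partial>lborel)"
    unfolding uniform_pm_def by (subst nn_integral_density) (auto intro!: nn_integral_cong simp: indicator_def)
  then show ?thesis unfolding uniform_mean_def by (subst (asm) nn_integral_cmult) auto
qed

lemma prob_space_uniform_pm: "prob_space uniform_pm"
  using nn_integral_uniform_pm[of "\<lambda>_. 1"] uniform_mean_const[of 1] by (auto intro!: prob_spaceI)

lemma AE_uniform_pm: "AE x in uniform_pm. \<bar>x\<bar> \<le> 1"
  unfolding uniform_pm_def by (subst AE_density) (auto simp: indicator_def)

lemma integral_uniform_pm: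
  fixes f :: "real \<Rightarrow> real"
  assumes [measurable]: "f \<in> borel_measurable borel"
  shows "(\<integral>x. f x \<partial>uniform_pm) = (\<integral>x. f x * indicator {- 1..1} x \<partial>lborel) / 2"
  unfolding uniform_pm_def by (subst integral_density) (auto simp: mult_ac)

lemma integral_U01:
  fixes f :: "real \<Rightarrow> real"
  assumes [measurable]: "f \<in> borel_measurable borel"
  shows "(\<integral>x. f x \<partial>U01) = (\<integral>x. f x * indicator {0..1} x \<partial>lborel)"
proof -
  have "(\<integral>x. f x \<partial>U01) = (\<integral>x. indicator {0<..<1} x *\<^sub>R f x \<partial>lborel)"
    by (rule integral_restrict_space) simp
  also have "\<dots> = (\<integral>x. f x * indicator {0..1} x \<partial>lborel)"
  proof (rule integral_cong_AE)
    have "AE x in lborel. x \<notin> {0, 1::real}"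
      by (intro AE_not_in) (auto intro: finite_imp_null_set_lborel)
    then show "AE x in lborel. indicator {0<..<1} x *\<^sub>R f x = f x * indicator {0..1} x"
      by eventually_elim (auto simp: indicator_def)
  qed auto
  finally show ?thesis .
qed

lemma cos_moment_0: "cos_moment 0 = 1"
  using prob_space.prob_space[OF prob_space_U01] by (simp add: cos_moment_def)

lemma cos_moment_1: "cos_moment 1 = 0"
proof -
  have "(\<integral>v. cos (pi * v) * indicator {0..1} v \<partial>lborel) = sin (pi * 1) / pi - sin (pi * 0) / pi"
    by (rule integral_FTC_Icc_real)
       (auto intro!: derivative_eq_intros continuous_intros)
  then show ?thesis unfolding cos_moment_def by (subst integral_U01) auto
qed

text \<open>Integration of the derivative of
  \<open>cos (pi * v) ^ (k + 1) * sin (pi * v) / pi\<close> over \<open>[0, 1]\<close>, where both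
  boundary values vanish.\<close>

lemma cos_moment_rec: "real (k + 2) * cos_moment (k + 2) = real (k + 1) * cos_moment k"
proof -
  interpret U: prob_space U01 by (rule prob_space_U01)
  have i: "integrable U01 (\<lambda>v. cos (pi * v) ^ k)" for k
    by (rule U.integrable_const_bound[where B = 1])
       (auto simp: power_abs power_le_one intro!: measurable_restrict_space1)
  let ?f = "\<lambda>v. real (k + 2) * cos (pi * v) ^ (k + 2) - real (k + 1) * cos (pi * v) ^ k"
  have "(\<integral>v. ?f v * indicator {0..1} v \<partial>lborel)
    = cos (pi * 1) ^ (k + 1) * sin (pi * 1) / pi - cos (pi * 0) ^ (k + 1) * sin (pi * 0) / pi"
  proof (rule integral_FTC_Icc_real)
    fix v :: real
    have s: "(sin (pi * v))\<^sup>2 = 1 - (cos (pi * v))\<^sup>2" by (simp add: sin_squared_eq)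
    have "((\<lambda>v. cos (pi * v) ^ (k + 1) * sin (pi * v) / pi) has_real_derivative
       cos (pi * v) ^ (k + 1) * cos (pi * v) - real (k + 1) * cos (pi * v) ^ k * (sin (pi * v))\<^sup>2) (at v)"
    proof -
      have "((\<lambda>v. cos (pi * v) ^ Suc k) has_real_derivative (1 + real k) * ((- sin (pi * v) * pi) * cos (pi * v) ^ k)) (at v)"
        by (rule DERIV_power_Suc) (auto intro!: derivative_eq_intros)
      moreover have "((\<lambda>v. sin (pi * v) / pi) has_real_derivative cos (pi * v)) (at v)"
        by (auto intro!: derivative_eq_intros)
      ultimately have "((\<lambda>v. cos (pi * v) ^ Suc k * (sin (pi * v) / pi)) has_real_derivative
         (1 + real k) * ((- sin (pi * v) * pi) * cos (pi * v) ^ k) * (sin (pi * v) / pi) + cos (pi * v) * cos (pi * v) ^ Suc k) (at v)"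
        by (rule DERIV_mult)
      moreover have "(1 + real k) * ((- sin (pi * v) * pi) * cos (pi * v) ^ k) * (sin (pi * v) / pi) + cos (pi * v) * cos (pi * v) ^ Suc k
         = cos (pi * v) ^ (k + 1) * cos (pi * v) - real (k + 1) * cos (pi * v) ^ k * (sin (pi * v))\<^sup>2"
        by (simp add: algebra_simps power2_eq_square)
      ultimately show ?thesis by (simp only: Suc_eq_plus1 times_divide_eq_right)
    qed
    then show "((\<lambda>v. cos (pi * v) ^ (k + 1) * sin (pi * v) / pi) has_real_derivative ?f v) (at v)"
      unfolding s by (simp add: algebra_simps power2_eq_square)
  qed (auto intro!: continuous_intros)
  then have "(\<integral>v. ?f v \<partial>U01) = 0"
    by (subst integral_U01) auto
  moreover have "(\<integral>v. ?f v \<partial>U01) = real (k + 2) * cos_moment (k + 2) - real (k + 1) * cos_moment k"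
    unfolding cos_moment_def
    by (subst Bochner_Integration.integral_diff)
       (intro integrable_mult_right i, intro integrable_mult_right i, simp only: integral_mult_right_zero)
  ultimately show ?thesis by simp
qed

lemma cos_moment_odd: "cos_moment (2 * j + 1) = 0"
proof (induction j)
  case (Suc j)
  then show ?case using cos_moment_rec[of "2 * j + 1"] by simp
qed (use cos_moment_1 in simp)

lemma integrable_uniform_pm:
  fixes f :: "real \<Rightarrow> real"
  assumes [measurable]: "f \<in> borel_measurable borel" and "\<And>x. \<bar>x\<bar> \<le> 1 \<Longrightarrow> \<bar>f x\<bar> \<le> 1"
  shows "integrable uniform_pm f"
proof -
  interpret U: prob_space uniform_pm by (rule prob_space_uniform_pm)
  show ?thesis
    by (rule U.integrable_const_bound[where B = 1]) (use AE_uniform_pm assms in \<open>auto elim!: eventually_mono\<close>)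
qed

lemma abs_one_minus_sq: "\<bar>x\<bar> \<le> 1 \<Longrightarrow> \<bar>1 - x\<^sup>2\<bar> \<le> (1::real)"
  by (auto simp: abs_le_iff power_le_one abs_square_le_1)

lemma integrable_interval_moment: "integrable uniform_pm (\<lambda>x. x ^ i * (1 - x\<^sup>2) ^ j)"
  by (rule integrable_uniform_pm) (auto simp: abs_mult power_abs intro!: mult_le_one power_le_one abs_one_minus_sq)

text \<open>Integration of the derivative of \<open>x ^ (i + 1) * (1 - x^2) ^ (j + 1)\<close>, which
  vanishes at both endpoints. Each use trades a factor \<open>1 - x^2\<close> for
  \<open>x^2\<close>, so everything reduces to \<open>j = 0\<close>.\<close>

lemma interval_moment_rec: "real (i + 1) * interval_moment i (j + 1) = 2 * real (j + 1) * interval_moment (i + 2) j"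
proof -
  let ?f = "\<lambda>x::real. real (i + 1) * (x ^ i * (1 - x\<^sup>2) ^ (j + 1)) - 2 * real (j + 1) * (x ^ (i + 2) * (1 - x\<^sup>2) ^ j)"
  have "(\<integral>x. ?f x * indicator {- 1..1} x \<partial>lborel)
    = 1 ^ (i + 1) * (1 - 1\<^sup>2) ^ (j + 1) - (- 1) ^ (i + 1) * (1 - (- 1)\<^sup>2) ^ (j + 1)"
  proof (rule integral_FTC_Icc_real)
    fix x :: real
    show "((\<lambda>x. x ^ (i + 1) * (1 - x\<^sup>2) ^ (j + 1)) has_real_derivative ?f x) (at x)"
    proof -
      have "((\<lambda>x. x ^ Suc i) has_real_derivative (1 + real i) * (1 * x ^ i)) (at x)"
        by (rule DERIV_power_Suc) (rule DERIV_ident)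
      moreover have "((\<lambda>x. (1 - x\<^sup>2) ^ Suc j) has_real_derivative (1 + real j) * ((- 2 * x) * (1 - x\<^sup>2) ^ j)) (at x)"
        by (rule DERIV_power_Suc) (auto intro!: derivative_eq_intros)
      ultimately have "((\<lambda>x. x ^ Suc i * (1 - x\<^sup>2) ^ Suc j) has_real_derivative
         (1 + real i) * (1 * x ^ i) * (1 - x\<^sup>2) ^ Suc j + (1 + real j) * ((- 2 * x) * (1 - x\<^sup>2) ^ j) * x ^ Suc i) (at x)"
        by (rule DERIV_mult)
      moreover have "(1 + real i) * (1 * x ^ i) * (1 - x\<^sup>2) ^ Suc j + (1 + real j) * ((- 2 * x) * (1 - x\<^sup>2) ^ j) * x ^ Suc i = ?f x"
        by (simp add: algebra_simps power2_eq_square)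
      ultimately show ?thesis by (simp only: Suc_eq_plus1)
    qed
  qed (auto intro!: continuous_intros)
  then have "(\<integral>x. ?f x \<partial>uniform_pm) = 0"
    by (subst integral_uniform_pm) auto
  moreover have "(\<integral>x. ?f x \<partial>uniform_pm) = real (i + 1) * interval_moment i (j + 1) - 2 * real (j + 1) * interval_moment (i + 2) j"
    unfolding interval_moment_def by (subst Bochner_Integration.integral_diff) (auto intro!: integrable_mult_right integrable_interval_moment simp del: power_Suc)
  ultimately show ?thesis by simp
qed

lemma interval_moment_odd: "odd i \<Longrightarrow> interval_moment i 0 = 0"
proof -
  assume i: "odd i"
  have "(\<integral>x. x ^ i * indicator {- 1..1} x \<partial>lborel) = 1 ^ Suc i / real (Suc i) - (- 1) ^ Suc i / real (Suc i)"
    by (rule integral_FTC_Icc_real) (auto intro!: derivative_eq_intros continuous_intros simp del: power_Suc)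
  then show ?thesis using i unfolding interval_moment_def by (subst integral_uniform_pm) auto
qed

text \<open>Coefficient of \<open>cos w ^ (n - 2 * j) * sin w ^ (2 * j)\<close> in the
  \<open>n\<close>-th moment of the rotated coordinate. Odd powers of \<open>sin w\<close> drop out
  because odd moments of the cosine vanish, and even powers of the square root are
  polynomial.\<close>

definition rot_moment_term :: "nat \<Rightarrow> nat \<Rightarrow> real" where
  "rot_moment_term n j = real (n choose (2 * j)) * interval_moment (n - 2 * j) j * cos_moment (2 * j)"

lemma choose_two_step:
  "2 * j + 2 \<le> n \<Longrightarrow> real (n choose (2 * j + 2)) * real (2 * j + 2) * real (2 * j + 1)
    = real (n choose (2 * j)) * real (n - 2 * j) * real (n - 2 * j - 1)"
proof -
  assume n: "2 * j + 2 \<le> n"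
  have "(n choose (2 * j + 2)) * (2 * j + 2) = (n choose (2 * j + 1)) * (n - 2 * j - 1)"
    using binomial_absorb_comp[of n "2 * j + 1"] Suc_times_binomial_add[of "2*j+1" "n - 2 * j - 2"] n
      binomial_absorption[of "2*j+1" n] 
    by (simp add: mult.commute)
  moreover have "(n choose (2 * j + 1)) * (2 * j + 1) = (n choose (2 * j)) * (n - 2 * j)"
    using binomial_absorb_comp[of n "2 * j"] binomial_absorption[of "2*j" n]  n
    by (simp add: mult.commute)
  moreover have "x * a * b = z * r * p" if "x * a = y * p" "y * b = z * r" for x y z a b p r :: nat
  proof -
    have "x * a * b = y * p * b" using that by simp
    also have "\<dots> = y * b * p" by simp
    finally show ?thesis using that by simp
  qed
  ultimately have "(n choose (2 * j + 2)) * (2 * j + 2) * (2 * j + 1) = (n choose (2 * j)) * (n - 2 * j) * (n - 2 * j - 1)"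
    by blast
  then show ?thesis by (simp only: of_nat_mult[symmetric])
qed

text \<open>Product of the recursions for the binomial coefficients, the interval moments and the
  cosine moments; the positive common factor \<open>p * x * y\<close> is cancelled at the
  end.\<close>

lemma rot_moment_term_rec:
  assumes n: "2 * j + 2 \<le> n"
  shows "rot_moment_term n (j + 1) * real (2 * j + 2) = rot_moment_term n j * real (n - 2 * j)"
proof -
  have c: "real (n choose (2 * j + 2)) * real (2 * j + 2) * real (2 * j + 1)
    = real (n choose (2 * j)) * real (n - 2 * j) * real (n - 2 * j - 1)"
    by (rule choose_two_step[OF n])
  have b: "real (n - 2 * j - 1) * interval_moment (n - 2 * j - 2) (j + 1) = real (2 * j + 2) * interval_moment (n - 2 * j) j"
    using interval_moment_rec[of "n - 2 * j - 2" j] n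
    by (simp add: Suc_diff_Suc numeral_2_eq_2 algebra_simps)
  have a: "real (2 * j + 2) * cos_moment (2 * j + 2) = real (2 * j + 1) * cos_moment (2 * j)"
    using cos_moment_rec[of "2 * j"] by simp
  define p where "p = real (n - 2 * j - 1)"
  define x where "x = real (2 * j + 2)"
  define y where "y = real (2 * j + 1)"
  have pos: "0 < p" "0 < x" "0 < y" using n by (auto simp: p_def x_def y_def)
  have "rot_moment_term n (j + 1) = real (n choose (2 * j + 2)) * interval_moment (n - 2 * j - 2) (j + 1) * cos_moment (2 * j + 2)"
    unfolding rot_moment_term_def by simp
  then have "p * x * y * (rot_moment_term n (j + 1) * x) =
     (real (n choose (2 * j + 2)) * x * y) * (p * interval_moment (n - 2 * j - 2) (j + 1)) * (x * cos_moment (2 * j + 2))"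
    by (simp add: algebra_simps)
  also have "\<dots> = p * x * y * (rot_moment_term n j * real (n - 2 * j))"
    using a b c unfolding p_def[symmetric] x_def[symmetric] y_def[symmetric]
    by (simp add: rot_moment_term_def algebra_simps)
  finally show ?thesis using pos unfolding x_def by simp
qed

text \<open>After halving both factors, the recursion in \<open>j\<close> is that of
  \<open>m choose j\<close>. The moment of order \<open>2 * m\<close> thus becomes the binomial
  expansion of \<open>(sin^2 + cos^2) ^ m\<close>.\<close>

lemma rot_moment_term_even: "j \<le> m \<Longrightarrow> rot_moment_term (2 * m) j = real (m choose j) * interval_moment (2 * m) 0"
proof (induction j)
  case (Suc j)
  have "rot_moment_term (2 * m) (j + 1) * real (2 * j + 2) = rot_moment_term (2 * m) j * real (2 * m - 2 * j)"
    by (rule rot_moment_term_rec) (use Suc.prems in simp)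
  then have "rot_moment_term (2 * m) (Suc j) * real (j + 1) = real ((m choose j) * (m - j)) * interval_moment (2 * m) 0"
    using Suc by (simp add: algebra_simps of_nat_diff)
  also have "(m choose j) * (m - j) = (m choose (Suc j)) * (j + 1)"
    using binomial_absorb_comp[of m j] binomial_absorption[of j m] by (simp add: mult.commute)
  finally have "rot_moment_term (2 * m) (Suc j) * real (j + 1) = (real (m choose (Suc j)) * interval_moment (2 * m) 0) * real (j + 1)"
    by (simp only: of_nat_mult mult_ac)
  then show ?case by (subst (asm) mult_right_cancel) simp_all
qed (simp add: rot_moment_term_def cos_moment_0)

lemma rot_moment_term_odd: "2 * j \<le> n \<Longrightarrow> odd n \<Longrightarrow> rot_moment_term n j = 0"
proof (induction j)
  case (Suc j)
  then show ?case using rot_moment_term_rec[of j n] by simp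
qed (simp add: rot_moment_term_def cos_moment_0 interval_moment_odd)

lemma sum_even_terms:
  fixes f :: "nat \<Rightarrow> real"
  assumes "\<And>j. f (2 * j + 1) = 0"
  shows "(\<Sum>k\<le>n. f k) = (\<Sum>j\<le>n div 2. f (2 * j))"
proof (induction n)
  case (Suc n)
  show ?case
  proof (cases "even n")
    case True
    then obtain j where "n = 2 * j" by auto
    then show ?thesis using Suc assms[of j] by simp
  next
    case False
    then obtain j where "n = 2 * j + 1" by (auto elim: oddE)
    then show ?thesis using Suc by simp
  qed
qed simp

text \<open>Archimedes: \<open>x\<close> and \<open>sqrt (1 - x\<^sup>2) cos (pi v)\<close> are two orthogonal coordinates of a uniform point
  of the sphere, so every combination with unit coefficients is uniform again.\<close>

definition rot :: "real \<Rightarrow> real \<Rightarrow> real \<Rightarrow> real" where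
  "rot w x v = x * cos w + sqrt (1 - x\<^sup>2) * cos (pi * v) * sin w"

lemma rot_measurable[measurable (raw)]:
  assumes [measurable]: "f \<in> borel_measurable N" "g \<in> borel_measurable N" "h \<in> borel_measurable N"
  shows "(\<lambda>y. rot (f y) (g y) (h y)) \<in> borel_measurable N"
  unfolding rot_def by measurable

text \<open>Cauchy-Schwarz for the unit vector \<open>(cos w, sin w)\<close> and the point
  \<open>(x, sqrt (1 - x^2) * cos (pi * v))\<close> of the unit disc.\<close>

lemma rot_bounded: assumes "\<bar>x\<bar> \<le> 1" shows "\<bar>rot w x v\<bar> \<le> 1"
proof -
  have x: "x\<^sup>2 \<le> 1" using assms by (simp add: abs_square_le_1)
  have "(x * cos w + (sqrt (1 - x\<^sup>2) * cos (pi * v)) * sin w)\<^sup>2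
     \<le> (x\<^sup>2 + (sqrt (1 - x\<^sup>2) * cos (pi * v))\<^sup>2) * ((cos w)\<^sup>2 + (sin w)\<^sup>2)"
  proof -
    have "(a * c + b * s)\<^sup>2 + (a * s - b * c)\<^sup>2 = (a\<^sup>2 + b\<^sup>2) * (c\<^sup>2 + s\<^sup>2)" for a b c s :: real
      by (simp add: power2_eq_square algebra_simps)
    then have "(a * c + b * s)\<^sup>2 \<le> (a\<^sup>2 + b\<^sup>2) * (c\<^sup>2 + s\<^sup>2)" for a b c s :: real
      by (metis le_add_same_cancel1 zero_le_power2)
    then show ?thesis .
  qed
  also have "\<dots> = x\<^sup>2 + (1 - x\<^sup>2) * (cos (pi * v))\<^sup>2"
    using x by (simp add: power_mult_distrib)
  also have "\<dots> \<le> x\<^sup>2 + (1 - x\<^sup>2) * 1"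
    using x by (intro add_left_mono mult_left_mono) (auto simp: abs_square_le_1)
  finally show ?thesis unfolding rot_def using abs_square_le_1 by fastforce
qed

text \<open>Both laws live on \<open>[-1, 1]\<close>, so it suffices to compare moments. Those of
  the rotated coordinate are independent of \<open>w\<close>: the expansion collapses to a power of
  \<open>sin^2 + cos^2\<close> in even order and vanishes in odd order.\<close>

lemma distr_rot: "distr (uniform_pm \<Otimes>\<^sub>M U01) borel (\<lambda>(x, v). rot w x v) = uniform_pm"
proof -
  interpret U: prob_space uniform_pm by (rule prob_space_uniform_pm)
  interpret V: prob_space U01 by (rule prob_space_U01)
  interpret P: pair_prob_space uniform_pm U01 ..
  have id_m[measurable]: "(\<lambda>x. x) \<in> borel_measurable U01" by (intro measurable_restrict_space1) simp
  have m[measurable]: "(\<lambda>(x, v). rot w x v) \<in> borel_measurable (uniform_pm \<Otimes>\<^sub>M U01)" by measurable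
  have AEP: "AE p in uniform_pm \<Otimes>\<^sub>M U01. \<bar>fst p\<bar> \<le> 1"
  proof (rule P.AE_pair_measure)
    show "{x \<in> space (uniform_pm \<Otimes>\<^sub>M U01). \<bar>fst x\<bar> \<le> 1} \<in> sets (uniform_pm \<Otimes>\<^sub>M U01)" by measurable
    show "AE x in uniform_pm. AE y in U01. \<bar>fst (x, y)\<bar> \<le> 1" using AE_uniform_pm by eventually_elim simp
  qed
  show ?thesis
  proof (rule bounded_moments_unique)
    show "real_distribution (distr (uniform_pm \<Otimes>\<^sub>M U01) borel (\<lambda>(x, v). rot w x v))"
      by (rule P.real_distribution_distr) simp
    show "real_distribution uniform_pm"
      by (intro real_distribution.intro real_distribution_axioms.intro) (auto simp: U.prob_space_axioms)
    show "AE x in uniform_pm. \<bar>x\<bar> \<le> 1" by (rule AE_uniform_pm)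
    show "AE x in distr (uniform_pm \<Otimes>\<^sub>M U01) borel (\<lambda>(x, v). rot w x v). \<bar>x\<bar> \<le> 1"
      using AEP by (subst AE_distr_iff) (auto elim!: eventually_mono intro!: rot_bounded)
    fix n
    let ?s = "\<lambda>k x. x ^ (n - k) * sqrt (1 - x\<^sup>2) ^ k"
    have i1: "integrable uniform_pm (?s k)" for k
      by (rule integrable_uniform_pm)
         (auto simp: abs_mult power_abs intro!: mult_le_one power_le_one real_sqrt_le_1_iff[THEN iffD2] simp: abs_square_le_1)
    have i2: "integrable U01 (\<lambda>v. cos (pi * v) ^ k)" for k
      by (rule V.integrable_const_bound[where B = 1]) (auto simp: power_abs power_le_one)
    have ip: "integrable (uniform_pm \<Otimes>\<^sub>M U01) (\<lambda>(x, v). ?s k x * cos (pi * v) ^ k)" for k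
    proof (rule P.integrable_const_bound[where B = 1])
      show "AE p in uniform_pm \<Otimes>\<^sub>M U01. norm (case p of (x, v) \<Rightarrow> ?s k x * cos (pi * v) ^ k) \<le> 1"
        using AEP
      proof eventually_elim
        case (elim p)
        then show ?case
          by (auto simp: abs_mult power_abs split_beta intro!: mult_le_one power_le_one real_sqrt_le_1_iff[THEN iffD2] simp: abs_square_le_1)
      qed
    qed measurable
    have int: "(\<integral>p. (case p of (x, v) \<Rightarrow> ?s k x * cos (pi * v) ^ k) \<partial>(uniform_pm \<Otimes>\<^sub>M U01)) = (\<integral>x. ?s k x \<partial>uniform_pm) * cos_moment k" for k
      using P.integral_fst'[OF ip[of k]] by (simp add: cos_moment_def)
    define f where "f k = real (n choose k) * (cos w) ^ (n - k) * (sin w) ^ k * ((\<integral>x. ?s k x \<partial>uniform_pm) * cos_moment k)" for k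
    have "(\<integral>x. x ^ n \<partial>distr (uniform_pm \<Otimes>\<^sub>M U01) borel (\<lambda>(x, v). rot w x v))
       = (\<integral>p. (case p of (x, v) \<Rightarrow> rot w x v) ^ n \<partial>(uniform_pm \<Otimes>\<^sub>M U01))"
      by (rule integral_distr) auto
    also have "\<dots> = (\<integral>p. (\<Sum>k\<le>n. real (n choose k) * (cos w) ^ (n - k) * (sin w) ^ k * (case p of (x, v) \<Rightarrow> ?s k x * cos (pi * v) ^ k)) \<partial>(uniform_pm \<Otimes>\<^sub>M U01))"
    proof (rule Bochner_Integration.integral_cong[OF refl])
      fix p
      show "(case p of (x, v) \<Rightarrow> rot w x v) ^ n = (\<Sum>k\<le>n. real (n choose k) * (cos w) ^ (n - k) * (sin w) ^ k * (case p of (x, v) \<Rightarrow> ?s k x * cos (pi * v) ^ k))"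
      proof (cases p)
        case (Pair x v)
        have "rot w x v ^ n = (sqrt (1 - x\<^sup>2) * cos (pi * v) * sin w + x * cos w) ^ n"
          by (simp add: rot_def add.commute)
        then show ?thesis unfolding Pair binomial_ring
          by (simp add: power_mult_distrib mult_ac)
      qed
    qed
    also have "\<dots> = (\<Sum>k\<le>n. f k)"
      unfolding f_def using ip by (subst Bochner_Integration.integral_sum) (auto simp: int)
    also have "\<dots> = (\<Sum>j\<le>n div 2. f (2 * j))"
      by (rule sum_even_terms) (simp only: f_def cos_moment_odd mult_zero_right)
    also have "\<dots> = (\<Sum>j\<le>n div 2. (cos w) ^ (n - 2 * j) * (sin w) ^ (2 * j) * rot_moment_term n j)"
    proof (rule sum.cong[OF refl])
      fix j
      have "(\<integral>x. ?s (2 * j) x \<partial>uniform_pm) = interval_moment (n - 2 * j) j"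
        unfolding interval_moment_def
      proof (rule integral_cong_AE)
        show "AE x in uniform_pm. x ^ (n - 2 * j) * sqrt (1 - x\<^sup>2) ^ (2 * j) = x ^ (n - 2 * j) * (1 - x\<^sup>2) ^ j"
          using AE_uniform_pm by eventually_elim (simp add: power_mult abs_square_le_1)
        note id_m[measurable del]
        show "(\<lambda>x. x ^ (n - 2 * j) * sqrt (1 - x\<^sup>2) ^ (2 * j)) \<in> borel_measurable uniform_pm"
          "(\<lambda>x. x ^ (n - 2 * j) * (1 - x\<^sup>2) ^ j) \<in> borel_measurable uniform_pm" by simp_all
      qed
      then show "f (2 * j) = (cos w) ^ (n - 2 * j) * (sin w) ^ (2 * j) * rot_moment_term n j"
        by (simp add: f_def rot_moment_term_def)
    qed
    also have "\<dots> = interval_moment n 0"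
    proof (cases "even n")
      case True
      then obtain m where n: "n = 2 * m" by auto
      have "(\<Sum>j\<le>n div 2. (cos w) ^ (n - 2 * j) * (sin w) ^ (2 * j) * rot_moment_term n j)
         = (\<Sum>j\<le>m. real (m choose j) * ((sin w)\<^sup>2) ^ j * ((cos w)\<^sup>2) ^ (m - j)) * interval_moment n 0"
        unfolding n sum_distrib_right
        by (rule sum.cong) (auto simp: rot_moment_term_even power_mult[symmetric] diff_mult_distrib2)
      also have "\<dots> = ((sin w)\<^sup>2 + (cos w)\<^sup>2) ^ m * interval_moment n 0" by (simp only: binomial_ring)
      finally show ?thesis by simp
    next
      case False
      then show ?thesis by (simp add: rot_moment_term_odd interval_moment_odd)
    qed
    also have "\<dots> = (\<integral>x. x ^ n \<partial>uniform_pm)" by (simp add: interval_moment_def)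
    finally show "(\<integral>x. x ^ n \<partial>distr (uniform_pm \<Otimes>\<^sub>M U01) borel (\<lambda>(x, v). rot w x v)) = (\<integral>x. x ^ n \<partial>uniform_pm)" .
  qed
qed

lemma nn_integral_rot:
  assumes [measurable]: "g \<in> borel_measurable borel"
  shows "(\<integral>\<^sup>+v. uniform_mean (\<lambda>x. g (rot w x v)) \<partial>U01) = uniform_mean g"
proof -
  interpret U: prob_space uniform_pm by (rule prob_space_uniform_pm)
  interpret V: prob_space U01 by (rule prob_space_U01)
  interpret P: pair_prob_space uniform_pm U01 ..
  have id_m[measurable]: "(\<lambda>x. x) \<in> borel_measurable U01" by (intro measurable_restrict_space1) simp
  have "(\<integral>\<^sup>+v. uniform_mean (\<lambda>x. g (rot w x v)) \<partial>U01) = (\<integral>\<^sup>+v. \<integral>\<^sup>+x. g (rot w x v) \<partial>uniform_pm \<partial>U01)"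
    by (intro nn_integral_cong) (simp add: nn_integral_uniform_pm)
  also have "\<dots> = (\<integral>\<^sup>+p. g (case p of (x, v) \<Rightarrow> rot w x v) \<partial>(uniform_pm \<Otimes>\<^sub>M U01))"
    by (subst P.nn_integral_snd[symmetric]) (auto simp: split_beta')
  also have "\<dots> = (\<integral>\<^sup>+x. g x \<partial>distr (uniform_pm \<Otimes>\<^sub>M U01) borel (\<lambda>(x, v). rot w x v))"
    by (subst nn_integral_distr) auto
  finally show ?thesis by (simp add: distr_rot nn_integral_uniform_pm)
qed

section \<open>Brownian motion with continuous paths\<close>

abbreviation gauss :: "real \<Rightarrow> real measure" where
  "gauss v \<equiv> density lborel (\<lambda>x. ennreal (normal_density 0 (sqrt v) x))"

lemma prob_space_gauss: "0 < v \<Longrightarrow> prob_space (gauss v)"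
  by (rule prob_space_normal_density) simp

text \<open>Start at 0 and continuity hold at every sample point, not just almost surely: the path
  will be read at a random time, which calls for joint measurability. A general solution is brought
  to this form at the end by removing a null set.\<close>

locale continuous_bm =
  fixes M :: "'a measure" and F :: "real \<Rightarrow> 'a measure" and B :: "real \<Rightarrow> 'a \<Rightarrow> real"
  assumes bm: "standard_brownian_motion M F B"
    and B_0: "\<And>\<omega>. \<omega> \<in> space M \<Longrightarrow> B 0 \<omega> = 0"
    and B_cont: "\<And>\<omega>. \<omega> \<in> space M \<Longrightarrow> continuous_on {0..} (\<lambda>t. B t \<omega>)"
begin

sublocale prob_space M
  using bm by (simp add: standard_brownian_motion_def)

lemma space_F[simp]: "space (F t) = space M"
  and sets_F_subset: "sets (F t) \<subseteq> sets M"
  and sets_F_mono: "s \<le> t \<Longrightarrow> sets (F s) \<subseteq> sets (F t)"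
  using bm
  by (auto simp: standard_brownian_motion_def filtration_on_def subalgebra_def filtration_def)

lemma measurable_from_F: "f \<in> measurable (F t) N \<Longrightarrow> f \<in> measurable M N"
  using sets_F_subset[of t] by (auto simp: measurable_def)

lemma measurable_F_mono: "f \<in> measurable (F s) N \<Longrightarrow> s \<le> t \<Longrightarrow> f \<in> measurable (F t) N"
  using sets_F_mono[of s t] by (auto simp: measurable_def)

lemma B_adapted: "0 \<le> t \<Longrightarrow> B t \<in> borel_measurable (F t)"
  using bm by (auto simp: standard_brownian_motion_def adapted_def)

lemma B_measurable_F: "0 \<le> s \<Longrightarrow> s \<le> t \<Longrightarrow> B s \<in> borel_measurable (F t)"
  using B_adapted measurable_F_mono by blast

lemma B_measurable: "0 \<le> t \<Longrightarrow> B t \<in> borel_measurable M"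
  using B_adapted measurable_from_F by blast

lemma increment_distributed:
  "0 \<le> s \<Longrightarrow> s < t \<Longrightarrow>
    distributed M lborel (\<lambda>\<omega>. B t \<omega> - B s \<omega>) (normal_density 0 (sqrt (t - s)))"
  using bm by (auto simp: standard_brownian_motion_def)

lemma distr_increment:
  "0 \<le> s \<Longrightarrow> s < t \<Longrightarrow> distr M borel (\<lambda>\<omega>. B t \<omega> - B s \<omega>) = gauss (t - s)"
  using distributed_distr_eq_density[OF increment_distributed[of s t]]
  by (metis distr_cong sets_lborel)

text \<open>Independence expressed as a product law. The first component is the identity into
  \<open>F s\<close>, so that integrands may depend on the whole past.\<close>

lemma distr_pair_increment:
  assumes st: "0 \<le> s" "s < t"
  shows "distr M (F s \<Otimes>\<^sub>M borel) (\<lambda>\<omega>. (\<omega>, B t \<omega> - B s \<omega>)) = distr M (F s) (\<lambda>\<omega>. \<omega>) \<Otimes>\<^sub>M gauss (t - s)"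
proof -
  have m1: "(\<lambda>\<omega>. \<omega>) \<in> measurable M (F s)"
    using sets_F_subset[of s] by (auto simp: measurable_def sets.Int_space_eq2)
  have m2: "(\<lambda>\<omega>. B t \<omega> - B s \<omega>) \<in> borel_measurable M"
    using st B_measurable by auto
  interpret G: prob_space "gauss (t - s)" using st by (intro prob_space_gauss) simp
  interpret D: prob_space "distr M (F s) (\<lambda>\<omega>. \<omega>)" by (rule prob_space_distr[OF m1])
  have m: "(\<lambda>\<omega>. (\<omega>, B t \<omega> - B s \<omega>)) \<in> measurable M (F s \<Otimes>\<^sub>M borel)"
    using m1 m2 by simp
  have ind: "indep_set (sets (F s)) (sets (vimage_algebra (space M) (\<lambda>\<omega>. B t \<omega> - B s \<omega>) borel))"
    using bm st by (auto simp: standard_brownian_motion_def)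
  show ?thesis
  proof (rule pair_measure_eqI[symmetric])
    show "sigma_finite_measure (distr M (F s) (\<lambda>\<omega>. \<omega>))" "sigma_finite_measure (gauss (t - s))"
      by unfold_locales
    show "sets (distr M (F s) (\<lambda>\<omega>. \<omega>) \<Otimes>\<^sub>M gauss (t - s))
      = sets (distr M (F s \<Otimes>\<^sub>M borel) (\<lambda>\<omega>. (\<omega>, B t \<omega> - B s \<omega>)))"
      by (simp cong: sets_pair_measure_cong)
  next
    fix A C assume A: "A \<in> sets (distr M (F s) (\<lambda>\<omega>. \<omega>))" and C: "C \<in> sets (gauss (t - s))"
    then have AF: "A \<in> sets (F s)" and CB: "C \<in> sets borel" by auto
    have AM: "A \<in> sets M" using AF sets_F_subset by auto
    have As: "A \<subseteq> space M" using AM sets.sets_into_space by auto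
    have CM: "(\<lambda>\<omega>. B t \<omega> - B s \<omega>) -` C \<inter> space M
        \<in> sets (vimage_algebra (space M) (\<lambda>\<omega>. B t \<omega> - B s \<omega>) borel)"
      using CB by (auto simp: sets_vimage_algebra)
    have "emeasure (distr M (F s \<Otimes>\<^sub>M borel) (\<lambda>\<omega>. (\<omega>, B t \<omega> - B s \<omega>))) (A \<times> C)
      = emeasure M (A \<inter> ((\<lambda>\<omega>. B t \<omega> - B s \<omega>) -` C \<inter> space M))"
      using AF CB As by (subst emeasure_distr[OF m]) (auto intro!: arg_cong[of _ _ "emeasure M"])
    also have "\<dots> = emeasure M A * emeasure M ((\<lambda>\<omega>. B t \<omega> - B s \<omega>) -` C \<inter> space M)"
      using indep_setD[OF ind AF CM] by (simp add: emeasure_eq_measure ennreal_mult')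
    also have "emeasure M ((\<lambda>\<omega>. B t \<omega> - B s \<omega>) -` C \<inter> space M) = emeasure (gauss (t - s)) C"
      using CB m2 by (simp flip: distr_increment[OF st] add: emeasure_distr)
    also have "emeasure M A = emeasure (distr M (F s) (\<lambda>\<omega>. \<omega>)) A"
      using AF m1 As by (simp add: emeasure_distr Int_absorb2)
    finally show "emeasure (distr M (F s) (\<lambda>\<omega>. \<omega>)) A * emeasure (gauss (t - s)) C
      = emeasure (distr M (F s \<Otimes>\<^sub>M borel) (\<lambda>\<omega>. (\<omega>, B t \<omega> - B s \<omega>))) (A \<times> C)" by simp
  qed
qed

text \<open>Fubini for the product law: the past is frozen and the increment integrated out. The
  martingale identities below all come from this.\<close>

lemma nn_integral_increment:
  assumes st: "0 \<le> s" "s < t" and g: "g \<in> borel_measurable (F s \<Otimes>\<^sub>M borel)"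
  shows "(\<integral>\<^sup>+\<omega>. g (\<omega>, B t \<omega> - B s \<omega>) \<partial>M) = (\<integral>\<^sup>+\<omega>. \<integral>\<^sup>+d. g (\<omega>, d) \<partial>gauss (t - s) \<partial>M)"
proof -
  have m1: "(\<lambda>\<omega>. \<omega>) \<in> measurable M (F s)"
    using sets_F_subset[of s] by (auto simp: measurable_def sets.Int_space_eq2)
  have m2: "(\<lambda>\<omega>. B t \<omega> - B s \<omega>) \<in> borel_measurable M"
    using st B_measurable by auto
  interpret G: prob_space "gauss (t - s)" using st by (intro prob_space_gauss) simp
  have m: "(\<lambda>\<omega>. (\<omega>, B t \<omega> - B s \<omega>)) \<in> measurable M (F s \<Otimes>\<^sub>M borel)"
    using m1 m2 by simp
  have "(\<integral>\<^sup>+\<omega>. g (\<omega>, B t \<omega> - B s \<omega>) \<partial>M)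
      = integral\<^sup>N (distr M (F s \<Otimes>\<^sub>M borel) (\<lambda>\<omega>. (\<omega>, B t \<omega> - B s \<omega>))) g"
    using g m by (simp add: nn_integral_distr)
  also have "\<dots> = integral\<^sup>N (distr M (F s) (\<lambda>\<omega>. \<omega>) \<Otimes>\<^sub>M gauss (t - s)) g"
    by (simp add: distr_pair_increment[OF st])
  also have "\<dots> = (\<integral>\<^sup>+\<omega>. \<integral>\<^sup>+d. g (\<omega>, d) \<partial>gauss (t - s) \<partial>distr M (F s) (\<lambda>\<omega>. \<omega>))"
    by (rule G.nn_integral_fst[symmetric])
      (use g in \<open>simp cong: measurable_cong_sets sets_pair_measure_cong\<close>)
  also have "\<dots> = (\<integral>\<^sup>+\<omega>. \<integral>\<^sup>+d. g (\<omega>, d) \<partial>gauss (t - s) \<partial>M)"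
  proof (rule nn_integral_distr[OF m1])
    have "g \<in> borel_measurable (F s \<Otimes>\<^sub>M gauss (t-s))"
      using g by (simp cong: measurable_cong_sets sets_pair_measure_cong)
    then show "(\<lambda>\<omega>. \<integral>\<^sup>+d. g (\<omega>, d) \<partial>gauss (t - s)) \<in> borel_measurable (distr M (F s) (\<lambda>\<omega>. \<omega>))"
      using G.borel_measurable_nn_integral_fst by (simp cong: measurable_cong_sets)
  qed
  finally show ?thesis .
qed

lemma distr_B: "0 < t \<Longrightarrow> distr M borel (B t) = gauss t"
proof -
  assume t: "0 < t"
  have "distr M borel (B t) = distr M borel (\<lambda>\<omega>. B t \<omega> - B 0 \<omega>)"
    by (rule distr_cong) (auto simp: B_0)
  then show ?thesis using distr_increment[of 0 t] t by simp
qed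

end

section \<open>Exponential and trigonometric martingales of Brownian motion\<close>

lemma gauss_char:
  assumes v: "0 < v"
  shows "(\<integral>x. cos x \<partial>gauss v) = exp (- v / 2)" "(\<integral>x. sin x \<partial>gauss v) = 0"
proof -
  interpret G: prob_space "gauss v" using v by (rule prob_space_gauss)
  interpret N: prob_space std_normal_distribution by (rule prob_space_normal_density) simp
  have "distributed (gauss v) lborel (\<lambda>x. x) (normal_density 0 (sqrt v))"
    unfolding distributed_def
    by (auto simp: distr_id2)
  then have "distributed (gauss v) lborel (\<lambda>x. (x - 0) / sqrt v) std_normal_density"
    using v by (subst G.normal_standard_normal_convert[symmetric]) auto
  then have d: "distr (gauss v) lborel (\<lambda>x. x / sqrt v) = std_normal_distribution"
    using distributed_distr_eq_density by fastforce
  have eq: "(\<integral>x. cis x \<partial>gauss v) = of_real (exp (- v / 2))"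
  proof -
    have "(\<integral>x. cis x \<partial>gauss v) = (\<integral>x. cis (sqrt v * (x / sqrt v)) \<partial>gauss v)"
      using v by simp
    also have "\<dots> = (\<integral>x. cis (sqrt v * x) \<partial>distr (gauss v) lborel (\<lambda>x. x / sqrt v))"
    proof (rule integral_distr[symmetric])
      show "(\<lambda>x. x / sqrt v) \<in> measurable (gauss v) lborel" by simp
      have "(\<lambda>x. cis (sqrt v * x)) = (\<lambda>x. complex_of_real (cos (sqrt v * x)) + \<i> * complex_of_real (sin (sqrt v * x)))"
        by (auto simp: complex_eq_iff simp del: of_real_mult)
      then show "(\<lambda>x. cis (sqrt v * x)) \<in> borel_measurable lborel" by simp
    qed
    also have "\<dots> = char std_normal_distribution (sqrt v)"
      unfolding d char_def by (simp add: cis_conv_exp)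
    also have "\<dots> = of_real (exp (- v / 2))"
      using v by (simp add: char_std_normal_distribution)
    finally show ?thesis .
  qed
  have int: "integrable (gauss v) cis"
  proof (rule G.integrable_const_bound[of _ 1])
    have "cis = (\<lambda>x. complex_of_real (cos x) + \<i> * complex_of_real (sin x))"
      by (auto simp: complex_eq_iff)
    moreover have "(\<lambda>x. complex_of_real (cos x) + \<i> * complex_of_real (sin x)) \<in> borel_measurable (gauss v)"
      by simp
    ultimately show "cis \<in> borel_measurable (gauss v)" by simp
  qed auto
  show "(\<integral>x. cos x \<partial>gauss v) = exp (- v / 2)"
    using arg_cong[OF eq, of Re] integral_Re[OF int] by simp
  show "(\<integral>x. sin x \<partial>gauss v) = 0"
    using arg_cong[OF eq, of Im] integral_Im[OF int] by simp
qed

lemma nn_integral_gauss_exp: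
  assumes v: "0 < v"
  shows "(\<integral>\<^sup>+x. ennreal (exp (c * x - c\<^sup>2 * v / 2)) \<partial>gauss v) = 1"
proof -
  have "(\<integral>\<^sup>+x. ennreal (exp (c * x - c\<^sup>2 * v / 2)) \<partial>gauss v)
      = (\<integral>\<^sup>+x. ennreal (normal_density (c * v) (sqrt v) x) \<partial>lborel)"
  proof (subst nn_integral_density, simp, simp, rule nn_integral_cong)
    fix x
    have "normal_density 0 (sqrt v) x * exp (c * x - c\<^sup>2 * v / 2) = normal_density (c * v) (sqrt v) x"
      using v by (simp add: normal_density_def exp_add[symmetric] power2_eq_square field_simps)
    then show "ennreal (normal_density 0 (sqrt v) x) * ennreal (exp (c * x - c\<^sup>2 * v / 2))
       = ennreal (normal_density (c * v) (sqrt v) x)"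
      by (metis ennreal_mult' normal_density_nonneg)
  qed
  also have "\<dots> = 1"
    using prob_space.emeasure_space_1[OF prob_space_normal_density[of "sqrt v" "c * v"]] v
    by (simp add: emeasure_density)
  finally show ?thesis .
qed

context continuous_bm
begin

lemma nn_integral_B:
  assumes "0 < t" and [measurable]: "g \<in> borel_measurable borel"
  shows "(\<integral>\<^sup>+\<omega>. g (B t \<omega>) \<partial>M) = (\<integral>\<^sup>+x. g x \<partial>gauss t)"
  using assms B_measurable[of t] by (subst distr_B[symmetric]) (simp_all add: nn_integral_distr)

definition stoch_exp :: "real \<Rightarrow> 'a \<Rightarrow> real" where
  "stoch_exp t \<omega> = exp (B t \<omega> - t / 2)"

lemma stoch_exp_pos: "0 < stoch_exp t \<omega>" by (simp add: stoch_exp_def)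

lemma stoch_exp_measurable_F: "0 \<le> s \<Longrightarrow> s \<le> t \<Longrightarrow> stoch_exp s \<in> borel_measurable (F t)"
  unfolding stoch_exp_def using B_measurable_F[of s t] by measurable

lemma stoch_exp_measurable: "0 \<le> t \<Longrightarrow> stoch_exp t \<in> borel_measurable M"
  using stoch_exp_measurable_F measurable_from_F by blast

lemma stoch_exp_cont: "\<omega> \<in> space M \<Longrightarrow> continuous_on {0..} (\<lambda>t. stoch_exp t \<omega>)"
  unfolding stoch_exp_def by (intro continuous_intros B_cont) auto

lemma stoch_exp_0: "\<omega> \<in> space M \<Longrightarrow> stoch_exp 0 \<omega> = 1"
  by (simp add: stoch_exp_def B_0)

text \<open>Testing against any nonnegative \<open>Y\<close> of the past, rather than events only,
  allows densities and factors such as \<open>1 / stoch_exp 1\<close> to be absorbed into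
  \<open>Y\<close>.\<close>

lemma exp_martingale:
  assumes st: "0 \<le> s" "s \<le> t" and Y: "Y \<in> borel_measurable (F s)"
  shows "(\<integral>\<^sup>+\<omega>. Y \<omega> * ennreal (stoch_exp t \<omega>) \<partial>M) = (\<integral>\<^sup>+\<omega>. Y \<omega> * ennreal (stoch_exp s \<omega>) \<partial>M)"
proof (cases "s = t")
  case False
  then have lt: "s < t" using st by simp
  note [measurable] = Y stoch_exp_measurable_F[OF st(1) order_refl]
  have "(\<integral>\<^sup>+\<omega>. Y \<omega> * ennreal (stoch_exp t \<omega>) \<partial>M)
    = (\<integral>\<^sup>+\<omega>. (\<lambda>(\<omega>, d). Y \<omega> * ennreal (stoch_exp s \<omega>) * ennreal (exp (d - (t - s) / 2))) (\<omega>, B t \<omega> - B s \<omega>) \<partial>M)"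
  proof (rule nn_integral_cong)
    fix \<omega>
    have "B t \<omega> - t / 2 = (B s \<omega> - s / 2) + (B t \<omega> - B s \<omega> - (t - s) / 2)" by (simp add: field_simps)
    then have "stoch_exp t \<omega> = stoch_exp s \<omega> * exp (B t \<omega> - B s \<omega> - (t - s) / 2)"
      unfolding stoch_exp_def exp_add[symmetric] by simp
    then show "Y \<omega> * ennreal (stoch_exp t \<omega>)
       = (\<lambda>(\<omega>, d). Y \<omega> * ennreal (stoch_exp s \<omega>) * ennreal (exp (d - (t - s) / 2))) (\<omega>, B t \<omega> - B s \<omega>)"
      by (simp add: mult.assoc ennreal_mult less_imp_le[OF stoch_exp_pos])
  qed
  also have "\<dots> = (\<integral>\<^sup>+\<omega>. \<integral>\<^sup>+d. (\<lambda>(\<omega>, d). Y \<omega> * ennreal (stoch_exp s \<omega>) * ennreal (exp (d - (t - s) / 2))) (\<omega>, d) \<partial>gauss (t - s) \<partial>M)"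
    by (rule nn_integral_increment[OF st(1) lt]) measurable
  also have "\<dots> = (\<integral>\<^sup>+\<omega>. Y \<omega> * ennreal (stoch_exp s \<omega>) \<partial>M)"
    using nn_integral_gauss_exp[of "t - s" 1] lt
    by (simp add: nn_integral_cmult)
  finally show ?thesis .
qed simp

text \<open>By the addition formulas only the mean \<open>exp (- v / 2)\<close> of
  \<open>cos d\<close> survives, as \<open>sin d\<close> has mean 0. Nonnegativity is assumed for
  all angles so that it covers every shift \<open>w + d\<close>.\<close>

lemma gauss_trig:
  assumes v: "0 < v" and nn: "\<And>w. 0 \<le> c + a * cos w + b * sin w"
  shows "(\<integral>\<^sup>+d. ennreal (c + a * cos (w + d) + b * sin (w + d)) \<partial>gauss v)
    = ennreal (c + exp (- v / 2) * (a * cos w + b * sin w))"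
proof -
  interpret G: prob_space "gauss v" using v by (rule prob_space_gauss)
  have i: "integrable (gauss v) cos" "integrable (gauss v) sin"
    by (rule G.integrable_const_bound[where B = 1]; simp)+
  have e: "c + a * cos (w + d) + b * sin (w + d)
     = c + (a * cos w + b * sin w) * cos d + (b * cos w - a * sin w) * sin d" for d
    by (simp add: cos_add sin_add algebra_simps)
  have "(\<integral>\<^sup>+d. ennreal (c + a * cos (w + d) + b * sin (w + d)) \<partial>gauss v)
    = ennreal (\<integral>d. c + a * cos (w + d) + b * sin (w + d) \<partial>gauss v)"
  proof (rule nn_integral_eq_integral)
    show "AE d in gauss v. 0 \<le> c + a * cos (w + d) + b * sin (w + d)" using nn by simp
  qed (use i in \<open>simp add: e\<close>)
  also have "(\<integral>d. c + a * cos (w + d) + b * sin (w + d) \<partial>gauss v)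
    = c + exp (- v / 2) * (a * cos w + b * sin w)"
    unfolding e using i by (simp add: gauss_char[OF v] G.prob_space[simplified])
  finally show ?thesis .
qed

text \<open>The factor \<open>exp (t / 2)\<close> offsets the decay of trigonometric means. The
  constant \<open>c\<close> makes the integrand nonnegative at the later time; below it is 1, and
  the trigonometric part is \<open>Z\<close> or \<open>- Z\<close>.\<close>

lemma trig_martingale:
  assumes st: "0 \<le> s" "s \<le> t" and Y: "Y \<in> borel_measurable (F s)"
    and nn: "\<And>w. 0 \<le> c + exp (t / 2) * (a * cos w + b * sin w)"
  shows "(\<integral>\<^sup>+\<omega>. Y \<omega> * ennreal (c + exp (t / 2) * (a * cos (B t \<omega>) + b * sin (B t \<omega>))) \<partial>M)
    = (\<integral>\<^sup>+\<omega>. Y \<omega> * ennreal (c + exp (s / 2) * (a * cos (B s \<omega>) + b * sin (B s \<omega>))) \<partial>M)"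
proof (cases "s = t")
  case False
  then have lt: "s < t" using st by simp
  note [measurable] = Y B_measurable_F[OF st(1) order_refl]
  let ?a = "exp (t / 2) * a" and ?b = "exp (t / 2) * b"
  let ?g = "\<lambda>(\<omega>, d). Y \<omega> * ennreal (c + ?a * cos (B s \<omega> + d) + ?b * sin (B s \<omega> + d))"
  have "(\<integral>\<^sup>+\<omega>. Y \<omega> * ennreal (c + exp (t / 2) * (a * cos (B t \<omega>) + b * sin (B t \<omega>))) \<partial>M)
    = (\<integral>\<^sup>+\<omega>. ?g (\<omega>, B t \<omega> - B s \<omega>) \<partial>M)"
    by (intro nn_integral_cong) (simp add: algebra_simps)
  also have "\<dots> = (\<integral>\<^sup>+\<omega>. \<integral>\<^sup>+d. ?g (\<omega>, d) \<partial>gauss (t - s) \<partial>M)"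
    by (rule nn_integral_increment[OF st(1) lt]) measurable
  also have "\<dots> = (\<integral>\<^sup>+\<omega>. Y \<omega> * ennreal (c + exp (s / 2) * (a * cos (B s \<omega>) + b * sin (B s \<omega>))) \<partial>M)"
  proof (rule nn_integral_cong)
    fix \<omega>
    have e: "exp (- (t - s) / 2) * (?a * x + ?b * y) = exp (s / 2) * (a * x + b * y)" for x y
    proof -
      have "exp (- (t - s) / 2) * exp (t / 2) = exp (s / 2)"
        unfolding exp_add[symmetric] by (simp add: field_simps)
      then show ?thesis by (metis (no_types, opaque_lifting) distrib_left mult.assoc)
    qed
    have "(\<integral>\<^sup>+d. ?g (\<omega>, d) \<partial>gauss (t - s))
      = Y \<omega> * (\<integral>\<^sup>+d. ennreal (c + ?a * cos (B s \<omega> + d) + ?b * sin (B s \<omega> + d)) \<partial>gauss (t - s))"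
      by (simp add: nn_integral_cmult)
    also have "\<dots> = Y \<omega> * ennreal (c + exp (- (t - s) / 2) * (?a * cos (B s \<omega>) + ?b * sin (B s \<omega>)))"
      by (subst gauss_trig) (use lt nn in \<open>auto simp: algebra_simps\<close>)
    finally show "(\<integral>\<^sup>+d. ?g (\<omega>, d) \<partial>gauss (t - s))
      = Y \<omega> * ennreal (c + exp (s / 2) * (a * cos (B s \<omega>) + b * sin (B s \<omega>)))"
      unfolding e .
  qed
  finally show ?thesis .
qed simp

lemma nn_integral_two_increments:
  assumes a: "0 < a" and g[measurable]: "case_prod g \<in> borel_measurable (borel \<Otimes>\<^sub>M borel)"
  shows "(\<integral>\<^sup>+\<omega>. g (B a \<omega>) (B (2 * a) \<omega> - B a \<omega>) \<partial>M) = (\<integral>\<^sup>+x. \<integral>\<^sup>+y. g x y \<partial>gauss a \<partial>gauss a)"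
proof -
  interpret G: prob_space "gauss a" using a by (rule prob_space_gauss)
  note [measurable] = B_adapted[of a]
  have "(\<integral>\<^sup>+\<omega>. g (B a \<omega>) (B (2 * a) \<omega> - B a \<omega>) \<partial>M)
    = (\<integral>\<^sup>+\<omega>. (\<lambda>(\<omega>, d). g (B a \<omega>) d) (\<omega>, B (2 * a) \<omega> - B a \<omega>) \<partial>M)" by simp
  also have "\<dots> = (\<integral>\<^sup>+\<omega>. \<integral>\<^sup>+d. (\<lambda>(\<omega>, d). g (B a \<omega>) d) (\<omega>, d) \<partial>gauss (2 * a - a) \<partial>M)"
    by (rule nn_integral_increment) (use a in auto)
  also have "\<dots> = (\<integral>\<^sup>+\<omega>. (\<lambda>x. \<integral>\<^sup>+d. g x d \<partial>gauss a) (B a \<omega>) \<partial>M)" by simp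
  also have "\<dots> = (\<integral>\<^sup>+x. \<integral>\<^sup>+d. g x d \<partial>gauss a \<partial>gauss a)"
    by (rule nn_integral_B[OF a]) measurable
  finally show ?thesis .
qed

text \<open>The two increments are independent with equal law, so the double integral is
  symmetric.\<close>

lemma swap_increments:
  assumes a: "0 < a" and g[measurable]: "case_prod g \<in> borel_measurable (borel \<Otimes>\<^sub>M borel)"
  shows "(\<integral>\<^sup>+\<omega>. g (B a \<omega>) (B (2 * a) \<omega> - B a \<omega>) \<partial>M)
    = (\<integral>\<^sup>+\<omega>. g (B (2 * a) \<omega> - B a \<omega>) (B a \<omega>) \<partial>M)"
proof -
  interpret G: prob_space "gauss a" using a by (rule prob_space_gauss)
  interpret P: pair_sigma_finite "gauss a" "gauss a" ..
  show ?thesis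
    unfolding nn_integral_two_increments[OF a g]
    by (subst nn_integral_two_increments[OF a, of "\<lambda>x y. g y x"], measurable)
       (rule P.Fubini', measurable)
qed

end

section \<open>Uniqueness of the stochastic exponential\<close>

lemma integrable_mult_of_squares:
  fixes f g :: "'b \<Rightarrow> real"
  assumes [measurable]: "f \<in> borel_measurable N" "g \<in> borel_measurable N"
    and "integrable N (\<lambda>x. (f x)\<^sup>2)" "integrable N (\<lambda>x. (g x)\<^sup>2)"
  shows "integrable N (\<lambda>x. f x * g x)"
proof (rule Bochner_Integration.integrable_bound[of N "\<lambda>x. (f x)\<^sup>2 + (g x)\<^sup>2"])
  have "\<bar>a * b\<bar> \<le> a\<^sup>2 + b\<^sup>2" for a b :: real
  proof -
    have "0 \<le> (\<bar>a\<bar> - \<bar>b\<bar>)\<^sup>2" by simp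
    then have "2 * \<bar>a * b\<bar> \<le> a\<^sup>2 + b\<^sup>2" by (simp add: power2_diff abs_mult)
    moreover have "0 \<le> \<bar>a * b\<bar>" by simp
    ultimately show ?thesis by linarith
  qed
  then show "AE x in N. norm (f x * g x) \<le> norm ((f x)\<^sup>2 + (g x)\<^sup>2)" by simp
qed (use assms in auto)

section \<open>Discrete Ito isometry and the integral equation of the exponential martingale\<close>

context continuous_bm
begin

lemma integral_increment_mult:
  fixes Y :: "'a \<Rightarrow> real" and \<phi> :: "real \<Rightarrow> real"
  assumes st: "0 \<le> s" "s < t" and Y: "Y \<in> borel_measurable (F s)" "integrable M Y"
    and \<phi>: "integrable (gauss (t - s)) \<phi>"
  shows "integrable M (\<lambda>\<omega>. Y \<omega> * \<phi> (B t \<omega> - B s \<omega>))"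
    and "(\<integral>\<omega>. Y \<omega> * \<phi> (B t \<omega> - B s \<omega>) \<partial>M) = (\<integral>\<omega>. Y \<omega> \<partial>M) * (\<integral>x. \<phi> x \<partial>gauss (t - s))"
proof -
  have \<phi>m: "\<phi> \<in> borel_measurable borel" using \<phi> by auto
  have m1: "(\<lambda>\<omega>. \<omega>) \<in> measurable M (F s)"
    using sets_F_subset[of s] by (auto simp: measurable_def sets.Int_space_eq2)
  have YM[measurable]: "Y \<in> borel_measurable M" using Y measurable_from_F by blast
  note [measurable] = Y(1) \<phi>m
  have B[measurable]: "B t \<in> borel_measurable M" "B s \<in> borel_measurable M"
    using B_measurable st by auto
  interpret G: prob_space "gauss (t - s)" using st by (intro prob_space_gauss) simp
  interpret D: prob_space "distr M (F s) (\<lambda>\<omega>. \<omega>)" by (rule prob_space_distr[OF m1])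
  interpret Q: pair_prob_space "distr M (F s) (\<lambda>\<omega>. \<omega>)" "gauss (t - s)" ..
  have m: "(\<lambda>\<omega>. (\<omega>, B t \<omega> - B s \<omega>)) \<in> measurable M (F s \<Otimes>\<^sub>M borel)"
    using m1 by simp
  show i: "integrable M (\<lambda>\<omega>. Y \<omega> * \<phi> (B t \<omega> - B s \<omega>))"
  proof (rule integrableI_bounded)
    have "(\<integral>\<^sup>+\<omega>. ennreal (norm (Y \<omega> * \<phi> (B t \<omega> - B s \<omega>))) \<partial>M)
      = (\<integral>\<^sup>+\<omega>. (\<lambda>(\<omega>, d). ennreal \<bar>Y \<omega>\<bar> * ennreal \<bar>\<phi> d\<bar>) (\<omega>, B t \<omega> - B s \<omega>) \<partial>M)"
      by (simp add: abs_mult ennreal_mult)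
    also have "\<dots> = (\<integral>\<^sup>+\<omega>. \<integral>\<^sup>+d. (\<lambda>(\<omega>, d). ennreal \<bar>Y \<omega>\<bar> * ennreal \<bar>\<phi> d\<bar>) (\<omega>, d) \<partial>gauss (t - s) \<partial>M)"
      by (rule nn_integral_increment[OF st]) measurable
    also have "\<dots> = (\<integral>\<^sup>+\<omega>. ennreal \<bar>Y \<omega>\<bar> \<partial>M) * (\<integral>\<^sup>+d. ennreal \<bar>\<phi> d\<bar> \<partial>gauss (t - s))"
      by (simp add: nn_integral_cmult nn_integral_multc)
    also have "\<dots> < \<infinity>"
      using Y(2) \<phi> by (simp add: integrable_iff_bounded ennreal_mult_less_top)
    finally show "(\<integral>\<^sup>+\<omega>. ennreal (norm (Y \<omega> * \<phi> (B t \<omega> - B s \<omega>))) \<partial>M) < \<infinity>" .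
  qed measurable
  have "(\<integral>\<omega>. Y \<omega> * \<phi> (B t \<omega> - B s \<omega>) \<partial>M)
     = (\<integral>p. (case p of (\<omega>, d) \<Rightarrow> Y \<omega> * \<phi> d) \<partial>distr M (F s \<Otimes>\<^sub>M borel) (\<lambda>\<omega>. (\<omega>, B t \<omega> - B s \<omega>)))"
    by (subst integral_distr[OF m]) (auto simp: split_beta')
  also have "\<dots> = (\<integral>p. (case p of (\<omega>, d) \<Rightarrow> Y \<omega> * \<phi> d) \<partial>(distr M (F s) (\<lambda>\<omega>. \<omega>) \<Otimes>\<^sub>M gauss (t - s)))"
    by (simp add: distr_pair_increment[OF st])
  also have "\<dots> = (\<integral>\<omega>. \<integral>d. Y \<omega> * \<phi> d \<partial>gauss (t - s) \<partial>distr M (F s) (\<lambda>\<omega>. \<omega>))"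
  proof -
    have "integrable (distr M (F s \<Otimes>\<^sub>M borel) (\<lambda>\<omega>. (\<omega>, B t \<omega> - B s \<omega>))) (\<lambda>(\<omega>, d). Y \<omega> * \<phi> d)"
      by (subst integrable_distr_eq[OF m]) (use i in \<open>auto simp: split_beta'\<close>)
    then have "integrable (distr M (F s) (\<lambda>\<omega>. \<omega>) \<Otimes>\<^sub>M gauss (t - s)) (\<lambda>(\<omega>, d). Y \<omega> * \<phi> d)"
      by (simp add: distr_pair_increment[OF st])
    from Q.integral_fst'[OF this] show ?thesis by simp
  qed
  also have "\<dots> = (\<integral>\<omega>. Y \<omega> \<partial>distr M (F s) (\<lambda>\<omega>. \<omega>)) * (\<integral>x. \<phi> x \<partial>gauss (t - s))" by simp
  also have "(\<integral>\<omega>. Y \<omega> \<partial>distr M (F s) (\<lambda>\<omega>. \<omega>)) = (\<integral>\<omega>. Y \<omega> \<partial>M)"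
    by (rule integral_distr[OF m1 Y(1)])
  finally show "(\<integral>\<omega>. Y \<omega> * \<phi> (B t \<omega> - B s \<omega>) \<partial>M) = (\<integral>\<omega>. Y \<omega> \<partial>M) * (\<integral>x. \<phi> x \<partial>gauss (t - s))" .
qed

text \<open>Induction on \<open>n\<close>: the mixed term vanishes because \<open>\<phi>\<close> has
  mean 0 and the earlier sum is known at time \<open>p n\<close>. A general \<open>\<phi>\<close>
  covers both the plain increment and the second-order error of the exponential.\<close>

lemma L2_sum_increments:
  fixes H :: "nat \<Rightarrow> 'a \<Rightarrow> real" and \<phi> :: "real \<Rightarrow> real"
  assumes D: "0 < D" and p: "\<And>i. 0 \<le> p i" "\<And>i. p (Suc i) = p i + D"
    and \<phi>: "integrable (gauss D) \<phi>" "integrable (gauss D) (\<lambda>x. (\<phi> x)\<^sup>2)" "(\<integral>x. \<phi> x \<partial>gauss D) = 0"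
    and H: "\<And>i. H i \<in> borel_measurable (F (p i))" "\<And>i. integrable M (\<lambda>\<omega>. (H i \<omega>)\<^sup>2)"
  defines "S \<equiv> \<lambda>n \<omega>. \<Sum>i<n. H i \<omega> * \<phi> (B (p (Suc i)) \<omega> - B (p i) \<omega>)"
  shows "integrable M (\<lambda>\<omega>. (S n \<omega>)\<^sup>2)"
    and "(\<integral>\<omega>. (S n \<omega>)\<^sup>2 \<partial>M) = (\<integral>x. (\<phi> x)\<^sup>2 \<partial>gauss D) * (\<Sum>i<n. \<integral>\<omega>. (H i \<omega>)\<^sup>2 \<partial>M)"
proof -
  have [measurable]: "\<phi> \<in> borel_measurable borel" using \<phi>(1) by auto
  have S: "S n \<in> borel_measurable (F (p n)) \<and> integrable M (\<lambda>\<omega>. (S n \<omega>)\<^sup>2)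
    \<and> (\<integral>\<omega>. (S n \<omega>)\<^sup>2 \<partial>M) = (\<integral>x. (\<phi> x)\<^sup>2 \<partial>gauss D) * (\<Sum>i<n. \<integral>\<omega>. (H i \<omega>)\<^sup>2 \<partial>M)" for n
  proof (induction n)
    case 0
    then show ?case by (simp add: S_def)
  next
    case (Suc n)
    have le: "p n \<le> p (Suc n)" and lt: "p n < p (Suc n)" and d: "p (Suc n) - p n = D" using p D by auto
    let ?x = "\<lambda>\<omega>. \<phi> (B (p (Suc n)) \<omega> - B (p n) \<omega>)"
    have SS: "S (Suc n) = (\<lambda>\<omega>. S n \<omega> + H n \<omega> * ?x \<omega>)" by (simp add: S_def)
    note mS = conjunct1[OF Suc.IH]
    note [measurable] = measurable_F_mono[OF mS le] measurable_F_mono[OF H(1) le]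
      B_measurable_F[OF p(1) le] B_adapted[OF p(1)[of "Suc n"]]
    have m: "S (Suc n) \<in> borel_measurable (F (p (Suc n)))"
      unfolding SS by measurable
    have mF: "(\<lambda>\<omega>. S n \<omega> * H n \<omega>) \<in> borel_measurable (F (p n))"
      using mS H(1)[of n] by measurable
    have iSH: "integrable M (\<lambda>\<omega>. S n \<omega> * H n \<omega>)"
      by (rule integrable_mult_of_squares) (use mS H Suc.IH measurable_from_F in blast)+
    have mF2: "(\<lambda>\<omega>. (H n \<omega>)\<^sup>2) \<in> borel_measurable (F (p n))" using H(1)[of n] by measurable
    note c = integral_increment_mult[OF p(1) lt mF iSH, of \<phi>, unfolded d, OF \<phi>(1)]
    note q = integral_increment_mult[OF p(1) lt mF2 H(2), of "\<lambda>x. (\<phi> x)\<^sup>2", unfolded d, OF \<phi>(2)]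
    have e: "(\<lambda>\<omega>. (S (Suc n) \<omega>)\<^sup>2) = (\<lambda>\<omega>. (S n \<omega>)\<^sup>2 + 2 * (S n \<omega> * H n \<omega> * ?x \<omega>) + (H n \<omega>)\<^sup>2 * (?x \<omega>)\<^sup>2)"
      unfolding SS by (rule ext) (simp add: power2_sum power_mult_distrib algebra_simps)
    show ?case
      unfolding e using m c q Suc.IH by (simp add: \<phi>(3) distrib_left mult.commute)
  qed
  show "integrable M (\<lambda>\<omega>. (S n \<omega>)\<^sup>2)"
    "(\<integral>\<omega>. (S n \<omega>)\<^sup>2 \<partial>M) = (\<integral>x. (\<phi> x)\<^sup>2 \<partial>gauss D) * (\<Sum>i<n. \<integral>\<omega>. (H i \<omega>)\<^sup>2 \<partial>M)"
    using S by auto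
qed

end

lemma gauss_moments:
  assumes v: "0 < v"
  shows "integrable (gauss v) (\<lambda>x. x)" "integrable (gauss v) (\<lambda>x. x\<^sup>2)"
    "(\<integral>x. x \<partial>gauss v) = 0" "(\<integral>x. x\<^sup>2 \<partial>gauss v) = v"
proof -
  have s: "0 < sqrt v" using v by simp
  show "integrable (gauss v) (\<lambda>x. x)" "(\<integral>x. x \<partial>gauss v) = 0"
    using integrable_normal_moment_nz_1[OF s, of 0] integral_normal_moment_nz_1[OF s, of 0]
    by (subst integrable_density integral_density; simp)+
  show "integrable (gauss v) (\<lambda>x. x\<^sup>2)"
    using integrable_normal_moment[OF s, of 0 2] by (subst integrable_density) simp_all
  show "(\<integral>x. x\<^sup>2 \<partial>gauss v) = v"
    using integral_normal_moment_even[OF s, of 0 1] v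
    by (subst integral_density) (simp_all add: power2_eq_square field_simps)
qed

text \<open>Here \<open>\<phi>\<close> is the error made when the relative growth of the exponential
  martingale over one step is replaced by the Brownian increment. Its second moment is of order
  \<open>v^2\<close>.\<close>

lemma gauss_exp_moments:
  assumes v: "0 < v"
  defines "\<phi> \<equiv> \<lambda>x. exp (x - v / 2) - 1 - x"
  shows "integrable (gauss v) \<phi>" "integrable (gauss v) (\<lambda>x. (\<phi> x)\<^sup>2)" "(\<integral>x. \<phi> x \<partial>gauss v) = 0"
    "(\<integral>x. (\<phi> x)\<^sup>2 \<partial>gauss v) = exp v - 1 - v"
proof -
  interpret G: prob_space "gauss v" using v by (rule prob_space_gauss)
  have s: "0 < sqrt v" using v by simp
  have e: "integrable (gauss v) (\<lambda>x. exp (c * x - c\<^sup>2 * v / 2)) \<and> (\<integral>x. exp (c * x - c\<^sup>2 * v / 2) \<partial>gauss v) = 1" for c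
  proof
    show "integrable (gauss v) (\<lambda>x. exp (c * x - c\<^sup>2 * v / 2))"
      using nn_integral_gauss_exp[OF v, of c] by (intro integrableI_bounded) auto
    show "(\<integral>x. exp (c * x - c\<^sup>2 * v / 2) \<partial>gauss v) = 1"
      using nn_integral_gauss_exp[OF v, of c] by (subst integral_eq_nn_integral) auto
  qed
  have e1: "integrable (gauss v) (\<lambda>x. exp (x - v / 2))" "(\<integral>x. exp (x - v / 2) \<partial>gauss v) = 1"
    using e[of 1] by simp_all
  have e2: "integrable (gauss v) (\<lambda>x. (exp (x - v / 2))\<^sup>2)" "(\<integral>x. (exp (x - v / 2))\<^sup>2 \<partial>gauss v) = exp v"
  proof -
    have x: "(exp (x - v / 2))\<^sup>2 = exp v * exp (2 * x - 2\<^sup>2 * v / 2)" for x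
      by (simp add: exp_double[symmetric] exp_add[symmetric] field_simps)
    show "integrable (gauss v) (\<lambda>x. (exp (x - v / 2))\<^sup>2)" "(\<integral>x. (exp (x - v / 2))\<^sup>2 \<partial>gauss v) = exp v"
      using e[of 2] unfolding x by simp_all
  qed
  have e3: "integrable (gauss v) (\<lambda>x. x * exp (x - v / 2))" "(\<integral>x. x * exp (x - v / 2) \<partial>gauss v) = v"
  proof -
    have eq: "normal_density 0 (sqrt v) x * (x * exp (x - v / 2)) = normal_density v (sqrt v) x * x" for x
      using v by (simp add: normal_density_def exp_add[symmetric] power2_eq_square field_simps)
    show "integrable (gauss v) (\<lambda>x. x * exp (x - v / 2))"
      using integrable_normal_moment_nz_1[OF s, of v]
      by (subst integrable_density, simp, simp, simp, simp only: real_scaleR_def eq)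
    show "(\<integral>x. x * exp (x - v / 2) \<partial>gauss v) = v"
      using integral_normal_moment_nz_1[OF s, of v]
      by (subst integral_density, simp, simp, simp, simp only: real_scaleR_def eq)
  qed
  note m = gauss_moments[OF v]
  show "integrable (gauss v) \<phi>" unfolding \<phi>_def using e1 m by auto
  show "(\<integral>x. \<phi> x \<partial>gauss v) = 0" unfolding \<phi>_def using e1 m G.prob_space by simp
  have x: "(\<phi> x)\<^sup>2 = (exp (x - v / 2))\<^sup>2 - 2 * exp (x - v / 2) - 2 * (x * exp (x - v / 2)) + 1 + 2 * x + x\<^sup>2" for x
    by (simp add: \<phi>_def power2_eq_square algebra_simps)
  show "integrable (gauss v) (\<lambda>x. (\<phi> x)\<^sup>2)" unfolding x using e1 e2 e3 m by auto
  show "(\<integral>x. (\<phi> x)\<^sup>2 \<partial>gauss v) = exp v - 1 - v"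
    unfolding x using e1 e2 e3 m G.prob_space by simp
qed

context continuous_bm
begin

lemma stoch_exp_square:
  assumes "0 \<le> t" shows "integrable M (\<lambda>\<omega>. (stoch_exp t \<omega>)\<^sup>2)" "(\<integral>\<omega>. (stoch_exp t \<omega>)\<^sup>2 \<partial>M) = exp t"
proof -
  have nn: "(\<integral>\<^sup>+\<omega>. ennreal ((stoch_exp t \<omega>)\<^sup>2) \<partial>M) = ennreal (exp t)"
  proof (cases "t = 0")
    case True
    have "(\<integral>\<^sup>+\<omega>. ennreal ((stoch_exp t \<omega>)\<^sup>2) \<partial>M) = (\<integral>\<^sup>+\<omega>. 1 \<partial>M)"
      by (rule nn_integral_cong) (simp add: True stoch_exp_0)
    then show ?thesis by (simp add: True emeasure_space_1)
  next
    case False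
    then have t: "0 < t" using assms by simp
    have "(stoch_exp t \<omega>)\<^sup>2 = exp t * exp (2 * B t \<omega> - 2\<^sup>2 * t / 2)" for \<omega>
      by (simp add: stoch_exp_def exp_double[symmetric] exp_add[symmetric] field_simps)
    then have "(\<integral>\<^sup>+\<omega>. ennreal ((stoch_exp t \<omega>)\<^sup>2) \<partial>M) = (\<integral>\<^sup>+\<omega>. (\<lambda>x. ennreal (exp t) * ennreal (exp (2 * x - 2\<^sup>2 * t / 2))) (B t \<omega>) \<partial>M)"
      by (simp add: ennreal_mult')
    also have "\<dots> = (\<integral>\<^sup>+x. ennreal (exp t) * ennreal (exp (2 * x - 2\<^sup>2 * t / 2)) \<partial>gauss t)"
      by (rule nn_integral_B[OF t]) measurable
    also have "\<dots> = ennreal (exp t)"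
      using nn_integral_gauss_exp[OF t, of 2] by (simp add: nn_integral_cmult)
    finally show ?thesis .
  qed
  note [measurable] = stoch_exp_measurable[OF assms]
  show "integrable M (\<lambda>\<omega>. (stoch_exp t \<omega>)\<^sup>2)" using nn by (intro integrableI_bounded) auto
  show "(\<integral>\<omega>. (stoch_exp t \<omega>)\<^sup>2 \<partial>M) = exp t" using nn by (subst integral_eq_nn_integral) auto
qed

text \<open>The error telescopes into a sum of terms \<open>stoch_exp * \<phi>\<close>, to which the
  isometry applies. For \<open>n\<close> of order \<open>1 / D\<close> the bound is of order
  \<open>D\<close>, so the integral equation holds in the limit along uniform partitions.\<close>

lemma stoch_exp_riemann_sum:
  assumes D: "0 < D"
  defines "p \<equiv> \<lambda>i. real i * D"
  shows "(\<integral>\<^sup>+\<omega>. ennreal (((\<Sum>i<n. stoch_exp (p i) \<omega> * (B (p (Suc i)) \<omega> - B (p i) \<omega>)) - (stoch_exp (p n) \<omega> - 1))\<^sup>2) \<partial>M)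
    \<le> ennreal (real n * exp (p n) * (exp D - 1 - D))"
proof -
  let ?\<phi> = "\<lambda>x. exp (x - D / 2) - 1 - x"
  let ?S = "\<lambda>\<omega>. \<Sum>i<n. stoch_exp (p i) \<omega> * ?\<phi> (B (p (Suc i)) \<omega> - B (p i) \<omega>)"
  have p: "0 \<le> p i" "p (Suc i) = p i + D" for i using D by (auto simp: p_def algebra_simps)
  have telescope: "(\<Sum>i<k. stoch_exp (p i) \<omega> * ?\<phi> (B (p (Suc i)) \<omega> - B (p i) \<omega>))
      = (stoch_exp (p k) \<omega> - 1) - (\<Sum>i<k. stoch_exp (p i) \<omega> * (B (p (Suc i)) \<omega> - B (p i) \<omega>))"
    if \<omega>: "\<omega> \<in> space M" for \<omega> k
  proof (induction k)
    case (Suc k)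
    have "B (p (Suc k)) \<omega> - p (Suc k) / 2 = (B (p k) \<omega> - p k / 2) + (B (p (Suc k)) \<omega> - B (p k) \<omega> - D / 2)"
      by (simp add: p(2) field_simps)
    then have "stoch_exp (p (Suc k)) \<omega> = stoch_exp (p k) \<omega> * exp (B (p (Suc k)) \<omega> - B (p k) \<omega> - D / 2)"
      unfolding stoch_exp_def exp_add[symmetric] by simp
    then show ?case using Suc by (simp add: algebra_simps)
  qed (use \<omega> in \<open>simp add: p_def stoch_exp_0\<close>)
  note L2 = L2_sum_increments[where H = "\<lambda>i. stoch_exp (p i)" and p = p, OF D p gauss_exp_moments(1-3)[OF D] stoch_exp_measurable_F[OF p(1) order_refl] stoch_exp_square(1)[OF p(1)]]
  have "(\<integral>\<^sup>+\<omega>. ennreal (((\<Sum>i<n. stoch_exp (p i) \<omega> * (B (p (Suc i)) \<omega> - B (p i) \<omega>)) - (stoch_exp (p n) \<omega> - 1))\<^sup>2) \<partial>M)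
     = (\<integral>\<^sup>+\<omega>. ennreal ((?S \<omega>)\<^sup>2) \<partial>M)"
    by (intro nn_integral_cong) (simp add: telescope power2_commute)
  also have "\<dots> = ennreal (\<integral>\<omega>. (?S \<omega>)\<^sup>2 \<partial>M)"
    by (rule nn_integral_eq_integral) (use L2(1)[of n] in auto)
  also have "(\<integral>\<omega>. (?S \<omega>)\<^sup>2 \<partial>M) = (exp D - 1 - D) * (\<Sum>i<n. exp (p i))"
    using L2(2)[of n] by (simp add: gauss_exp_moments[OF D] stoch_exp_square(2)[OF p(1)])
  also have "\<dots> \<le> (exp D - 1 - D) * (\<Sum>i<n. exp (p n))"
  proof (intro mult_left_mono sum_mono)
    show "0 \<le> exp D - 1 - D" using exp_ge_add_one_self[of D] by linarith
  qed (use D in \<open>auto simp: p_def\<close>)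
  finally show ?thesis by (simp add: mult_ac ennreal_leI)
qed

end

lemma nn_integral_step:
  fixes a :: "nat \<Rightarrow> ennreal"
  assumes D: "0 < D"
  shows "(\<integral>\<^sup>+s. a (nat \<lfloor>s / D\<rfloor>) * indicator {0..<real n * D} s \<partial>lborel) = (\<Sum>i<n. ennreal D * a i)"
proof (induction n)
  case (Suc n)
  have "(\<integral>\<^sup>+s. a (nat \<lfloor>s / D\<rfloor>) * indicator {0..<real (Suc n) * D} s \<partial>lborel)
    = (\<integral>\<^sup>+s. a (nat \<lfloor>s / D\<rfloor>) * indicator {0..<real n * D} s + a n * indicator {real n * D..<real (Suc n) * D} s \<partial>lborel)"
  proof (rule nn_integral_cong)
    fix s :: real
    have n: "real n * D \<le> real (Suc n) * D" "0 \<le> real n * D" using D by auto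
    show "a (nat \<lfloor>s / D\<rfloor>) * indicator {0..<real (Suc n) * D} s
      = a (nat \<lfloor>s / D\<rfloor>) * indicator {0..<real n * D} s + a n * indicator {real n * D..<real (Suc n) * D} s"
    proof (cases "s \<in> {real n * D..<real (Suc n) * D}")
      case True
      then have "\<lfloor>s / D\<rfloor> = int n"
        using D by (intro floor_unique) (auto simp: field_simps)
      then show ?thesis using True n by (auto simp: indicator_def)
    next
      case False
      then show ?thesis using n by (auto simp: indicator_def)
    qed
  qed
  also have "\<dots> = (\<Sum>i<n. ennreal D * a i) + a n * ennreal D"
  proof -
    have "(\<integral>\<^sup>+s. a n * indicator {real n * D..<real (Suc n) * D} s \<partial>lborel) = a n * ennreal D"
      using D by (subst nn_integral_cmult) (auto simp: algebra_simps)
    then show ?thesis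
      by (subst nn_integral_add, measurable, simp only: Suc.IH)
  qed
  finally show ?case by (simp add: mult.commute)
qed simp

text \<open>Gronwall by iteration: inserting the inequality into itself \<open>m\<close> times
  yields the bound \<open>C * t ^ m / fact m\<close>, which tends to 0.\<close>

lemma integral_inequality_zero:
  fixes f :: "real \<Rightarrow> ennreal"
  assumes b: "\<And>t. f t \<le> ennreal C"
    and i: "\<And>t. 0 < t \<Longrightarrow> f t \<le> (\<integral>\<^sup>+s. f s * indicator {0..<t} s \<partial>lborel)"
    and C: "0 \<le> C" and t: "0 < t"
  shows "f t = 0"
proof -
  have "f t \<le> ennreal (C * t ^ m / fact m)" if "0 < t" for t m
    using that
  proof (induction m arbitrary: t)
    case (Suc m)
    have "f t \<le> (\<integral>\<^sup>+s. f s * indicator {0..<t} s \<partial>lborel)" using i Suc.prems .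
    also have "\<dots> \<le> (\<integral>\<^sup>+s. ennreal (C * s ^ m / fact m) * indicator {0..t} s \<partial>lborel)"
    proof (rule nn_integral_mono_AE)
      \<comment> \<open>The induction hypothesis speaks of positive times only, hence the point 0 is
        discarded.\<close>
      have "AE s in lborel. s \<noteq> (0::real)" by (rule AE_lborel_singleton)
      then show "AE s in lborel. f s * indicator {0..<t} s \<le> ennreal (C * s ^ m / fact m) * indicator {0..t} s"
        by eventually_elim (use Suc.IH in \<open>auto simp: indicator_def\<close>)
    qed
    also have "\<dots> = ennreal (C * t ^ Suc m / fact (Suc m) - C * 0 ^ Suc m / fact (Suc m))"
    proof (rule nn_integral_FTC_Icc)
      fix s :: real
      show "((\<lambda>s. C * s ^ Suc m / fact (Suc m)) has_real_derivative C * s ^ m / fact m) (at s)"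
        by (rule derivative_eq_intros refl | simp)+
    qed (use Suc.prems C in auto)
    finally show ?case by simp
  qed (use b in simp)
  moreover have "(\<lambda>m. ennreal (C * t ^ m / fact m)) \<longlonglongrightarrow> ennreal (C * 0)"
  proof (rule tendsto_ennrealI)
    have "(\<lambda>m. t ^ m / fact m) \<longlonglongrightarrow> 0"
      using summable_LIMSEQ_zero[OF summable_exp_generic[of t]] by (simp add: divide_inverse mult.commute)
    from tendsto_mult_left[OF this, of C] show "(\<lambda>m. C * t ^ m / fact m) \<longlonglongrightarrow> C * 0" by simp
  qed
  ultimately have "f t \<le> ennreal (C * 0)"
    using t by (intro LIMSEQ_le_const) auto
  then show ?thesis by simp
qed

section \<open>Truncated second moment of the difference of two solutions\<close>

locale exponential_bm_paths = continuous_bm M F B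
  for M :: "'a measure" and F B +
  fixes P :: "real \<Rightarrow> 'a \<Rightarrow> real"
  assumes ebm: "exponential_brownian_motion M F B P"
    and P_0: "\<And>\<omega>. \<omega> \<in> space M \<Longrightarrow> P 0 \<omega> = 1"
    and P_cont: "\<And>\<omega>. \<omega> \<in> space M \<Longrightarrow> continuous_on {0..} (\<lambda>t. P t \<omega>)"
begin

definition diff_sol :: "real \<Rightarrow> 'a \<Rightarrow> real" where "diff_sol t \<omega> = P t \<omega> - stoch_exp t \<omega>"

lemma P_adapted: "0 \<le> t \<Longrightarrow> P t \<in> borel_measurable (F t)"
  using ebm by (auto simp: exponential_brownian_motion_def adapted_def)

lemma P_measurable: "0 \<le> t \<Longrightarrow> P t \<in> borel_measurable M"
  using P_adapted measurable_from_F by blast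

lemma diff_sol_measurable_F: "0 \<le> s \<Longrightarrow> s \<le> t \<Longrightarrow> diff_sol s \<in> borel_measurable (F t)"
  unfolding diff_sol_def using measurable_F_mono[OF P_adapted, of s t] stoch_exp_measurable_F[of s t] by simp

lemma diff_sol_measurable: "0 \<le> t \<Longrightarrow> diff_sol t \<in> borel_measurable M"
  using diff_sol_measurable_F measurable_from_F by blast

lemma diff_sol_cont: "\<omega> \<in> space M \<Longrightarrow> continuous_on {0..} (\<lambda>t. diff_sol t \<omega>)"
  unfolding diff_sol_def by (intro continuous_intros P_cont stoch_exp_cont)

context
  fixes T K :: real
  assumes T: "0 < T" and K: "0 \<le> K"
begin

definition mesh :: "nat \<Rightarrow> real" where "mesh n = T / 2 ^ n"

definition grid :: "nat \<Rightarrow> nat \<Rightarrow> real" where "grid n i = real i * mesh n"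

lemma mesh_pos: "0 < mesh n" using T by (simp add: mesh_def)

lemma grid_nonneg: "0 \<le> grid n i" using mesh_pos[of n] by (simp add: grid_def)

lemma grid_Suc: "grid n (Suc i) = grid n i + mesh n" by (simp add: grid_def algebra_simps)

lemma grid_mono: "i \<le> j \<Longrightarrow> grid n i \<le> grid n j" using mesh_pos[of n] by (simp add: grid_def)

lemma grid_last: "grid n (2 ^ n) = T" by (simp add: grid_def mesh_def)

lemma mesh_lim: "mesh \<longlonglongrightarrow> 0"
  unfolding mesh_def by (intro LIMSEQ_divide_realpow_zero) auto

definition riemann_sum :: "nat \<Rightarrow> 'a \<Rightarrow> real" where
  "riemann_sum n \<omega> = (\<Sum>i<2 ^ n. diff_sol (grid n i) \<omega> * (B (grid n (Suc i)) \<omega> - B (grid n i) \<omega>))"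

lemma riemann_sum_measurable[measurable]: "riemann_sum n \<in> borel_measurable M"
  unfolding riemann_sum_def using diff_sol_measurable B_measurable grid_nonneg by auto

text \<open>By linearity the error splits into that of \<open>P\<close>, small by the definition of
  the Ito integral, and that of \<open>stoch_exp\<close>, small by Chebyshev's inequality. Each part
  receives \<open>\<delta>\<close>, half of \<open>\<epsilon>\<close>.\<close>

lemma riemann_sum_converges:
  assumes \<epsilon>: "0 < \<epsilon>"
  shows "eventually (\<lambda>n. prob {\<omega> \<in> space M. \<epsilon> < \<bar>riemann_sum n \<omega> - diff_sol T \<omega>\<bar>} \<le> \<epsilon>) sequentially"
proof -
  define \<delta> where "\<delta> = \<epsilon> / 2"
  have \<delta>: "0 < \<delta>" using \<epsilon> by (simp add: \<delta>_def)
  let ?P = "\<lambda>n \<omega>. \<Sum>i<2 ^ n. P (grid n i) \<omega> * (B (grid n (Suc i)) \<omega> - B (grid n i) \<omega>)"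
  let ?E = "\<lambda>n \<omega>. \<Sum>i<2 ^ n. stoch_exp (grid n i) \<omega> * (B (grid n (Suc i)) \<omega> - B (grid n i) \<omega>)"
  have [measurable]: "?P n \<in> borel_measurable M" "?E n \<in> borel_measurable M"
    "P T \<in> borel_measurable M" "P 0 \<in> borel_measurable M" "stoch_exp T \<in> borel_measurable M" "diff_sol T \<in> borel_measurable M" for n
    using P_measurable stoch_exp_measurable B_measurable diff_sol_measurable grid_nonneg T by auto
  have "has_ito_integral M B P T (\<lambda>\<omega>. P T \<omega> - P 0 \<omega>)"
    using ebm T by (auto simp: exponential_brownian_motion_def)
  then obtain \<eta> where \<eta>: "0 < \<eta>"
    and ito: "\<And>n p. partition_mesh_less T \<eta> n p \<Longrightarrow> measure M {\<omega> \<in> space M.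
        \<delta> < \<bar>(\<Sum>i<n. P (p i) \<omega> * (B (p (Suc i)) \<omega> - B (p i) \<omega>)) - (P T \<omega> - P 0 \<omega>)\<bar>} < \<delta>"
    using \<delta> unfolding has_ito_integral_def by blast
  have "eventually (\<lambda>n. mesh n < \<eta>) sequentially" using order_tendstoD(2)[OF mesh_lim \<eta>] .
  \<comment> \<open>A mesh below 1 admits the bound \<open>exp x \<le> 1 + x + x^2\<close>. In the
    next condition, \<open>\<delta> ^ 3\<close> divided by Chebyshev's \<open>\<delta> ^ 2\<close>
    leaves \<open>\<delta>\<close>.\<close>
  moreover have "eventually (\<lambda>n. mesh n < 1) sequentially" using order_tendstoD(2)[OF mesh_lim] by simp
  moreover have "eventually (\<lambda>n. T * exp T * mesh n < \<delta> ^ 3) sequentially"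
  proof -
    have "(\<lambda>n. T * exp T * mesh n) \<longlonglongrightarrow> T * exp T * 0" by (intro tendsto_mult_left mesh_lim)
    then show ?thesis by (rule order_tendstoD(2)) (use \<delta> in simp)
  qed
  ultimately show ?thesis
  proof eventually_elim
    case (elim n)
    have 1: "prob {\<omega> \<in> space M. \<delta> < \<bar>?P n \<omega> - (P T \<omega> - P 0 \<omega>)\<bar>} < \<delta>"
      by (rule ito) (use elim mesh_pos[of n] grid_last in \<open>auto simp: partition_mesh_less_def grid_Suc\<close>, simp add: grid_def)
    have 2: "prob {\<omega> \<in> space M. \<delta> < \<bar>?E n \<omega> - (stoch_exp T \<omega> - 1)\<bar>} \<le> \<delta>"
    proof -
      have "(\<integral>\<^sup>+\<omega>. ennreal ((?E n \<omega> - (stoch_exp T \<omega> - 1))\<^sup>2) \<partial>M) \<le> ennreal (real (2 ^ n) * exp T * (exp (mesh n) - 1 - mesh n))"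
        using stoch_exp_riemann_sum[OF mesh_pos[of n], of "2 ^ n"] unfolding grid_def[symmetric] grid_last .
      also have "\<dots> \<le> ennreal (real (2 ^ n) * exp T * (mesh n)\<^sup>2)"
        using exp_bound[of "mesh n"] mesh_pos[of n] elim by (intro ennreal_leI mult_left_mono) auto
      also have "real (2 ^ n) * exp T * (mesh n)\<^sup>2 = T * exp T * mesh n"
        by (simp add: mesh_def power2_eq_square)
      also have "ennreal \<dots> \<le> ennreal (\<delta> ^ 3)" using elim by (intro ennreal_leI) auto
      finally have b: "(\<integral>\<^sup>+\<omega>. ennreal ((?E n \<omega> - (stoch_exp T \<omega> - 1))\<^sup>2) \<partial>M) \<le> ennreal (\<delta> ^ 3)" .
      have "emeasure M {\<omega> \<in> space M. \<delta> < \<bar>?E n \<omega> - (stoch_exp T \<omega> - 1)\<bar>}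
        \<le> emeasure M {\<omega> \<in> space M. 1 \<le> ennreal (1 / \<delta>\<^sup>2) * ennreal ((?E n \<omega> - (stoch_exp T \<omega> - 1))\<^sup>2)}"
      proof (rule emeasure_mono)
        show "{\<omega> \<in> space M. \<delta> < \<bar>?E n \<omega> - (stoch_exp T \<omega> - 1)\<bar>}
          \<subseteq> {\<omega> \<in> space M. 1 \<le> ennreal (1 / \<delta>\<^sup>2) * ennreal ((?E n \<omega> - (stoch_exp T \<omega> - 1))\<^sup>2)}"
        proof safe
          fix \<omega> assume "\<delta> < \<bar>?E n \<omega> - (stoch_exp T \<omega> - 1)\<bar>"
          then have "\<delta>\<^sup>2 \<le> \<bar>?E n \<omega> - (stoch_exp T \<omega> - 1)\<bar>\<^sup>2" using \<delta> by (intro power_mono) auto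
          then have "1 \<le> 1 / \<delta>\<^sup>2 * (?E n \<omega> - (stoch_exp T \<omega> - 1))\<^sup>2" using \<delta> by (simp add: field_simps)
          then show "1 \<le> ennreal (1 / \<delta>\<^sup>2) * ennreal ((?E n \<omega> - (stoch_exp T \<omega> - 1))\<^sup>2)"
            using \<delta> by (simp only: ennreal_mult'[symmetric] zero_le_divide_1_iff zero_le_power2 ennreal_ge_1)
        qed
      qed measurable
      also have "\<dots> \<le> ennreal (1 / \<delta>\<^sup>2) * (\<integral>\<^sup>+\<omega>. ennreal ((?E n \<omega> - (stoch_exp T \<omega> - 1))\<^sup>2) * indicator (space M) \<omega> \<partial>M)"
        by (rule nn_integral_Markov_inequality) auto
      also have "\<dots> \<le> ennreal (1 / \<delta>\<^sup>2) * ennreal (\<delta> ^ 3)"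
        using b by (intro mult_left_mono) (auto cong: nn_integral_cong)
      also have "\<dots> = ennreal \<delta>" using \<delta> by (simp flip: ennreal_mult' add: power2_eq_square power3_eq_cube)
      finally show ?thesis using \<delta> by (simp add: emeasure_eq_measure)
    qed
    have "prob {\<omega> \<in> space M. \<epsilon> < \<bar>riemann_sum n \<omega> - diff_sol T \<omega>\<bar>}
      \<le> prob ({\<omega> \<in> space M. \<delta> < \<bar>?P n \<omega> - (P T \<omega> - P 0 \<omega>)\<bar>} \<union> {\<omega> \<in> space M. \<delta> < \<bar>?E n \<omega> - (stoch_exp T \<omega> - 1)\<bar>})"
    proof (rule finite_measure_mono)
      show "{\<omega> \<in> space M. \<epsilon> < \<bar>riemann_sum n \<omega> - diff_sol T \<omega>\<bar>}
        \<subseteq> {\<omega> \<in> space M. \<delta> < \<bar>?P n \<omega> - (P T \<omega> - P 0 \<omega>)\<bar>} \<union> {\<omega> \<in> space M. \<delta> < \<bar>?E n \<omega> - (stoch_exp T \<omega> - 1)\<bar>}"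
      proof
        have half: "\<epsilon> < \<bar>x - y\<bar> \<Longrightarrow> \<delta> < \<bar>x\<bar> \<or> \<delta> < \<bar>y\<bar>" for x y
          unfolding \<delta>_def by arith
        fix \<omega> assume \<omega>: "\<omega> \<in> {\<omega> \<in> space M. \<epsilon> < \<bar>riemann_sum n \<omega> - diff_sol T \<omega>\<bar>}"
        have "riemann_sum n \<omega> = ?P n \<omega> - ?E n \<omega>"
          unfolding riemann_sum_def diff_sol_def by (simp add: sum_subtractf[symmetric] algebra_simps)
        then have "riemann_sum n \<omega> - diff_sol T \<omega> = (?P n \<omega> - (P T \<omega> - P 0 \<omega>)) - (?E n \<omega> - (stoch_exp T \<omega> - 1))"
          using \<omega> P_0[of \<omega>] by (simp add: diff_sol_def)
        then show "\<omega> \<in> {\<omega> \<in> space M. \<delta> < \<bar>?P n \<omega> - (P T \<omega> - P 0 \<omega>)\<bar>} \<union> {\<omega> \<in> space M. \<delta> < \<bar>?E n \<omega> - (stoch_exp T \<omega> - 1)\<bar>}"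
          using \<omega> half[of "?P n \<omega> - (P T \<omega> - P 0 \<omega>)" "?E n \<omega> - (stoch_exp T \<omega> - 1)"] by auto
      qed
    qed measurable
    also have "\<dots> \<le> prob {\<omega> \<in> space M. \<delta> < \<bar>?P n \<omega> - (P T \<omega> - P 0 \<omega>)\<bar>} + prob {\<omega> \<in> space M. \<delta> < \<bar>?E n \<omega> - (stoch_exp T \<omega> - 1)\<bar>}"
      by (rule measure_Un_le) measurable
    also have "\<dots> \<le> \<epsilon>" using 1 2 by (simp add: \<delta>_def)
    finally show ?case .
  qed
qed

text \<open>No moments of \<open>P\<close> are known in advance. Setting the difference to 0 from
  the first grid point on at which it exceeds \<open>K\<close> makes it bounded and keeps it
  adapted, as the isometry requires.\<close>

definition stopped :: "nat \<Rightarrow> nat \<Rightarrow> 'a \<Rightarrow> real" where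
  "stopped n i \<omega> = diff_sol (grid n i) \<omega> * (\<Prod>j\<le>i. indicator {- K..K} (diff_sol (grid n j) \<omega>))"

lemma stopped_measurable_F: "stopped n i \<in> borel_measurable (F (grid n i))"
  unfolding stopped_def
  by (intro borel_measurable_times diff_sol_measurable_F borel_measurable_prod grid_nonneg grid_mono order_refl
      measurable_compose[OF diff_sol_measurable_F]) (auto simp: grid_nonneg grid_mono)

lemma stopped_measurable[measurable]: "stopped n i \<in> borel_measurable M"
  using stopped_measurable_F measurable_from_F by blast

lemma stopped_eq: "stopped n i \<omega> = (if \<forall>j\<le>i. \<bar>diff_sol (grid n j) \<omega>\<bar> \<le> K then diff_sol (grid n i) \<omega> else 0)"
proof (cases "\<forall>j\<le>i. \<bar>diff_sol (grid n j) \<omega>\<bar> \<le> K")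
  case True
  then have "(\<Prod>j\<le>i. indicator {- K..K} (diff_sol (grid n j) \<omega>)) = (1::real)"
    by (intro prod.neutral) (auto simp: indicator_def abs_le_iff)
  then show ?thesis using True by (simp add: stopped_def)
next
  case False
  then obtain j where "j \<le> i" "\<not> \<bar>diff_sol (grid n j) \<omega>\<bar> \<le> K" by auto
  then have z: "(\<Prod>j\<le>i. indicator {- K..K} (diff_sol (grid n j) \<omega>)) = (0::real)"
    by (intro prod_zero) (auto simp: indicator_def abs_le_iff intro!: bexI[of _ j])
  show ?thesis unfolding stopped_def z using False by auto
qed

lemma stopped_bound: "(stopped n i \<omega>)\<^sup>2 \<le> K\<^sup>2"
  using K by (auto simp: stopped_eq abs_le_square_iff[symmetric])

definition bounded_until :: "real \<Rightarrow> 'a \<Rightarrow> bool" where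
  "bounded_until s \<omega> \<longleftrightarrow> (\<forall>u\<in>{0..s}. \<bar>diff_sol u \<omega>\<bar> \<le> K)"

definition grid_index :: "nat \<Rightarrow> real \<Rightarrow> nat" where "grid_index n s = nat \<lfloor>s / mesh n\<rfloor>"

lemma grid_grid_index: assumes "0 \<le> s" shows "grid n (grid_index n s) \<le> s" "s - mesh n \<le> grid n (grid_index n s)"
proof -
  have f: "real (grid_index n s) = of_int \<lfloor>s / mesh n\<rfloor>"
    using assms mesh_pos[of n] by (simp add: grid_index_def)
  have "of_int \<lfloor>s / mesh n\<rfloor> * mesh n \<le> s / mesh n * mesh n" "(s / mesh n - 1) * mesh n \<le> of_int \<lfloor>s / mesh n\<rfloor> * mesh n"
    using mesh_pos[of n] by (intro mult_right_mono; linarith)+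
  then show "grid n (grid_index n s) \<le> s" "s - mesh n \<le> grid n (grid_index n s)"
    using mesh_pos[of n] by (simp_all add: grid_def f left_diff_distrib)
qed

lemma grid_index_mono: "s \<le> t \<Longrightarrow> grid_index n s \<le> grid_index n t"
  using mesh_pos[of n] unfolding grid_index_def by (intro nat_mono floor_mono divide_right_mono) auto

lemma grid_grid_index_lim: assumes "0 \<le> s" shows "(\<lambda>n. grid n (grid_index n s)) \<longlonglongrightarrow> s"
proof (rule tendsto_sandwich)
  show "(\<lambda>n. s - mesh n) \<longlonglongrightarrow> s" using tendsto_diff[OF tendsto_const mesh_lim, of s] by simp
  show "(\<lambda>n. s) \<longlonglongrightarrow> s" by simp
qed (use grid_grid_index[OF assms] in auto)

lemma diff_sol_grid_index_lim:
  assumes "0 \<le> s" "\<omega> \<in> space M" shows "(\<lambda>n. diff_sol (grid n (grid_index n s)) \<omega>) \<longlonglongrightarrow> diff_sol s \<omega>"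
  by (rule continuous_on_tendsto_compose[OF diff_sol_cont grid_grid_index_lim]) (use assms grid_nonneg in auto)

text \<open>If the path leaves \<open>[-K, K]\<close> at some \<open>u \<le> s\<close>, it exceeds
  \<open>K\<close> strictly there, hence also at the grid point just before \<open>u\<close> once
  the grid is fine, and the stopped value is 0. Otherwise no grid point triggers the cutoff, and
  continuity gives the limit.\<close>

lemma stopped_lim:
  assumes s: "0 \<le> s" and \<omega>: "\<omega> \<in> space M"
  shows "(\<lambda>n. (stopped n (grid_index n s) \<omega>)\<^sup>2) \<longlonglongrightarrow> (if bounded_until s \<omega> then (diff_sol s \<omega>)\<^sup>2 else 0)"
proof (cases "bounded_until s \<omega>")
  case True
  have "stopped n (grid_index n s) \<omega> = diff_sol (grid n (grid_index n s)) \<omega>" for n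
  proof -
    have "\<bar>diff_sol (grid n j) \<omega>\<bar> \<le> K" if "j \<le> grid_index n s" for j
      using True grid_mono[OF that, of n] grid_grid_index(1)[OF s, of n] grid_nonneg[of n j] by (auto simp: bounded_until_def)
    then show ?thesis by (simp add: stopped_eq)
  qed
  then show ?thesis using True diff_sol_grid_index_lim[OF s \<omega>] by (auto intro!: tendsto_power)
next
  case False
  then obtain u where u: "0 \<le> u" "u \<le> s" "K < \<bar>diff_sol u \<omega>\<bar>" by (auto simp: bounded_until_def not_le)
  have "(\<lambda>n. \<bar>diff_sol (grid n (grid_index n u)) \<omega>\<bar>) \<longlonglongrightarrow> \<bar>diff_sol u \<omega>\<bar>"
    by (intro tendsto_rabs diff_sol_grid_index_lim u \<omega>)
  then have "eventually (\<lambda>n. K < \<bar>diff_sol (grid n (grid_index n u)) \<omega>\<bar>) sequentially"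
    using u by (intro order_tendstoD(1)) auto
  then have "eventually (\<lambda>n. (stopped n (grid_index n s) \<omega>)\<^sup>2 = 0) sequentially"
    by eventually_elim (use grid_index_mono[OF u(2)] in \<open>fastforce simp: stopped_eq\<close>)
  then show ?thesis using False by (auto intro: tendsto_eventually)
qed

definition diff_square :: "real \<Rightarrow> ennreal" where
  "diff_square s = (\<integral>\<^sup>+\<omega>. ennreal (if bounded_until s \<omega> then (diff_sol s \<omega>)\<^sup>2 else 0) \<partial>M)"

lemma diff_square_le: "diff_square s \<le> ennreal (K\<^sup>2)" if "0 \<le> s"
proof -
  have "diff_square s \<le> (\<integral>\<^sup>+\<omega>. ennreal (K\<^sup>2) \<partial>M)"
    unfolding diff_square_def using that K
    by (intro nn_integral_mono ennreal_leI) (auto simp: bounded_until_def abs_le_square_iff[symmetric])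
  then show ?thesis by (simp add: emeasure_space_1)
qed

definition stopped_square :: "nat \<Rightarrow> nat \<Rightarrow> ennreal" where
  "stopped_square n i = (\<integral>\<^sup>+\<omega>. ennreal ((stopped n i \<omega>)\<^sup>2) \<partial>M)"

lemma stopped_square_le: "stopped_square n i \<le> ennreal (K\<^sup>2)"
proof -
  have "stopped_square n i \<le> (\<integral>\<^sup>+\<omega>. ennreal (K\<^sup>2) \<partial>M)"
    unfolding stopped_square_def by (intro nn_integral_mono ennreal_leI stopped_bound)
  then show ?thesis by (simp add: emeasure_space_1)
qed

lemma bounded_until_measurable:
  assumes "0 \<le> s" shows "(\<lambda>\<omega>. if bounded_until s \<omega> then (diff_sol s \<omega>)\<^sup>2 else 0) \<in> borel_measurable M"
  by (rule borel_measurable_LIMSEQ_real[OF stopped_lim[OF assms]]) measurable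

lemma stopped_square_lim: assumes "0 \<le> s" shows "(\<lambda>n. stopped_square n (grid_index n s)) \<longlonglongrightarrow> diff_square s"
  unfolding stopped_square_def diff_square_def
proof (rule nn_integral_dominated_convergence[where w = "\<lambda>_. ennreal (K\<^sup>2)"])
  show "(\<lambda>\<omega>. ennreal (if bounded_until s \<omega> then (diff_sol s \<omega>)\<^sup>2 else 0)) \<in> borel_measurable M"
    using bounded_until_measurable[OF assms] by simp
  show "AE \<omega> in M. (\<lambda>n. ennreal ((stopped n (grid_index n s) \<omega>)\<^sup>2)) \<longlonglongrightarrow> ennreal (if bounded_until s \<omega> then (diff_sol s \<omega>)\<^sup>2 else 0)"
    using stopped_lim[OF assms] by (intro AE_I2 tendsto_ennrealI)
  show "AE \<omega> in M. ennreal ((stopped n (grid_index n s) \<omega>)\<^sup>2) \<le> ennreal (K\<^sup>2)" for n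
    by (intro AE_I2 ennreal_leI stopped_bound)
qed (auto simp: emeasure_space_1)

lemma sum_stopped_square: "(\<Sum>i<2 ^ n. ennreal (mesh n) * stopped_square n i) = (\<integral>\<^sup>+s. stopped_square n (grid_index n s) * indicator {0..<T} s \<partial>lborel)"
proof -
  have "real (2 ^ n) * mesh n = T" by (simp add: mesh_def)
  then show ?thesis using nn_integral_step[OF mesh_pos[of n], of "stopped_square n" "2 ^ n"] unfolding grid_index_def by simp
qed

text \<open>The sums are integrals of step functions dominated by \<open>K^2\<close>. That
  \<open>diff_square\<close> is measurable in time comes from its being a pointwise limit of such
  step functions.\<close>

lemma sum_stopped_square_lim: "(\<lambda>n. \<Sum>i<2 ^ n. ennreal (mesh n) * stopped_square n i) \<longlonglongrightarrow> (\<integral>\<^sup>+s. diff_square s * indicator {0..<T} s \<partial>lborel)"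
  unfolding sum_stopped_square
proof (rule nn_integral_dominated_convergence[where w = "\<lambda>s. ennreal (K\<^sup>2) * indicator {0..<T} s"])
  have m: "(\<lambda>s. stopped_square n (grid_index n s) * indicator {0..<T} s) \<in> borel_measurable lborel" for n
    unfolding grid_index_def by measurable
  have l: "(\<lambda>n. stopped_square n (grid_index n s) * indicator {0..<T} s) \<longlonglongrightarrow> diff_square s * indicator {0..<T} s" for s
    using stopped_square_lim[of s] by (cases "0 \<le> s \<and> s < T") (auto simp: indicator_def)
  show "(\<lambda>s. stopped_square n (grid_index n s) * indicator {0..<T} s) \<in> borel_measurable lborel" for n by (rule m)
  show "(\<lambda>s. diff_square s * indicator {0..<T} s) \<in> borel_measurable lborel"
    by (rule borel_measurable_LIMSEQ_order[OF l m])
  show "AE s in lborel. (\<lambda>n. stopped_square n (grid_index n s) * indicator {0..<T} s) \<longlonglongrightarrow> diff_square s * indicator {0..<T} s"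
    using l by simp
  show "AE s in lborel. stopped_square n (grid_index n s) * indicator {0..<T} s \<le> ennreal (K\<^sup>2) * indicator {0..<T} s" for n
    using stopped_square_le by (intro AE_I2 mult_right_mono) auto
  show "(\<integral>\<^sup>+s. ennreal (K\<^sup>2) * indicator {0..<T} s \<partial>lborel) < \<infinity>"
    using T by (simp add: nn_integral_cmult ennreal_mult_less_top)
qed simp

lemma J_square:
  "(\<integral>\<^sup>+\<omega>. ennreal ((\<Sum>i<2 ^ n. stopped n i \<omega> * (B (grid n (Suc i)) \<omega> - B (grid n i) \<omega>))\<^sup>2) \<partial>M)
    = (\<Sum>i<2 ^ n. ennreal (mesh n) * stopped_square n i)"
proof -
  have i: "integrable M (\<lambda>\<omega>. (stopped n i \<omega>)\<^sup>2)" for i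
    by (rule integrable_const_bound[where B = "K\<^sup>2"]) (auto simp: stopped_bound)
  note L2 = L2_sum_increments[where H = "stopped n" and p = "grid n", OF mesh_pos[of n] grid_nonneg grid_Suc
      gauss_moments(1,2,3)[OF mesh_pos[of n]] stopped_measurable_F i, of "2 ^ n"]
  have "(\<integral>\<^sup>+\<omega>. ennreal ((\<Sum>i<2 ^ n. stopped n i \<omega> * (B (grid n (Suc i)) \<omega> - B (grid n i) \<omega>))\<^sup>2) \<partial>M)
    = ennreal (mesh n * (\<Sum>i<2 ^ n. \<integral>\<omega>. (stopped n i \<omega>)\<^sup>2 \<partial>M))"
    using L2 by (subst nn_integral_eq_integral) (auto simp: gauss_moments[OF mesh_pos[of n]])
  also have "\<dots> = (\<Sum>i<2 ^ n. ennreal (mesh n) * stopped_square n i)"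
    unfolding stopped_square_def sum_distrib_left
    using i mesh_pos[of n] by (subst sum_ennreal[symmetric]) (auto simp: nn_integral_eq_integral ennreal_mult')
  finally show ?thesis .
qed

text \<open>As long as the difference stays within \<open>[-K, K]\<close>, the stopped sum is the
  Riemann sum, which is \<open>\<epsilon>\<close>-close to the difference at \<open>T\<close>
  outside an event of probability at most \<open>\<epsilon>\<close>. That event costs at most
  \<open>K^2 * \<epsilon>\<close>.\<close>

lemma diff_square_bound_eps:
  assumes \<epsilon>: "0 < \<epsilon>"
  shows "diff_square T \<le> ennreal (1 + \<epsilon>) * (\<integral>\<^sup>+s. diff_square s * indicator {0..<T} s \<partial>lborel) + ennreal (\<epsilon> + \<epsilon>\<^sup>2 + K\<^sup>2 * \<epsilon>)"
proof (rule LIMSEQ_le_const)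
  show "(\<lambda>n. ennreal (1 + \<epsilon>) * (\<Sum>i<2 ^ n. ennreal (mesh n) * stopped_square n i) + ennreal (\<epsilon> + \<epsilon>\<^sup>2 + K\<^sup>2 * \<epsilon>))
    \<longlonglongrightarrow> ennreal (1 + \<epsilon>) * (\<integral>\<^sup>+s. diff_square s * indicator {0..<T} s \<partial>lborel) + ennreal (\<epsilon> + \<epsilon>\<^sup>2 + K\<^sup>2 * \<epsilon>)"
    by (intro tendsto_add tendsto_const ennreal_tendsto_cmult sum_stopped_square_lim) simp
  have "eventually (\<lambda>n. diff_square T \<le> ennreal (1 + \<epsilon>) * (\<Sum>i<2 ^ n. ennreal (mesh n) * stopped_square n i) + ennreal (\<epsilon> + \<epsilon>\<^sup>2 + K\<^sup>2 * \<epsilon>)) sequentially"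
    using riemann_sum_converges[OF \<epsilon>]
  proof eventually_elim
    case (elim n)
    have [measurable]: "diff_sol T \<in> borel_measurable M" using diff_sol_measurable T by simp
    have [measurable]: "B (grid n i) \<in> borel_measurable M" for i using B_measurable grid_nonneg by simp
    let ?J = "\<lambda>\<omega>. \<Sum>i<2 ^ n. stopped n i \<omega> * (B (grid n (Suc i)) \<omega> - B (grid n i) \<omega>)"
    let ?A = "{\<omega> \<in> space M. \<epsilon> < \<bar>riemann_sum n \<omega> - diff_sol T \<omega>\<bar>}"
    \<comment> \<open>Young's inequality with weight \<open>\<epsilon>\<close>; the leading constant
      \<open>1 + \<epsilon>\<close> tends to 1, as the iteration of the integral inequality
      expects.\<close>
    have sq: "v\<^sup>2 \<le> (1 + \<epsilon>) * j\<^sup>2 + (\<epsilon> + \<epsilon>\<^sup>2)" if "\<bar>j - v\<bar> \<le> \<epsilon>" for v j :: real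
    proof -
      have a: "(v - j)\<^sup>2 \<le> \<epsilon>\<^sup>2" using that \<epsilon> by (simp add: abs_le_square_iff[symmetric] abs_minus_commute)
      have "v\<^sup>2 = j\<^sup>2 + 2 * (j * (v - j)) + (v - j)\<^sup>2" by (simp add: power2_eq_square algebra_simps)
      moreover have "2 * (j * (v - j)) \<le> \<epsilon> * j\<^sup>2 + \<epsilon>"
      proof -
        have "0 \<le> (\<epsilon> * j - (v - j))\<^sup>2" by simp
        then have "\<epsilon> * (2 * (j * (v - j))) \<le> \<epsilon>\<^sup>2 * j\<^sup>2 + (v - j)\<^sup>2" by (simp add: power2_eq_square algebra_simps)
        also have "\<dots> \<le> \<epsilon> * (\<epsilon> * j\<^sup>2 + \<epsilon>)" using a by (simp add: power2_eq_square algebra_simps)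
        finally show ?thesis using \<epsilon> by simp
      qed
      ultimately show ?thesis using a by (simp add: algebra_simps)
    qed
    have "diff_square T \<le> (\<integral>\<^sup>+\<omega>. ennreal (1 + \<epsilon>) * ennreal ((?J \<omega>)\<^sup>2) + ennreal (\<epsilon> + \<epsilon>\<^sup>2) + ennreal (K\<^sup>2) * indicator ?A \<omega> \<partial>M)"
      unfolding diff_square_def
    proof (rule nn_integral_mono)
      fix \<omega> assume \<omega>: "\<omega> \<in> space M"
      show "ennreal (if bounded_until T \<omega> then (diff_sol T \<omega>)\<^sup>2 else 0) \<le> ennreal (1 + \<epsilon>) * ennreal ((?J \<omega>)\<^sup>2) + ennreal (\<epsilon> + \<epsilon>\<^sup>2) + ennreal (K\<^sup>2) * indicator ?A \<omega>"
      proof (cases "bounded_until T \<omega>")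
        case True
        have gT: "grid n i \<le> T" if "i \<le> 2 ^ n" for i using grid_mono[OF that, of n] grid_last by simp
        have "\<bar>diff_sol T \<omega>\<bar> \<le> K" using True T by (auto simp: bounded_until_def)
        then have VK: "(diff_sol T \<omega>)\<^sup>2 \<le> K\<^sup>2" using K by (simp add: abs_le_square_iff[symmetric])
        have J: "?J \<omega> = riemann_sum n \<omega>"
          unfolding riemann_sum_def using True grid_nonneg gT by (intro sum.cong) (auto simp: stopped_eq bounded_until_def)
        show ?thesis
        proof (cases "\<epsilon> < \<bar>riemann_sum n \<omega> - diff_sol T \<omega>\<bar>")
          case True
          then show ?thesis using \<omega> VK by (auto intro!: add_increasing ennreal_leI)
        next
          case False
          then have "(diff_sol T \<omega>)\<^sup>2 \<le> (1 + \<epsilon>) * (?J \<omega>)\<^sup>2 + (\<epsilon> + \<epsilon>\<^sup>2)" using sq[of "riemann_sum n \<omega>" "diff_sol T \<omega>"] J by simp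
          then have "ennreal ((diff_sol T \<omega>)\<^sup>2) \<le> ennreal (1 + \<epsilon>) * ennreal ((?J \<omega>)\<^sup>2) + ennreal (\<epsilon> + \<epsilon>\<^sup>2)"
            using \<epsilon> by (simp flip: ennreal_mult' ennreal_plus add: ennreal_leI)
          then show ?thesis using \<open>bounded_until T \<omega>\<close> False by simp
        qed
      qed simp
    qed
    also have "\<dots> = ennreal (1 + \<epsilon>) * (\<integral>\<^sup>+\<omega>. ennreal ((?J \<omega>)\<^sup>2) \<partial>M) + ennreal (\<epsilon> + \<epsilon>\<^sup>2) + ennreal (K\<^sup>2) * emeasure M ?A"
      by (simp add: nn_integral_add nn_integral_cmult emeasure_space_1)
    also have "\<dots> \<le> ennreal (1 + \<epsilon>) * (\<Sum>i<2 ^ n. ennreal (mesh n) * stopped_square n i) + ennreal (\<epsilon> + \<epsilon>\<^sup>2) + ennreal (K\<^sup>2 * \<epsilon>)"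
      unfolding J_square using elim by (intro add_left_mono) (simp add: emeasure_eq_measure ennreal_mult'[symmetric] mult_left_mono ennreal_leI)
    finally show ?case using \<epsilon> by (simp add: add.assoc ennreal_plus)
  qed
  then show "\<exists>N. \<forall>n\<ge>N. diff_square T \<le> ennreal (1 + \<epsilon>) * (\<Sum>i<2 ^ n. ennreal (mesh n) * stopped_square n i) + ennreal (\<epsilon> + \<epsilon>\<^sup>2 + K\<^sup>2 * \<epsilon>)"
    by (simp add: eventually_sequentially)
qed

lemma diff_square_le_integral: "diff_square T \<le> (\<integral>\<^sup>+s. diff_square s * indicator {0..<T} s \<partial>lborel)"
proof (rule LIMSEQ_le_const)
  let ?e = "\<lambda>n. 1 / real (Suc n)"
  have e: "?e \<longlonglongrightarrow> 0" by (rule LIMSEQ_inverse_real_of_nat[unfolded inverse_eq_divide])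
  have "(\<lambda>n. ennreal (1 + ?e n) * (\<integral>\<^sup>+s. diff_square s * indicator {0..<T} s \<partial>lborel) + ennreal (?e n + (?e n)\<^sup>2 + K\<^sup>2 * ?e n))
    \<longlonglongrightarrow> ennreal (1 + 0) * (\<integral>\<^sup>+s. diff_square s * indicator {0..<T} s \<partial>lborel) + ennreal (0 + 0\<^sup>2 + K\<^sup>2 * 0)"
    by (intro tendsto_add tendsto_mult_ennreal tendsto_ennrealI tendsto_const e tendsto_power tendsto_mult) simp
  then show "(\<lambda>n. ennreal (1 + ?e n) * (\<integral>\<^sup>+s. diff_square s * indicator {0..<T} s \<partial>lborel) + ennreal (?e n + (?e n)\<^sup>2 + K\<^sup>2 * ?e n))
    \<longlonglongrightarrow> (\<integral>\<^sup>+s. diff_square s * indicator {0..<T} s \<partial>lborel)" by simp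
  show "\<exists>N. \<forall>n\<ge>N. diff_square T \<le> ennreal (1 + ?e n) * (\<integral>\<^sup>+s. diff_square s * indicator {0..<T} s \<partial>lborel) + ennreal (?e n + (?e n)\<^sup>2 + K\<^sup>2 * ?e n)"
    by (intro exI[of _ 0] allI impI diff_square_bound_eps) simp
qed

end

text \<open>The truncated second moment of the difference of two solutions satisfies Gronwall's inequality.\<close>

theorem P_eq_stoch_exp: assumes t: "0 \<le> t" shows "AE \<omega> in M. P t \<omega> = stoch_exp t \<omega>"
proof (cases "t = 0")
  case True
  then show ?thesis by (auto simp: P_0 stoch_exp_0)
next
  case False
  then have t: "0 < t" using t by simp
  have "AE \<omega> in M. bounded_until (real k) t \<omega> \<longrightarrow> diff_sol t \<omega> = 0" for k
  proof -
    have k: "0 \<le> real k" by simp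
    \<comment> \<open>At negative times \<open>bounded_until\<close> is vacuous and gives no bound,
      so the function is continued by 0 there.\<close>
    have "(if 0 \<le> t then diff_square (real k) t else 0) = 0"
    proof (rule integral_inequality_zero[OF _ _ _ t, where C = "(real k)\<^sup>2"])
      show "(if 0 \<le> s then diff_square (real k) s else 0) \<le> ennreal ((real k)\<^sup>2)" for s
        using diff_square_le[OF _ k, of 1 s] by simp
      fix s :: real assume s: "0 < s"
      have "diff_square (real k) s \<le> (\<integral>\<^sup>+u. diff_square (real k) u * indicator {0..<s} u \<partial>lborel)"
        by (rule diff_square_le_integral[OF s k])
      also have "\<dots> = (\<integral>\<^sup>+u. (if 0 \<le> u then diff_square (real k) u else 0) * indicator {0..<s} u \<partial>lborel)"
        by (rule nn_integral_cong) (auto simp: indicator_def)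
      finally show "(if 0 \<le> s then diff_square (real k) s else 0) \<le> (\<integral>\<^sup>+u. (if 0 \<le> u then diff_square (real k) u else 0) * indicator {0..<s} u \<partial>lborel)"
        using s by simp
    qed simp
    then have "(\<integral>\<^sup>+\<omega>. ennreal (if bounded_until (real k) t \<omega> then (diff_sol t \<omega>)\<^sup>2 else 0) \<partial>M) = 0"
      using t unfolding diff_square_def[OF t k] by simp
    then have "AE \<omega> in M. ennreal (if bounded_until (real k) t \<omega> then (diff_sol t \<omega>)\<^sup>2 else 0) = 0"
      using bounded_until_measurable[OF t k, of t] t by (subst (asm) nn_integral_0_iff_AE) auto
    then show ?thesis by eventually_elim (auto split: if_splits)
  qed
  then have "AE \<omega> in M. \<forall>k. bounded_until (real k) t \<omega> \<longrightarrow> diff_sol t \<omega> = 0"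
    by (subst AE_all_countable) blast
  then show ?thesis
  proof (rule AE_mp, intro AE_I2 impI)
    fix \<omega> assume \<omega>: "\<omega> \<in> space M" and h: "\<forall>k. bounded_until (real k) t \<omega> \<longrightarrow> diff_sol t \<omega> = 0"
    have "compact ((\<lambda>u. diff_sol u \<omega>) ` {0..t})"
      by (intro compact_continuous_image continuous_on_subset[OF diff_sol_cont[OF \<omega>]]) auto
    then obtain b where b: "\<And>u. u \<in> {0..t} \<Longrightarrow> \<bar>diff_sol u \<omega>\<bar> \<le> b"
      using compact_imp_bounded bounded_iff by (metis imageI real_norm_def)
    obtain k where "b \<le> real k" using real_arch_simple by blast
    then have "bounded_until (real k) t \<omega>" using b unfolding bounded_until_def[OF t of_nat_0_le_iff] by fastforce
    then have "diff_sol t \<omega> = 0" using h by blast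
    then show "P t \<omega> = stoch_exp t \<omega>" by (simp add: diff_sol_def)
  qed
qed

end

section \<open>Martingales on path space\<close>

text \<open>The continuous paths are not a measurable set of the product space; the sample space
  carries the trace sigma-algebra instead.\<close>

lemma martingale_on_path_space:
  fixes Q :: "'b measure" and X :: "real \<Rightarrow> 'b \<Rightarrow> real"
  assumes Q: "prob_space Q"
    and X[measurable]: "\<And>t. 0 \<le> t \<Longrightarrow> X t \<in> borel_measurable Q"
    and S[measurable]: "S \<in> sets Q" and AE_S: "AE \<omega> in Q. \<omega> \<in> S"
    and cont: "\<And>\<omega>. \<omega> \<in> S \<Longrightarrow> continuous_on {0..} (\<lambda>t. X t \<omega>)"
    and nonneg: "\<And>t \<omega>. 0 \<le> t \<Longrightarrow> \<omega> \<in> S \<Longrightarrow> 0 \<le> X t \<omega>"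
    and fin: "\<And>t. 0 \<le> t \<Longrightarrow> (\<integral>\<^sup>+\<omega>. ennreal (X t \<omega>) \<partial>Q) < \<infinity>"
    and mart: "\<And>s t A. 0 \<le> s \<Longrightarrow> s \<le> t \<Longrightarrow> A \<in> sets (PiM {0..s} (\<lambda>_. borel)) \<Longrightarrow>
      (\<integral>\<^sup>+\<omega>. indicator A (restrict (\<lambda>u. X u \<omega>) {0..s}) * ennreal (X t \<omega>) \<partial>Q)
      = (\<integral>\<^sup>+\<omega>. indicator A (restrict (\<lambda>u. X u \<omega>) {0..s}) * ennreal (X s \<omega>) \<partial>Q)"
  shows "\<exists>(M' :: (real \<Rightarrow> real) measure) F' P'. martingale M' F' P'
    \<and> (\<forall>\<omega>\<in>space M'. continuous_on {0..} (\<lambda>t. P' t \<omega>))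
    \<and> (\<forall>t\<ge>0. distr M' borel (P' t) = distr Q borel (X t))
    \<and> process_law M' P' = process_law Q X"
proof -
  interpret Q: prob_space Q by fact
  define C where "C = {f :: real \<Rightarrow> real. continuous_on {0..} f}"
  define Pi where "Pi = (\<lambda>J. PiM J (\<lambda>_. borel) :: (real \<Rightarrow> real) measure)"
  define K where "K = restrict_space (Pi UNIV) C"
  \<comment> \<open>The value 0 off \<open>S\<close> makes every path continuous on
    \<open>{0..}\<close>, so the image lies in \<open>C\<close> without exception.\<close>
  define path where "path \<omega> = (\<lambda>t. if \<omega> \<in> S \<and> 0 \<le> t then X t \<omega> else 0)" for \<omega>
  define M' where "M' = distr Q K path"
  \<comment> \<open>Events of the path up to time \<open>s\<close>; \<open>max\<close> keeps the
    filtration constant at negative times.\<close>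
  define F' where "F' s = vimage_algebra C (\<lambda>f. restrict f {0..max 0 s}) (Pi {0..max 0 s})" for s
  define P' where "P' = (\<lambda>(t :: real) f. f t :: real)"
  have spPi: "space (Pi J) = extensional J" for J
    by (auto simp: Pi_def space_PiM PiE_def)
  have spK: "space K = C" by (auto simp: K_def space_restrict_space spPi)
  have spM: "space M' = C" by (simp add: M'_def spK)
  have setsM: "sets M' = sets K" by (simp add: M'_def)
  have path_C: "path \<omega> \<in> C" for \<omega>
  proof (cases "\<omega> \<in> S")
    case True
    then have "continuous_on {0..} (path \<omega>) \<longleftrightarrow> continuous_on {0..} (\<lambda>t. X t \<omega>)"
      by (intro continuous_on_cong) (auto simp: path_def)
    then show ?thesis using cont[OF True] by (simp add: C_def)
  qed (simp add: path_def C_def)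
  have path_m[measurable]: "path \<in> measurable Q K"
    unfolding K_def
  proof (rule measurable_restrict_space2)
    show "path \<in> space Q \<rightarrow> C" using path_C by auto
    show "path \<in> measurable Q (Pi UNIV)"
      unfolding Pi_def
    proof (rule measurable_PiM_single')
      fix t :: real
      show "(\<lambda>\<omega>. path \<omega> t) \<in> borel_measurable Q"
        by (cases "0 \<le> t") (simp_all add: path_def)
    qed auto
  qed
  have restr_K: "(\<lambda>f. restrict f J) \<in> measurable K (Pi J)" for J
    unfolding K_def Pi_def by (intro measurable_restrict_space1 measurable_restrict_subset) auto
  have coord_K[measurable]: "(\<lambda>f. f t) \<in> borel_measurable K" for t
    unfolding K_def Pi_def by (intro measurable_restrict_space1 measurable_component_singleton) auto
  have prob: "prob_space M'" unfolding M'_def by (rule Q.prob_space_distr) measurable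
  interpret M': prob_space M' by (rule prob)
  have sets_F': "sets (F' s) = {(\<lambda>f. restrict f {0..max 0 s}) -` A \<inter> C | A. A \<in> sets (Pi {0..max 0 s})}" for s
    unfolding F'_def by (rule sets_vimage_algebra2) (auto simp: spPi)
  have filt: "filtration_on M' F'"
    unfolding filtration_on_def filtration_def subalgebra_def
  proof (intro conjI allI impI)
    show "space (F' i) = space M'" for i by (simp add: F'_def spM)
    show "space (F' i) = space M'" for i by (simp add: F'_def spM)
    show "sets (F' t) \<subseteq> sets M'" for t
      unfolding setsM sets_F' using measurable_sets[OF restr_K[of "{0..max 0 t}"]] by (auto simp: spK)
    show "sets (F' s) \<subseteq> sets (F' t)" if "s \<le> t" for s t
    proof
      fix A' assume "A' \<in> sets (F' s)"
      then obtain A where A: "A \<in> sets (Pi {0..max 0 s})" "A' = (\<lambda>f. restrict f {0..max 0 s}) -` A \<inter> C"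
        unfolding sets_F' by auto
      let ?A = "(\<lambda>f. restrict f {0..max 0 s}) -` A \<inter> space (Pi {0..max 0 t})"
      have "(\<lambda>f. restrict f {0..max 0 s}) \<in> measurable (Pi {0..max 0 t}) (Pi {0..max 0 s})"
        unfolding Pi_def using that by (intro measurable_restrict_subset) auto
      then have "?A \<in> sets (Pi {0..max 0 t})" using A(1) by (rule measurable_sets)
      moreover have "A' = (\<lambda>f. restrict f {0..max 0 t}) -` ?A \<inter> C"
      proof -
        have "restrict (restrict f {0..max 0 t}) {0..max 0 s} = restrict f {0..max 0 s}" for f :: "real \<Rightarrow> real"
          using that by (auto simp: restrict_def fun_eq_iff)
        then show ?thesis unfolding A by (auto simp: spPi)
      qed
      ultimately show "A' \<in> sets (F' t)" unfolding sets_F' by blast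
    qed
  qed
  have adapt: "adapted F' P'"
    unfolding adapted_def
  proof (intro allI impI)
    fix t :: real assume t: "0 \<le> t"
    have "(\<lambda>f. restrict f {0..t}) \<in> measurable (F' t) (Pi {0..t})"
      unfolding F'_def using t by (simp add: max_def) (rule measurable_vimage_algebra1, auto simp: spPi)
    then have "(\<lambda>f. (restrict f {0..t}) t) \<in> borel_measurable (F' t)"
      by (rule measurable_compose) (use t in \<open>auto simp: Pi_def intro!: measurable_component_singleton\<close>)
    then show "P' t \<in> borel_measurable (F' t)" using t by (simp add: P'_def)
  qed
  have nn: "(\<integral>\<^sup>+f. g f \<partial>M') = (\<integral>\<^sup>+\<omega>. g (path \<omega>) \<partial>Q)" if "g \<in> borel_measurable K" for g
    unfolding M'_def using that by (subst nn_integral_distr) auto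
  have pos: "AE f in M'. 0 \<le> P' t f" for t
    unfolding M'_def by (subst AE_distr_iff) (auto simp: P'_def path_def nonneg)
  have int: "integrable M' (P' t)" if t: "0 \<le> t" for t
  proof (rule integrableI_nonneg)
    show "P' t \<in> borel_measurable M'" unfolding P'_def M'_def by simp
    show "AE f in M'. 0 \<le> P' t f" by (rule pos)
    have "(\<integral>\<^sup>+f. ennreal (P' t f) \<partial>M') = (\<integral>\<^sup>+\<omega>. ennreal (P' t (path \<omega>)) \<partial>Q)"
      by (rule nn) (simp add: P'_def)
    also have "\<dots> = (\<integral>\<^sup>+\<omega>. ennreal (X t \<omega>) \<partial>Q)"
      by (rule nn_integral_cong_AE) (use AE_S t in \<open>auto simp: P'_def path_def elim!: eventually_mono\<close>)
    also have "\<dots> < \<infinity>" by (rule fin[OF t])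
    finally show "(\<integral>\<^sup>+f. ennreal (P' t f) \<partial>M') < \<infinity>" .
  qed
  \<comment> \<open>Integrals over events of the past are pulled back to \<open>Q\<close>, where
    they are finite nonnegative integrals of the kind occurring in \<open>mart\<close>.\<close>
  have set_int: "set_lebesgue_integral M' A' (P' t) = enn2real (\<integral>\<^sup>+\<omega>. indicator A (restrict (\<lambda>u. X u \<omega>) {0..s}) * ennreal (X t \<omega>) \<partial>Q)"
    if s: "0 \<le> s" "s \<le> t" and A: "A \<in> sets (Pi {0..s})" "A' = (\<lambda>f. restrict f {0..s}) -` A \<inter> C" for s t A A'
  proof -
    have A'[measurable]: "A' \<in> sets K"
      using measurable_sets[OF restr_K A(1)] unfolding A(2) spK .
    have "set_lebesgue_integral M' A' (P' t) = (\<integral>f. indicator A' f * P' t f \<partial>M')"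
      by (simp add: set_lebesgue_integral_def)
    also have "\<dots> = enn2real (\<integral>\<^sup>+f. ennreal (indicator A' f * P' t f) \<partial>M')"
    proof (rule integral_eq_nn_integral)
      show "(\<lambda>f. indicator A' f * P' t f) \<in> borel_measurable M'" unfolding P'_def M'_def by simp
      show "AE f in M'. 0 \<le> indicator A' f * P' t f" using pos[of t] by eventually_elim simp
    qed
    also have "(\<integral>\<^sup>+f. ennreal (indicator A' f * P' t f) \<partial>M') = (\<integral>\<^sup>+\<omega>. ennreal (indicator A' (path \<omega>) * P' t (path \<omega>)) \<partial>Q)"
      by (rule nn) (simp add: P'_def)
    also have "\<dots> = (\<integral>\<^sup>+\<omega>. indicator A (restrict (\<lambda>u. X u \<omega>) {0..s}) * ennreal (X t \<omega>) \<partial>Q)"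
    proof (rule nn_integral_cong_AE, use AE_S in eventually_elim)
      case (elim \<omega>)
      have "restrict (path \<omega>) {0..s} = restrict (\<lambda>u. X u \<omega>) {0..s}"
        using elim by (auto simp: path_def restrict_def fun_eq_iff)
      then have "path \<omega> \<in> A' \<longleftrightarrow> restrict (\<lambda>u. X u \<omega>) {0..s} \<in> A" using path_C by (simp add: A(2))
      moreover have "P' t (path \<omega>) = X t \<omega>" using elim s by (simp add: P'_def path_def)
      ultimately show ?case by (auto simp: indicator_def)
    qed
    finally show ?thesis .
  qed
  have cexp: "AE f in M'. real_cond_exp M' (F' s) (P' t) f = P' s f" if s: "0 \<le> s" "s \<le> t" for s t
  proof -
    have sub: "subalgebra M' (F' s)" using filt by (simp add: filtration_on_def)
    interpret finite_measure_subalgebra M' "F' s"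
      by unfold_locales (rule sub)
    show ?thesis
    proof (rule real_cond_exp_charact)
      fix A' assume "A' \<in> sets (F' s)"
      then obtain A where A: "A \<in> sets (Pi {0..s})" "A' = (\<lambda>f. restrict f {0..s}) -` A \<inter> C"
        using s unfolding sets_F' by (auto simp: max_def)
      show "set_lebesgue_integral M' A' (P' t) = set_lebesgue_integral M' A' (P' s)"
        unfolding set_int[OF s A] set_int[OF s(1) order_refl A]
        using mart[OF s, of A] A(1) by (simp add: Pi_def)
    qed (use s int adapt in \<open>auto simp: adapted_def\<close>)
  qed
  have "martingale M' F' P'"
    unfolding martingale_def using prob filt adapt int cexp by blast
  moreover have "\<forall>\<omega>\<in>space M'. continuous_on {0..} (\<lambda>t. P' t \<omega>)"
    unfolding spM by (simp add: P'_def C_def)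
  moreover have "\<forall>t\<ge>0. distr M' borel (P' t) = distr Q borel (X t)"
  proof (intro allI impI)
    fix t :: real assume t: "0 \<le> t"
    have "distr M' borel (P' t) = distr Q borel (\<lambda>\<omega>. path \<omega> t)"
      unfolding M'_def P'_def by (subst distr_distr) (auto simp: comp_def)
    also have "\<dots> = distr Q borel (X t)"
      by (rule distr_cong_AE) (use AE_S t in \<open>auto simp: path_def elim!: eventually_mono\<close>)
    finally show "distr M' borel (P' t) = distr Q borel (X t)" .
  qed
  moreover have "process_law M' P' = process_law Q X"
  proof -
    have "process_law M' P' = distr Q (Pi {0..}) (\<lambda>\<omega>. restrict (path \<omega>) {0..})"
      unfolding process_law_def M'_def P'_def
      by (subst distr_distr[OF restr_K[unfolded Pi_def] path_m]) (simp add: comp_def Pi_def)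
    also have "\<dots> = process_law Q X"
      unfolding process_law_def
    proof (rule distr_cong_AE)
      show "AE \<omega> in Q. restrict (path \<omega>) {0..} = restrict (\<lambda>t. X t \<omega>) {0..}"
        using AE_S by eventually_elim (auto simp: path_def restrict_def fun_eq_iff)
      show "(\<lambda>\<omega>. restrict (path \<omega>) {0..}) \<in> measurable Q (Pi {0..})"
        by (rule measurable_compose[OF path_m restr_K])
      show "(\<lambda>\<omega>. restrict (\<lambda>t. X t \<omega>) {0..}) \<in> measurable Q (PiM {0..} (\<lambda>_. borel))"
        by (rule measurable_restrict) auto
    qed (auto simp: Pi_def)
    finally show ?thesis .
  qed
  ultimately show ?thesis by blast
qed

section \<open>Construction of the process\<close>

text \<open>The mixture density at the point \<open>tanh u\<close>: every interval that reaches
  beyond this point contributes the inverse of its length. At \<open>t = 1/2\<close> this provides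
  the normalization of \<open>weight\<close>.\<close>

lemma nn_integral_cond_density:
  assumes t: "0 < t" "t \<le> 1"
  shows "(\<integral>\<^sup>+h. ennreal (1 / (2 * tanh (radius_quantile t h))) * indicator {\<bar>u\<bar><..} (radius_quantile t h) \<partial>U01) = ennreal (tanh_density t \<bar>u\<bar>)"
proof -
  have "(\<integral>\<^sup>+h. ennreal (1 / (2 * tanh (radius_quantile t h))) * indicator {\<bar>u\<bar><..} (radius_quantile t h) \<partial>U01)
    = (\<integral>\<^sup>+s. ennreal (1 / (2 * tanh s)) * indicator {\<bar>u\<bar><..} s \<partial>distr U01 borel (radius_quantile t))"
    using radius_quantile_measurable[OF t] by (subst nn_integral_distr) (auto intro: measurable_restrict_space1)
  also have "\<dots> = (\<integral>\<^sup>+s. ennreal (radius_density t s) * indicator {0<..} s * (ennreal (1 / (2 * tanh s)) * indicator {\<bar>u\<bar><..} s) \<partial>lborel)"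
    unfolding distr_radius_quantile[OF t] radius_law_def by (subst nn_integral_density) auto
  also have "\<dots> = (\<integral>\<^sup>+s. ennreal (tanh_density_slope t s) * indicator {\<bar>u\<bar>..} s \<partial>lborel)"
  proof (rule nn_integral_cong_AE)
    have "AE s in lborel. s \<noteq> \<bar>u\<bar>" by (rule AE_lborel_singleton)
    then show "AE s in lborel. ennreal (radius_density t s) * indicator {0<..} s * (ennreal (1 / (2 * tanh s)) * indicator {\<bar>u\<bar><..} s)
      = ennreal (tanh_density_slope t s) * indicator {\<bar>u\<bar>..} s"
    proof eventually_elim
      case (elim s)
      show ?case
      proof (cases "\<bar>u\<bar> < s")
        case True
        then have "0 < s" by linarith
        then have "ennreal (radius_density t s) * ennreal (1 / (2 * tanh s)) = ennreal (tanh_density_slope t s)"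
          using tanh_density_slope_nonneg[OF t, of s] by (subst ennreal_mult[symmetric]) (auto simp: radius_density_def)
        then show ?thesis using True \<open>0 < s\<close> by simp
      next
        case False
        then show ?thesis using elim by (simp add: indicator_def)
      qed
    qed
  qed
  finally show ?thesis using nn_integral_tanh_density_slope[OF t, of "\<bar>u\<bar>"] by simp
qed

section \<open>The rotation clock\<close>

definition rot_time :: "real \<Rightarrow> real \<Rightarrow> real" where
  "rot_time t h = 2 * ln (tanh (radius_quantile t h) / tanh (radius_quantile (1/2) h))"

lemma radius_quantile_pos': "0 < t \<Longrightarrow> t \<le> 1 \<Longrightarrow> 0 < radius_quantile t h"
  using radius_quantile_pos[of t h] by (cases "h \<in> {0<..<1}") (auto simp: radius_quantile_def)

lemma radius_quantile_mono_time: "0 < s \<Longrightarrow> s \<le> t \<Longrightarrow> t \<le> 1 \<Longrightarrow> radius_quantile s h \<le> radius_quantile t h"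
  using radius_quantile_strict_mono_time[of s t h] by (cases "s = t"; cases "h \<in> {0<..<1}") (auto simp: radius_quantile_def)

lemma exp_rot_time: "1/2 \<le> t \<Longrightarrow> t \<le> 1 \<Longrightarrow> exp (rot_time t h / 2) = tanh (radius_quantile t h) / tanh (radius_quantile (1/2) h)"
  using radius_quantile_pos'[of t h] radius_quantile_pos'[of "1/2" h] by (simp add: rot_time_def)

lemma rot_time_half[simp]: "rot_time (1/2) h = 0"
  using radius_quantile_pos'[of "1/2" h] by (simp add: rot_time_def)

lemma rot_time_mono: assumes "1/2 \<le> s" "s \<le> t" "t \<le> 1" shows "rot_time s h \<le> rot_time t h"
proof -
  have "tanh (radius_quantile s h) / tanh (radius_quantile (1/2) h) \<le> tanh (radius_quantile t h) / tanh (radius_quantile (1/2) h)"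
    using radius_quantile_mono_time[of s t h] radius_quantile_pos'[of "1/2" h] assms by (intro divide_right_mono) auto
  moreover have "0 < tanh (radius_quantile s h) / tanh (radius_quantile (1/2) h)"
    using radius_quantile_pos'[of "1/2" h] radius_quantile_pos'[of s h] assms by simp
  ultimately show ?thesis by (simp add: rot_time_def)
qed

lemma rot_time_nonneg: "1/2 \<le> t \<Longrightarrow> t \<le> 1 \<Longrightarrow> 0 \<le> rot_time t h"
  using rot_time_mono[of "1/2" t h] by simp

text \<open>Strict growth of the radius makes the angle at time 1 nondegenerate; the difference of
  the process laws rests on this.\<close>

lemma rot_time_pos: assumes "0 < h" "h < 1" shows "0 < rot_time 1 h"
proof -
  have "tanh (radius_quantile (1/2) h) < tanh (radius_quantile 1 h)" using radius_quantile_strict_mono_time[of "1/2" 1 h] assms by simp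
  then show ?thesis using radius_quantile_pos'[of "1/2" h] by (simp add: rot_time_def)
qed

lemma rot_time_measurable[measurable]: "1/2 \<le> t \<Longrightarrow> t \<le> 1 \<Longrightarrow> rot_time t \<in> borel_measurable borel"
  using radius_quantile_measurable[of t] radius_quantile_measurable[of "1/2"] unfolding rot_time_def by simp

lemma radius_quantile_continuous_half:
  assumes "0 < h" "h < 1" shows "continuous_on {1/2..1} (\<lambda>t. radius_quantile t h)"
  by (rule continuous_on_subset[OF radius_quantile_continuous[OF assms]]) auto

lemma rot_time_continuous:
  assumes "0 < h" "h < 1" shows "continuous_on {1/2..1} (\<lambda>t. rot_time t h)"
proof -
  have "tanh (radius_quantile t h) / tanh (radius_quantile (1/2) h) \<noteq> 0" if "t \<in> {1/2..1}" for t
    using that radius_quantile_pos'[of t h] radius_quantile_pos'[of "1/2" h] by auto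
  then show ?thesis
    unfolding rot_time_def using radius_quantile_pos'[of "1/2" h]
    by (intro continuous_intros radius_quantile_continuous_half assms) auto
qed

section \<open>Sample space and building blocks of the process\<close>

context continuous_bm
begin

text \<open>Dyadic times approaching \<open>s\<close> from below reduce each level to countably many
  coordinates, and continuity of the paths gives the limit. The result lets the second path be read
  at \<open>rot_time t h\<close>, which depends on the sample point.\<close>

lemma B_joint: "(\<lambda>(s, \<omega>). B (max 0 s) \<omega>) \<in> borel_measurable (borel \<Otimes>\<^sub>M M)"
proof (rule borel_measurable_LIMSEQ_real)
  let ?k = "\<lambda>n (s::real, \<omega>::'a). nat \<lfloor>2 ^ n * max 0 s\<rfloor>"
  let ?f = "\<lambda>n p. B (real (?k n p) / 2 ^ n) (snd p)"
  show "?f n \<in> borel_measurable (borel \<Otimes>\<^sub>M M)" for n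
  proof (rule measurable_compose_countable[where f = "\<lambda>i p. B (real i / 2 ^ n) (snd p)"])
    show "(\<lambda>p. B (real i / 2 ^ n) (snd p)) \<in> borel_measurable (borel \<Otimes>\<^sub>M M)" for i
      using B_measurable[of "real i / 2 ^ n"] by measurable
    show "?k n \<in> measurable (borel \<Otimes>\<^sub>M M) (count_space UNIV)" by measurable
  qed
  fix p :: "real \<times> 'a" assume p: "p \<in> space (borel \<Otimes>\<^sub>M M)"
  obtain s \<omega> where p': "p = (s, \<omega>)" by (cases p)
  have \<omega>: "\<omega> \<in> space M" using p by (simp add: p' space_pair_measure)
  define r where "r = max 0 s"
  have r: "0 \<le> r" by (simp add: r_def)
  have "(\<lambda>n. real (nat \<lfloor>2 ^ n * r\<rfloor>) / 2 ^ n) \<longlonglongrightarrow> r"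
  proof (rule tendsto_sandwich)
    show "(\<lambda>n. r - (1/2) ^ n) \<longlonglongrightarrow> r"
      using tendsto_diff[OF tendsto_const LIMSEQ_realpow_zero[of "1/2"], of r] by simp
    have b: "r - (1/2) ^ n \<le> real (nat \<lfloor>2 ^ n * r\<rfloor>) / 2 ^ n \<and> real (nat \<lfloor>2 ^ n * r\<rfloor>) / 2 ^ n \<le> r" for n
    proof -
      have "real (nat \<lfloor>2 ^ n * r\<rfloor>) = of_int \<lfloor>2 ^ n * r\<rfloor>" using r by simp
      moreover have "of_int \<lfloor>2 ^ n * r\<rfloor> \<le> 2 ^ n * r" "2 ^ n * r - 1 \<le> of_int \<lfloor>2 ^ n * r\<rfloor>" by linarith+
      moreover have "r - (1/2) ^ n = (2 ^ n * r - 1) / 2 ^ n" "r = 2 ^ n * r / 2 ^ n"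
        by (simp_all add: field_simps power_divide)
      ultimately show ?thesis by (metis divide_right_mono zero_le_numeral zero_le_power)
    qed
    show "eventually (\<lambda>n. r - (1/2) ^ n \<le> real (nat \<lfloor>2 ^ n * r\<rfloor>) / 2 ^ n) sequentially"
      "eventually (\<lambda>n. real (nat \<lfloor>2 ^ n * r\<rfloor>) / 2 ^ n \<le> r) sequentially"
      using b by auto
  qed auto
  then have "(\<lambda>n. B (real (nat \<lfloor>2 ^ n * r\<rfloor>) / 2 ^ n) \<omega>) \<longlonglongrightarrow> B r \<omega>"
    by (intro continuous_on_tendsto_compose[OF B_cont[OF \<omega>]]) (use r in auto)
  then show "(\<lambda>n. ?f n p) \<longlonglongrightarrow> (case p of (s, \<omega>) \<Rightarrow> B (max 0 s) \<omega>)"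
    by (simp add: p' r_def)
qed

lemma B_time_measurable:
  assumes "f \<in> borel_measurable N" "g \<in> measurable N M" "\<And>x. x \<in> space N \<Longrightarrow> 0 \<le> f x"
  shows "(\<lambda>x. B (f x) (g x)) \<in> borel_measurable N"
proof -
  have "(\<lambda>x. (\<lambda>(s, \<omega>). B (max 0 s) \<omega>) (f x, g x)) \<in> borel_measurable N"
    by (rule measurable_compose[OF _ B_joint]) (use assms in measurable)
  moreover have "(\<lambda>(s, \<omega>). B (max 0 s) \<omega>) (f x, g x) = B (f x) (g x)" if "x \<in> space N" for x
    using assms(3)[OF that] by simp
  ultimately show ?thesis by (subst measurable_cong[of _ _ "\<lambda>x. (\<lambda>(s, \<omega>). B (max 0 s) \<omega>) (f x, g x)"]) auto
qed

text \<open>Half of \<open>ln (stoch_exp (1/2) \<omega>)\<close>, so that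
  \<open>tanh (start \<omega>)\<close> is the value of \<open>Z\<close> at time 1/2.\<close>

definition start :: "'a \<Rightarrow> real" where "start \<omega> = (B (1/2) \<omega> - 1/4) / 2"

text \<open>Odd under the exchange of the increments of \<open>B\<close> over \<open>[0, 1/4]\<close> and \<open>[1/4, 1/2]\<close>, which leaves
  \<open>start\<close> unchanged.\<close>

definition swap_sign :: "'a \<Rightarrow> real" where
  "swap_sign \<omega> = indicator {0<..} (B (1/4) \<omega>) - indicator {0<..} (B (1/2) \<omega> - B (1/4) \<omega>)"

text \<open>First coordinate of the sphere point at time 1/2. The support of \<open>weight\<close>
  keeps it inside \<open>(-1, 1)\<close>.\<close>

definition start_ratio :: "'a \<Rightarrow> real \<Rightarrow> real" where "start_ratio \<omega> h = tanh (start \<omega>) / tanh (radius_quantile (1/2) h)"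

text \<open>The parameters are left unevaluated to match
  \<open>normal_density_eq_killed_kernel\<close> at \<open>t = 1/2\<close>.\<close>

definition start_density :: "real \<Rightarrow> real" where "start_density = normal_density (- (1/2) / 4) (sqrt (1/2) / 2)"

text \<open>Sample points are triples: a Brownian path driving the process outside \<open>[1/2, 1]\<close>, the pair of the
  quantile \<open>h\<close> of the radius and the angle \<open>v\<close>, and a second Brownian path driving the rotation.\<close>

definition rot_tanh :: "real \<Rightarrow> 'a \<times> (real \<times> real) \<times> 'a \<Rightarrow> real" where
  "rot_tanh t = (\<lambda>(\<omega>, (h, v), \<omega>'). tanh (radius_quantile t h) * rot (B (rot_time t h) \<omega>') (start_ratio \<omega> h) v)"

definition fake :: "real \<Rightarrow> 'a \<times> (real \<times> real) \<times> 'a \<Rightarrow> real" where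
  "fake t p = (if t \<le> 1/2 then stoch_exp t (fst p)
     else if t \<le> 1 then (1 + rot_tanh t p) / (1 - rot_tanh t p)
     else (1 + rot_tanh 1 p) / (1 - rot_tanh 1 p) * (stoch_exp t (fst p) / stoch_exp 1 (fst p)))"

text \<open>Conditional density of \<open>(h, v)\<close> given the first path, relative to the uniform law. The first factor
  correlates the angle with the sign; the second one expresses that, given \<open>h\<close>, the point \<open>tanh (start \<omega>)\<close>
  is uniform on an interval of radius \<open>tanh (radius_quantile (1/2) h)\<close>, up to the factor \<open>1 - Z\<close>.\<close>

definition weight :: "'a \<Rightarrow> real \<times> real \<Rightarrow> real" where
  "weight \<omega> = (\<lambda>(h, v). (1 + swap_sign \<omega> * cos (2 * pi * v)) *
     (indicator {\<bar>start \<omega>\<bar><..} (radius_quantile (1/2) h) / (2 * tanh (radius_quantile (1/2) h) * (cosh (start \<omega>))\<^sup>2 * start_density (start \<omega>))))"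

definition base :: "('a \<times> (real \<times> real) \<times> 'a) measure" where
  "base = M \<Otimes>\<^sub>M ((U01 \<Otimes>\<^sub>M U01) \<Otimes>\<^sub>M M)"

text \<open>The factor \<open>1 - rot_tanh 1 p\<close> undoes the change of measure under which \<open>rot_tanh\<close> is a martingale.\<close>

definition fake_measure :: "('a \<times> (real \<times> real) \<times> 'a) measure" where
  "fake_measure = density base (\<lambda>p. ennreal (weight (fst p) (fst (snd p)) * (1 - rot_tanh 1 p)))"

lemma start_density_pos: "0 < start_density u" by (simp add: start_density_def normal_density_pos)

lemma swap_sign_bound: "\<bar>swap_sign \<omega>\<bar> \<le> 1" by (auto simp: swap_sign_def indicator_def)

lemma one_plus_swap_sign: "0 \<le> 1 + swap_sign \<omega> * cos x"
proof -
  have "\<bar>swap_sign \<omega> * cos x\<bar> \<le> 1 * 1" unfolding abs_mult by (intro mult_mono swap_sign_bound) auto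
  then show ?thesis by linarith
qed

lemma weight_nonneg: "0 \<le> weight \<omega> \<theta>"
  using radius_quantile_pos'[of "1/2" "fst \<theta>"] start_density_pos[of "start \<omega>"] one_plus_swap_sign
  by (auto simp: weight_def split_beta intro!: mult_nonneg_nonneg divide_nonneg_nonneg less_imp_le)

lemma weight_nonzeroD: "weight \<omega> (h, v) \<noteq> 0 \<Longrightarrow> \<bar>start \<omega>\<bar> < radius_quantile (1/2) h"
  by (auto simp: weight_def indicator_def split: if_splits)

lemma start_measurable: "1/2 \<le> t \<Longrightarrow> start \<in> borel_measurable (F t)"
  unfolding start_def using B_measurable_F[of "1/2" t] by simp

lemma swap_sign_measurable: "1/2 \<le> t \<Longrightarrow> swap_sign \<in> borel_measurable (F t)"
  unfolding swap_sign_def using B_measurable_F[of "1/2" t] B_measurable_F[of "1/4" t] by simp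

lemma start_measurable_M[measurable]: "start \<in> borel_measurable M"
  using start_measurable[of "1/2"] measurable_from_F by blast

lemma swap_sign_measurable_M[measurable]: "swap_sign \<in> borel_measurable M"
  using swap_sign_measurable[of "1/2"] measurable_from_F by blast

lemma id_U01: "(\<lambda>x. x) \<in> measurable U01 borel"
  by (rule measurable_restrict_space1) simp

lemma start_density_measurable[measurable]: "start_density \<in> borel_measurable borel"
  by (simp add: start_density_def)

lemma start_ratio_abs:
  assumes "\<bar>start \<omega>\<bar> < radius_quantile (1/2) h" shows "\<bar>start_ratio \<omega> h\<bar> < 1"
proof -
  have "tanh (start \<omega>) < tanh (radius_quantile (1/2) h)" "tanh (- start \<omega>) < tanh (radius_quantile (1/2) h)"
    using assms by (auto simp only: tanh_real_less_iff)
  then show ?thesis using radius_quantile_pos'[of "1/2" h] by (simp add: start_ratio_def abs_less_iff divide_simps)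
qed

lemma rot_tanh_abs:
  assumes "\<bar>start \<omega>\<bar> < radius_quantile (1/2) h" "0 < t" "t \<le> 1"
  shows "\<bar>rot_tanh t (\<omega>, (h, v), \<omega>')\<bar> < 1"
proof -
  have "\<bar>rot_tanh t (\<omega>, (h, v), \<omega>')\<bar> \<le> \<bar>tanh (radius_quantile t h)\<bar> * 1"
    unfolding rot_tanh_def prod.case abs_mult using start_ratio_abs[OF assms(1)] by (intro mult_left_mono rot_bounded) auto
  also have "\<dots> < 1" using tanh_real_bounds[of "radius_quantile t h"] by (auto simp: abs_less_iff)
  finally show ?thesis .
qed

text \<open>The clock is set so that \<open>exp (rot_time t h / 2)\<close> is the ratio of the radii
  at \<open>t\<close> and at 1/2. The moving radius thus becomes the exponential factor that
  \<open>trig_martingale\<close> asks for.\<close>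

lemma rot_tanh_trig:
  assumes "1/2 \<le> t" "t \<le> 1"
  shows "rot_tanh t (\<omega>, (h, v), \<omega>') = exp (rot_time t h / 2) * (tanh (start \<omega>) * cos (B (rot_time t h) \<omega>')
     + tanh (radius_quantile (1/2) h) * sqrt (1 - (start_ratio \<omega> h)\<^sup>2) * cos (pi * v) * sin (B (rot_time t h) \<omega>'))"
  using radius_quantile_pos'[of "1/2" h] unfolding exp_rot_time[OF assms]
  by (simp add: rot_tanh_def rot_def start_ratio_def field_simps)

lemma rot_tanh_half:
  assumes "\<omega>' \<in> space M" shows "rot_tanh (1/2) (\<omega>, (h, v), \<omega>') = tanh (start \<omega>)"
  by (subst rot_tanh_trig) (simp_all add: B_0[OF assms])

lemma stoch_exp_half: "stoch_exp (1/2) \<omega> = (1 + tanh (start \<omega>)) / (1 - tanh (start \<omega>))"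
proof -
  have e: "stoch_exp (1/2) \<omega> = exp (start \<omega>) / exp (- start \<omega>)"
    by (simp add: stoch_exp_def start_def exp_diff[symmetric] field_simps)
  have "exp (start \<omega>) = (1 + tanh (start \<omega>)) * cosh (start \<omega>)" "exp (- start \<omega>) = (1 - tanh (start \<omega>)) * cosh (start \<omega>)"
    using cosh_real_pos[of "start \<omega>"]
    by (simp_all add: tanh_def algebra_simps cosh_plus_sinh cosh_minus_sinh)
  then show ?thesis unfolding e using cosh_real_pos[of "start \<omega>"] by simp
qed

text \<open>At the joint \<open>t = 1/2\<close> the angle is still 0, so the rotated value is
  \<open>tanh (start \<omega>)\<close> and its Moebius transform is
  \<open>stoch_exp (1/2) \<omega>\<close>. This makes the pieces of the path fit together.\<close>

lemma fake_half:
  assumes "\<omega>' \<in> space M" "1/2 \<le> t" "t \<le> 1"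
  shows "fake t (\<omega>, (h, v), \<omega>') = (1 + rot_tanh t (\<omega>, (h, v), \<omega>')) / (1 - rot_tanh t (\<omega>, (h, v), \<omega>'))"
proof (cases "t = 1/2")
  case True
  show ?thesis unfolding True rot_tanh_half[OF assms(1)] by (simp add: fake_def stoch_exp_half)
qed (use assms in \<open>auto simp: fake_def\<close>)

lemma fake_one:
  assumes "1 \<le> t"
  shows "fake t (\<omega>, (h, v), \<omega>') = (1 + rot_tanh 1 (\<omega>, (h, v), \<omega>')) / (1 - rot_tanh 1 (\<omega>, (h, v), \<omega>')) * (stoch_exp t \<omega> / stoch_exp 1 \<omega>)"
  using assms stoch_exp_pos[of 1 \<omega>] by (cases "t = 1") (auto simp: fake_def)

definition radius_coord :: "'a \<times> (real \<times> real) \<times> 'a \<Rightarrow> real" where "radius_coord p = fst (fst (snd p))"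
definition angle_coord :: "'a \<times> (real \<times> real) \<times> 'a \<Rightarrow> real" where "angle_coord p = snd (fst (snd p))"
definition first_path :: "'a \<times> (real \<times> real) \<times> 'a \<Rightarrow> 'a" where "first_path p = fst p"
definition second_path :: "'a \<times> (real \<times> real) \<times> 'a \<Rightarrow> 'a" where "second_path p = snd (snd p)"

lemma coordinates_measurable[measurable]:
  "radius_coord \<in> borel_measurable base" "angle_coord \<in> borel_measurable base" "first_path \<in> measurable base M" "second_path \<in> measurable base M"
proof -
  have 1: "(\<lambda>p. fst (fst (snd p))) \<in> measurable base U01" "(\<lambda>p. snd (fst (snd p))) \<in> measurable base U01"
    unfolding base_def by measurable
  show "radius_coord \<in> borel_measurable base" "angle_coord \<in> borel_measurable base"
    unfolding radius_coord_def[abs_def] angle_coord_def[abs_def]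
    using measurable_compose[OF 1(1) id_U01] measurable_compose[OF 1(2) id_U01] .
  show "first_path \<in> measurable base M" "second_path \<in> measurable base M"
    unfolding first_path_def[abs_def] second_path_def[abs_def] base_def by measurable
qed

lemma rot_tanh_coordinates:
  "rot_tanh t = (\<lambda>p. tanh (radius_quantile t (radius_coord p)) * rot (B (rot_time t (radius_coord p)) (second_path p)) (tanh (start (first_path p)) / tanh (radius_quantile (1/2) (radius_coord p))) (angle_coord p))"
  by (auto simp: rot_tanh_def radius_coord_def angle_coord_def first_path_def second_path_def start_ratio_def fun_eq_iff)

lemma rot_tanh_measurable[measurable]:
  assumes "1/2 \<le> t" "t \<le> 1" shows "rot_tanh t \<in> borel_measurable base"
proof -
  have [measurable]: "radius_quantile t \<in> borel_measurable borel" "radius_quantile (1/2) \<in> borel_measurable borel"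
    using assms by (auto intro!: radius_quantile_measurable)
  note [measurable] = rot_time_measurable[OF assms]
  have [measurable]: "(\<lambda>p. B (rot_time t (radius_coord p)) (second_path p)) \<in> borel_measurable base"
    by (rule B_time_measurable[OF measurable_compose[OF coordinates_measurable(1) rot_time_measurable[OF assms]] coordinates_measurable(4)])
       (use assms rot_time_nonneg in auto)
  show ?thesis unfolding rot_tanh_coordinates by measurable
qed

lemma weight_measurable[measurable]: "(\<lambda>p. weight (fst p) (fst (snd p))) \<in> borel_measurable base"
proof -
  have [measurable]: "radius_quantile (1/2) \<in> borel_measurable borel" by (auto intro!: radius_quantile_measurable)
  have "(\<lambda>p. weight (fst p) (fst (snd p))) = (\<lambda>p. (1 + swap_sign (first_path p) * cos (2 * pi * angle_coord p)) *
     (indicator {0<..} (radius_quantile (1/2) (radius_coord p) - \<bar>start (first_path p)\<bar>) / (2 * tanh (radius_quantile (1/2) (radius_coord p)) * (cosh (start (first_path p)))\<^sup>2 * start_density (start (first_path p)))))"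
    by (auto simp: fun_eq_iff weight_def radius_coord_def angle_coord_def first_path_def indicator_def)
  then show ?thesis by simp
qed

lemma fake_measurable[measurable]:
  assumes "0 \<le> t" shows "fake t \<in> borel_measurable base"
proof -
  have [measurable]: "(\<lambda>p. stoch_exp t (fst p)) \<in> borel_measurable base" if "0 \<le> t" for t
    using measurable_compose[OF coordinates_measurable(3) stoch_exp_measurable[OF that]] by (simp add: first_path_def)
  show ?thesis
  proof (cases "t \<le> 1/2")
    case True
    then show ?thesis using assms by (simp add: fake_def[abs_def])
  next
    case False
    show ?thesis
    proof (cases "t \<le> 1")
      case True
      then show ?thesis using False by (simp add: fake_def[abs_def])
    next
      case False
      then have "\<not> t \<le> 1/2" by simp
      then show ?thesis using False by (simp add: fake_def[abs_def])
    qed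
  qed
qed

end

section \<open>The martingale property\<close>

text \<open>The tilt by \<open>cos (2 * pi * v)\<close> has mean 0, so it is invisible to integrands
  that ignore the angle.\<close>

lemma nn_integral_U01_angle:
  assumes e: "\<bar>e\<bar> \<le> 1" and k: "0 \<le> k"
  shows "(\<integral>\<^sup>+v. ennreal ((1 + e * cos (2 * pi * v)) * k) \<partial>U01) = ennreal k"
proof -
  interpret U: prob_space U01 by (rule prob_space_U01)
  have m: "(\<lambda>v. cos (2 * pi * v)) \<in> borel_measurable U01"
    by (rule measurable_restrict_space1) simp
  have i: "integrable U01 (\<lambda>v. cos (2 * pi * v))"
    by (rule U.integrable_const_bound[where B = 1]) (use m in auto)
  have "(\<integral>v. cos (2 * pi * v) * indicator {0..1} v \<partial>lborel) = sin (2 * pi * 1) / (2 * pi) - sin (2 * pi * 0) / (2 * pi)"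
    by (rule integral_FTC_Icc_real) (auto intro!: derivative_eq_intros continuous_intros)
  then have z: "(\<integral>v. cos (2 * pi * v) \<partial>U01) = 0"
    by (subst integral_U01) (auto simp: sin_double[symmetric] mult.commute)
  have nn: "0 \<le> 1 + e * cos x" for x
  proof -
    have "\<bar>e * cos x\<bar> \<le> 1 * 1" unfolding abs_mult using e by (intro mult_mono) auto
    then show ?thesis by linarith
  qed
  have "(\<integral>\<^sup>+v. ennreal ((1 + e * cos (2 * pi * v)) * k) \<partial>U01) = ennreal (\<integral>v. (1 + e * cos (2 * pi * v)) * k \<partial>U01)"
    by (rule nn_integral_eq_integral) (use i nn k in auto)
  also have "(\<integral>v. (1 + e * cos (2 * pi * v)) * k \<partial>U01) = k"
    using i z U.prob_space by (simp add: space_restrict_space)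
  finally show ?thesis .
qed

context continuous_bm
begin

lemma prob_space_angles: "prob_space (U01 \<Otimes>\<^sub>M U01)"
proof -
  interpret U: prob_space U01 by (rule prob_space_U01)
  interpret P: pair_prob_space U01 U01 ..
  show ?thesis by unfold_locales
qed

lemma prob_space_angles_path: "prob_space ((U01 \<Otimes>\<^sub>M U01) \<Otimes>\<^sub>M M)"
proof -
  interpret U: prob_space "U01 \<Otimes>\<^sub>M U01" by (rule prob_space_angles)
  interpret P: pair_prob_space "U01 \<Otimes>\<^sub>M U01" M ..
  show ?thesis by unfold_locales
qed

text \<open>The second path is innermost, for the rotation martingale with all other coordinates
  frozen.\<close>

lemma nn_integral_base_A:
  assumes f: "f \<in> borel_measurable base"
  shows "(\<integral>\<^sup>+p. f p \<partial>base) = (\<integral>\<^sup>+\<omega>. \<integral>\<^sup>+\<theta>. \<integral>\<^sup>+\<omega>'. f (\<omega>, \<theta>, \<omega>') \<partial>M \<partial>(U01 \<Otimes>\<^sub>M U01) \<partial>M)"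
proof -
  interpret R: prob_space "(U01 \<Otimes>\<^sub>M U01) \<Otimes>\<^sub>M M" by (rule prob_space_angles_path)
  note [measurable] = f[unfolded base_def]
  have "(\<integral>\<^sup>+p. f p \<partial>base) = (\<integral>\<^sup>+\<omega>. \<integral>\<^sup>+r. f (\<omega>, r) \<partial>((U01 \<Otimes>\<^sub>M U01) \<Otimes>\<^sub>M M) \<partial>M)"
    unfolding base_def by (subst R.nn_integral_fst) auto
  also have "\<dots> = (\<integral>\<^sup>+\<omega>. \<integral>\<^sup>+\<theta>. \<integral>\<^sup>+\<omega>'. f (\<omega>, \<theta>, \<omega>') \<partial>M \<partial>(U01 \<Otimes>\<^sub>M U01) \<partial>M)"
    by (intro nn_integral_cong nn_integral_fst[symmetric]) measurable
  finally show ?thesis .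
qed

text \<open>The first path is innermost, for its exponential increments after time 1.\<close>

lemma nn_integral_base_B:
  assumes f: "f \<in> borel_measurable base"
  shows "(\<integral>\<^sup>+p. f p \<partial>base) = (\<integral>\<^sup>+\<theta>. \<integral>\<^sup>+\<omega>'. \<integral>\<^sup>+\<omega>. f (\<omega>, \<theta>, \<omega>') \<partial>M \<partial>M \<partial>(U01 \<Otimes>\<^sub>M U01))"
proof -
  interpret R: prob_space "(U01 \<Otimes>\<^sub>M U01) \<Otimes>\<^sub>M M" by (rule prob_space_angles_path)
  interpret P: pair_sigma_finite M "(U01 \<Otimes>\<^sub>M U01) \<Otimes>\<^sub>M M" ..
  note [measurable] = f[unfolded base_def]
  have "(\<integral>\<^sup>+p. f p \<partial>base) = (\<integral>\<^sup>+r. \<integral>\<^sup>+\<omega>. f (\<omega>, r) \<partial>M \<partial>((U01 \<Otimes>\<^sub>M U01) \<Otimes>\<^sub>M M))"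
    unfolding base_def by (subst P.nn_integral_snd) auto
  also have "\<dots> = (\<integral>\<^sup>+\<theta>. \<integral>\<^sup>+\<omega>'. \<integral>\<^sup>+\<omega>. f (\<omega>, \<theta>, \<omega>') \<partial>M \<partial>M \<partial>(U01 \<Otimes>\<^sub>M U01))"
    by (intro nn_integral_fst[symmetric]) measurable
  finally show ?thesis .
qed

lemma space_base: "space base = space M \<times> (({0<..<1} \<times> {0<..<1}) \<times> space M)"
  by (simp add: base_def space_pair_measure space_restrict_space)

text \<open>For fixed \<open>h\<close>, process time \<open>t\<close> is time
  \<open>rot_time t h\<close> of the second path, and \<open>1 + \<sigma> * Z\<close> is a
  trigonometric martingale there. Its nonnegativity relies on \<open>start_ratio\<close> lying in
  \<open>[-1, 1]\<close>; where this fails, \<open>weight\<close> vanishes and both sides are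
  0.\<close>

lemma tilt_section:
  assumes st: "1/2 \<le> s" "s \<le> t" "t \<le> 1" and Y[measurable]: "Y \<in> borel_measurable (F (rot_time s h))"
    and \<sigma>: "\<sigma> = 1 \<or> \<sigma> = -1"
  shows "(\<integral>\<^sup>+\<omega>'. Y \<omega>' * ennreal (weight \<omega> (h, v) * (1 + \<sigma> * rot_tanh t (\<omega>, (h, v), \<omega>'))) \<partial>M)
    = (\<integral>\<^sup>+\<omega>'. Y \<omega>' * ennreal (weight \<omega> (h, v) * (1 + \<sigma> * rot_tanh s (\<omega>, (h, v), \<omega>'))) \<partial>M)"
proof (cases "weight \<omega> (h, v) = 0")
  case False
  note sup = weight_nonzeroD[OF False]
  let ?a = "\<sigma> * tanh (start \<omega>)" and ?b = "\<sigma> * (tanh (radius_quantile (1/2) h) * sqrt (1 - (start_ratio \<omega> h)\<^sup>2) * cos (pi * v))"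
  have Z: "\<sigma> * rot_tanh r (\<omega>, (h, v), \<omega>') = exp (rot_time r h / 2) * (?a * cos (B (rot_time r h) \<omega>') + ?b * sin (B (rot_time r h) \<omega>'))"
    if "1/2 \<le> r" "r \<le> 1" for r \<omega>'
    unfolding rot_tanh_trig[OF that] by (simp add: algebra_simps)
  have nn: "0 \<le> 1 + exp (rot_time t h / 2) * (?a * cos w + ?b * sin w)" for w
  proof -
    have r: "exp (rot_time t h / 2) * (?a * cos w + ?b * sin w) = \<sigma> * (tanh (radius_quantile t h) * rot w (start_ratio \<omega> h) v)"
      using radius_quantile_pos'[of "1/2" h] st unfolding exp_rot_time[of t h, OF order_trans[OF st(1,2)] st(3)]
      by (simp add: rot_def start_ratio_def field_simps)
    have "\<bar>tanh (radius_quantile t h) * rot w (start_ratio \<omega> h) v\<bar> \<le> 1 * 1"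
      unfolding abs_mult using start_ratio_abs[OF sup] tanh_real_bounds[of "radius_quantile t h"]
      by (intro mult_mono rot_bounded) auto
    then show ?thesis unfolding r using \<sigma> by auto
  qed
  have e: "Y \<omega>' * ennreal (weight \<omega> (h, v) * (1 + \<sigma> * rot_tanh r (\<omega>, (h, v), \<omega>')))
      = (Y \<omega>' * ennreal (weight \<omega> (h, v))) * ennreal (1 + exp (rot_time r h / 2) * (?a * cos (B (rot_time r h) \<omega>') + ?b * sin (B (rot_time r h) \<omega>')))"
    if "1/2 \<le> r" "r \<le> 1" for r \<omega>'
    unfolding Z[OF that] by (simp add: mult.assoc ennreal_mult'[OF weight_nonneg])
  have st': "1/2 \<le> t" "s \<le> 1" using st by auto
  show ?thesis
    unfolding e[OF st'(1) st(3)] e[OF st(1) st'(2)]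
    by (rule trig_martingale) (use st nn rot_time_nonneg rot_time_mono in auto)
qed simp

text \<open>The two signs have different uses: \<open>- 1\<close> moves the density of
  \<open>fake_measure\<close> from one time to another, and \<open>1\<close> gives the martingale
  property, since \<open>fake\<close> times \<open>1 - Z\<close> is \<open>1 + Z\<close>.\<close>

lemma tilt_base:
  assumes st: "1/2 \<le> s" "s \<le> t" "t \<le> 1" and \<sigma>: "\<sigma> = 1 \<or> \<sigma> = -1"
    and Y[measurable]: "Y \<in> borel_measurable base"
    and sec: "\<And>\<omega> h v. \<omega> \<in> space M \<Longrightarrow> (\<lambda>\<omega>'. Y (\<omega>, (h, v), \<omega>')) \<in> borel_measurable (F (rot_time s h))"
  shows "(\<integral>\<^sup>+p. Y p * ennreal (weight (fst p) (fst (snd p)) * (1 + \<sigma> * rot_tanh t p)) \<partial>base)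
    = (\<integral>\<^sup>+p. Y p * ennreal (weight (fst p) (fst (snd p)) * (1 + \<sigma> * rot_tanh s p)) \<partial>base)"
proof -
  have [measurable]: "rot_tanh t \<in> borel_measurable base" "rot_tanh s \<in> borel_measurable base" using st by auto
  have e: "(\<integral>\<^sup>+\<omega>'. Y (\<omega>, \<theta>, \<omega>') * ennreal (weight \<omega> \<theta> * (1 + \<sigma> * rot_tanh t (\<omega>, \<theta>, \<omega>'))) \<partial>M)
      = (\<integral>\<^sup>+\<omega>'. Y (\<omega>, \<theta>, \<omega>') * ennreal (weight \<omega> \<theta> * (1 + \<sigma> * rot_tanh s (\<omega>, \<theta>, \<omega>'))) \<partial>M)"
    if "\<omega> \<in> space M" for \<omega> \<theta>
    using tilt_section[OF st sec[OF that, of "fst \<theta>" "snd \<theta>"] \<sigma>, of \<omega> "snd \<theta>"] by simp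
  show ?thesis
    by (subst (1 2) nn_integral_base_A, measurable, unfold fst_conv snd_conv)
       (rule nn_integral_cong, rule nn_integral_cong, rule e)
qed

lemma nn_integral_fake_measure:
  assumes [measurable]: "f \<in> borel_measurable base"
  shows "(\<integral>\<^sup>+p. f p \<partial>fake_measure) = (\<integral>\<^sup>+p. f p * ennreal (weight (fst p) (fst (snd p)) * (1 + - 1 * rot_tanh 1 p)) \<partial>base)"
  unfolding fake_measure_def by (subst nn_integral_density) (auto simp: mult.commute)

text \<open>The factor \<open>1 - Z\<close> of the density is a martingale, so for an integrand
  known at time \<open>t\<close> its value at time 1 may be exchanged for the one at time
  \<open>t\<close>.\<close>

lemma nn_integral_fake_measure_tilt:
  assumes t: "1/2 \<le> t" "t \<le> 1" and Y[measurable]: "Y \<in> borel_measurable base"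
    and sec: "\<And>\<omega> h v. \<omega> \<in> space M \<Longrightarrow> (\<lambda>\<omega>'. Y (\<omega>, (h, v), \<omega>')) \<in> borel_measurable (F (rot_time t h))"
  shows "(\<integral>\<^sup>+p. Y p \<partial>fake_measure) = (\<integral>\<^sup>+p. Y p * ennreal (weight (fst p) (fst (snd p)) * (1 + - 1 * rot_tanh t p)) \<partial>base)"
  unfolding nn_integral_fake_measure[OF Y] by (rule tilt_base) (use t sec in auto)

lemma weight_measurable_angles: "weight \<omega> \<in> borel_measurable (U01 \<Otimes>\<^sub>M U01)"
proof -
  have [measurable]: "radius_quantile (1/2) \<in> borel_measurable borel" by (auto intro!: radius_quantile_measurable)
  have [measurable]: "(\<lambda>\<theta>. fst \<theta>) \<in> borel_measurable (U01 \<Otimes>\<^sub>M U01)" "(\<lambda>\<theta>. snd \<theta>) \<in> borel_measurable (U01 \<Otimes>\<^sub>M U01)"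
    by (rule measurable_compose[OF measurable_fst id_U01], rule measurable_compose[OF measurable_snd id_U01])
  have "weight \<omega> = (\<lambda>\<theta>. (1 + swap_sign \<omega> * cos (2 * pi * snd \<theta>)) *
     (indicator {0<..} (radius_quantile (1/2) (fst \<theta>) - \<bar>start \<omega>\<bar>) / (2 * tanh (radius_quantile (1/2) (fst \<theta>)) * (cosh (start \<omega>))\<^sup>2 * start_density (start \<omega>))))"
    by (auto simp: fun_eq_iff weight_def indicator_def)
  then show ?thesis by simp
qed

text \<open>The angle integrates out, and integrating over \<open>h\<close> yields the mixture
  density at \<open>start \<omega>\<close>. Division by \<open>start_density\<close> then leaves the
  inverse of the factor from the change of measure.\<close>

lemma nn_integral_weight:
  "(\<integral>\<^sup>+\<theta>. ennreal (weight \<omega> \<theta>) \<partial>(U01 \<Otimes>\<^sub>M U01)) = ennreal (1 / (1 - tanh (start \<omega>)))"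
proof -
  interpret U: prob_space U01 by (rule prob_space_U01)
  note [measurable] = weight_measurable_angles
  let ?k = "\<lambda>h. indicator {\<bar>start \<omega>\<bar><..} (radius_quantile (1/2) h) / (2 * tanh (radius_quantile (1/2) h) * (cosh (start \<omega>))\<^sup>2 * start_density (start \<omega>))"
  have k: "0 \<le> ?k h" for h
    using radius_quantile_pos'[of "1/2" h] start_density_pos[of "start \<omega>"] by (intro divide_nonneg_nonneg mult_nonneg_nonneg) auto
  have "(\<integral>\<^sup>+\<theta>. ennreal (weight \<omega> \<theta>) \<partial>(U01 \<Otimes>\<^sub>M U01)) = (\<integral>\<^sup>+h. \<integral>\<^sup>+v. ennreal (weight \<omega> (h, v)) \<partial>U01 \<partial>U01)"
    by (rule U.nn_integral_fst[symmetric]) measurable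
  also have "\<dots> = (\<integral>\<^sup>+h. ennreal (?k h) \<partial>U01)"
    unfolding weight_def prod.case using nn_integral_U01_angle[OF swap_sign_bound k] by (intro nn_integral_cong)
  also have "\<dots> = (\<integral>\<^sup>+h. ennreal (1 / ((cosh (start \<omega>))\<^sup>2 * start_density (start \<omega>))) * (ennreal (1 / (2 * tanh (radius_quantile (1/2) h))) * indicator {\<bar>start \<omega>\<bar><..} (radius_quantile (1/2) h)) \<partial>U01)"
  proof (rule nn_integral_cong)
    fix h
    have "ennreal (1 / ((cosh (start \<omega>))\<^sup>2 * start_density (start \<omega>))) * ennreal (1 / (2 * tanh (radius_quantile (1/2) h)))
       = ennreal (1 / (2 * tanh (radius_quantile (1/2) h) * (cosh (start \<omega>))\<^sup>2 * start_density (start \<omega>)))"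
      using radius_quantile_pos'[of "1/2" h] start_density_pos[of "start \<omega>"] by (subst ennreal_mult[symmetric]) (auto simp: mult_ac)
    then show "ennreal (?k h) = ennreal (1 / ((cosh (start \<omega>))\<^sup>2 * start_density (start \<omega>))) * (ennreal (1 / (2 * tanh (radius_quantile (1/2) h))) * indicator {\<bar>start \<omega>\<bar><..} (radius_quantile (1/2) h))"
      by (simp add: indicator_def)
  qed
  also have "\<dots> = ennreal (1 / ((cosh (start \<omega>))\<^sup>2 * start_density (start \<omega>))) * ennreal (tanh_density (1/2) \<bar>start \<omega>\<bar>)"
  proof (subst nn_integral_cmult)
    have [measurable]: "radius_quantile (1/2) \<in> borel_measurable U01"
      by (intro measurable_restrict_space1) (auto intro!: radius_quantile_measurable)
    show "(\<lambda>h. ennreal (1 / (2 * tanh (radius_quantile (1/2) h))) * indicator {\<bar>start \<omega>\<bar><..} (radius_quantile (1/2) h)) \<in> borel_measurable U01"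
      by measurable
  qed (simp add: nn_integral_cond_density)
  also have "\<dots> = ennreal (1 / (1 - tanh (start \<omega>)))"
  proof -
    have n: "start_density (start \<omega>) = (1 - tanh (start \<omega>)) * (2 * cosh (start \<omega>) * killed_kernel (1/2) (start \<omega>))"
      unfolding start_density_def by (rule normal_density_eq_killed_kernel) simp
    have g: "tanh_density (1/2) \<bar>start \<omega>\<bar> = 2 * cosh (start \<omega>) ^ 3 * killed_kernel (1/2) (start \<omega>)"
      by (simp add: tanh_density_def abs_if)
    have "1 / ((cosh (start \<omega>))\<^sup>2 * start_density (start \<omega>)) * tanh_density (1/2) \<bar>start \<omega>\<bar> = 1 / (1 - tanh (start \<omega>))"
      unfolding n g using killed_kernel_pos[of "1/2" "start \<omega>"] cosh_real_pos[of "start \<omega>"] tanh_real_bounds[of "start \<omega>"]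
      by (simp add: field_simps power2_eq_square power3_eq_cube)
    moreover have "0 \<le> tanh_density (1/2) \<bar>start \<omega>\<bar>" using killed_kernel_pos[of "1/2" "start \<omega>"] unfolding g by simp
    ultimately show ?thesis using start_density_pos[of "start \<omega>"] by (subst ennreal_mult[symmetric]) auto
  qed
  finally show ?thesis .
qed

lemma rot_tanh_section: "1/2 \<le> u \<Longrightarrow> u \<le> t \<Longrightarrow> t \<le> 1 \<Longrightarrow>
    (\<lambda>\<omega>'. rot_tanh u (\<omega>, (h, v), \<omega>')) \<in> borel_measurable (F (rot_time t h))"
  unfolding rot_tanh_def prod.case using B_measurable_F[OF rot_time_nonneg[of u h] rot_time_mono[of u t h]] by measurable

lemma fake_section:
  assumes "0 \<le> u" "u \<le> t" "1/2 \<le> t" "t \<le> 1"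
  shows "(\<lambda>\<omega>'. fake u (\<omega>, (h, v), \<omega>')) \<in> borel_measurable (F (rot_time t h))"
proof (cases "u \<le> 1/2")
  case False
  note [measurable] = rot_tanh_section[of u t \<omega> h v]
  show ?thesis using False assms by (simp add: fake_def)
qed (simp add: fake_def)

lemma fake_section1:
  assumes "0 \<le> u" "u \<le> t"
  shows "(\<lambda>\<omega>. fake u (\<omega>, \<theta>, \<omega>')) \<in> borel_measurable (F t)"
proof (cases "u \<le> 1/2")
  case True
  then show ?thesis using stoch_exp_measurable_F[OF assms] by (simp add: fake_def)
next
  case False
  then have t: "1/2 \<le> t" using assms by simp
  obtain h v where \<theta>: "\<theta> = (h, v)" by (cases \<theta>)
  note [measurable] = start_measurable[OF t] stoch_exp_measurable_F[OF assms]
  have [measurable]: "(\<lambda>\<omega>. rot_tanh r (\<omega>, \<theta>, \<omega>')) \<in> borel_measurable (F t)" for r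
    unfolding rot_tanh_def \<theta> prod.case start_ratio_def by measurable
  have "stoch_exp 1 \<in> borel_measurable (F t)" if "\<not> u \<le> 1" using stoch_exp_measurable_F[of 1 t] that assms by simp
  then show ?thesis using False by (cases "u \<le> 1") (simp_all add: fake_def)
qed

lemma weight_section1: "1/2 \<le> t \<Longrightarrow> (\<lambda>\<omega>. weight \<omega> \<theta>) \<in> borel_measurable (F t)"
proof -
  assume t: "1/2 \<le> t"
  note [measurable] = start_measurable[OF t] swap_sign_measurable[OF t]
  have "(\<lambda>\<omega>. weight \<omega> \<theta>) = (\<lambda>\<omega>. (1 + swap_sign \<omega> * cos (2 * pi * snd \<theta>)) *
     (indicator {0<..} (radius_quantile (1/2) (fst \<theta>) - \<bar>start \<omega>\<bar>) / (2 * tanh (radius_quantile (1/2) (fst \<theta>)) * (cosh (start \<omega>))\<^sup>2 * start_density (start \<omega>))))"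
    by (auto simp: fun_eq_iff weight_def indicator_def split_beta)
  then show ?thesis by simp
qed

lemma rot_tanh_section1: "1/2 \<le> t \<Longrightarrow> (\<lambda>\<omega>. rot_tanh r (\<omega>, \<theta>, \<omega>')) \<in> borel_measurable (F t)"
  using start_measurable[of t] unfolding rot_tanh_def start_ratio_def by (cases \<theta>) simp

text \<open>With the density moved to time 1/2, its factor \<open>1 - tanh (start \<omega>)\<close>
  cancels the total mass of \<open>weight\<close>. So the first path keeps its law, and constant 1
  shows that \<open>fake_measure\<close> is a probability.\<close>

lemma nn_integral_fake_measure_initial:
  assumes f: "f \<in> borel_measurable M"
  shows "(\<integral>\<^sup>+p. f (fst p) \<partial>fake_measure) = (\<integral>\<^sup>+\<omega>. f \<omega> \<partial>M)"
proof -
  have [measurable]: "(\<lambda>p. f (fst p)) \<in> borel_measurable base"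
    using measurable_compose[OF coordinates_measurable(3) f] by (simp add: first_path_def)
  have m: "rot_tanh (1/2) \<in> borel_measurable base" by simp
  have "(\<integral>\<^sup>+p. f (fst p) \<partial>fake_measure) = (\<integral>\<^sup>+p. f (fst p) * ennreal (weight (fst p) (fst (snd p)) * (1 + - 1 * rot_tanh (1/2) p)) \<partial>base)"
    by (rule nn_integral_fake_measure_tilt) auto
  also have "\<dots> = (\<integral>\<^sup>+\<omega>. \<integral>\<^sup>+\<theta>. \<integral>\<^sup>+\<omega>'. f \<omega> * ennreal (weight \<omega> \<theta> * (1 + - 1 * rot_tanh (1/2) (\<omega>, \<theta>, \<omega>'))) \<partial>M \<partial>(U01 \<Otimes>\<^sub>M U01) \<partial>M)"
    using m by (subst nn_integral_base_A) auto
  also have "\<dots> = (\<integral>\<^sup>+\<omega>. \<integral>\<^sup>+\<theta>. f \<omega> * ennreal (1 - tanh (start \<omega>)) * ennreal (weight \<omega> \<theta>) \<partial>(U01 \<Otimes>\<^sub>M U01) \<partial>M)"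
  proof (intro nn_integral_cong)
    fix \<omega> \<theta>
    have t: "0 \<le> 1 - tanh (start \<omega>)" using tanh_real_bounds[of "start \<omega>"] by simp
    have "(\<integral>\<^sup>+\<omega>'. f \<omega> * ennreal (weight \<omega> \<theta> * (1 + - 1 * rot_tanh (1/2) (\<omega>, \<theta>, \<omega>'))) \<partial>M)
      = (\<integral>\<^sup>+\<omega>'. f \<omega> * ennreal (weight \<omega> \<theta> * (1 - tanh (start \<omega>))) \<partial>M)"
      by (intro nn_integral_cong) (cases \<theta>, simp add: rot_tanh_half)
    also have "\<dots> = f \<omega> * ennreal (1 - tanh (start \<omega>)) * ennreal (weight \<omega> \<theta>)"
      using t by (simp add: emeasure_space_1 ennreal_mult'[OF weight_nonneg] mult_ac)
    finally show "(\<integral>\<^sup>+\<omega>'. f \<omega> * ennreal (weight \<omega> \<theta> * (1 + - 1 * rot_tanh (1/2) (\<omega>, \<theta>, \<omega>'))) \<partial>M)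
      = f \<omega> * ennreal (1 - tanh (start \<omega>)) * ennreal (weight \<omega> \<theta>)" .
  qed
  also have "\<dots> = (\<integral>\<^sup>+\<omega>. f \<omega> \<partial>M)"
  proof (rule nn_integral_cong)
    fix \<omega>
    have t: "0 < 1 - tanh (start \<omega>)" using tanh_real_bounds[of "start \<omega>"] by simp
    have "(\<integral>\<^sup>+\<theta>. f \<omega> * ennreal (1 - tanh (start \<omega>)) * ennreal (weight \<omega> \<theta>) \<partial>(U01 \<Otimes>\<^sub>M U01))
      = f \<omega> * (ennreal (1 - tanh (start \<omega>)) * ennreal (1 / (1 - tanh (start \<omega>))))"
      using weight_measurable_angles by (subst nn_integral_cmult) (auto simp: nn_integral_weight mult.assoc)
    also have "ennreal (1 - tanh (start \<omega>)) * ennreal (1 / (1 - tanh (start \<omega>))) = 1"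
      using t by (subst ennreal_mult[symmetric]) auto
    finally show "(\<integral>\<^sup>+\<theta>. f \<omega> * ennreal (1 - tanh (start \<omega>)) * ennreal (weight \<omega> \<theta>) \<partial>(U01 \<Otimes>\<^sub>M U01)) = f \<omega>" by simp
  qed
  finally show ?thesis .
qed

lemma prob_space_fake_measure: "prob_space fake_measure"
proof
  show "emeasure fake_measure (space fake_measure) = 1"
    using nn_integral_fake_measure_initial[of "\<lambda>_. 1"] by (simp add: emeasure_space_1)
qed

lemma measurable_fake_measure: "measurable fake_measure L = measurable base L"
  by (rule measurable_cong_sets) (auto simp: fake_measure_def)

section \<open>Martingale property with respect to the past of the process, piece by piece in
  time\<close>

definition past :: "(real \<Rightarrow> real) set \<Rightarrow> real \<Rightarrow> 'a \<times> (real \<times> real) \<times> 'a \<Rightarrow> ennreal" where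
  "past A s p = indicator A (restrict (\<lambda>u. fake u p) {0..s})"

lemma past_measurable:
  assumes A: "A \<in> sets (PiM {0..s} (\<lambda>_. borel))"
    and X: "\<And>u. 0 \<le> u \<Longrightarrow> u \<le> s \<Longrightarrow> (\<lambda>x. fake u (f x)) \<in> borel_measurable L"
  shows "(\<lambda>x. past A s (f x)) \<in> borel_measurable L"
  unfolding past_def
  by (rule measurable_compose[of "\<lambda>x. restrict (\<lambda>u. fake u (f x)) {0..s}" L "PiM {0..s} (\<lambda>_. borel)" "indicator A"])
     (use A X in \<open>auto intro!: measurable_restrict\<close>)

lemma past_mono:
  assumes A: "A \<in> sets (PiM {0..s} (\<lambda>_. borel))" and "s \<le> t"
  obtains A' where "A' \<in> sets (PiM {0..t} (\<lambda>_. borel))" "past A s = past A' t"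
proof
  let ?A = "(\<lambda>f. restrict f {0..s}) -` A \<inter> space (PiM {0..t} (\<lambda>_. borel :: real measure))"
  have "(\<lambda>f. restrict f {0..s}) \<in> measurable (PiM {0..t} (\<lambda>_. borel :: real measure)) (PiM {0..s} (\<lambda>_. borel))"
    using assms(2) by (intro measurable_restrict_subset) auto
  then show "?A \<in> sets (PiM {0..t} (\<lambda>_. borel))" using A by (rule measurable_sets)
  have r: "restrict (restrict (\<lambda>u. fake u p) {0..t}) {0..s} = restrict (\<lambda>u. fake u p) {0..s}" for p
    using assms(2) by (auto simp: restrict_def fun_eq_iff)
  have sp: "restrict (\<lambda>u. fake u p) {0..t} \<in> space (PiM {0..t} (\<lambda>_. borel))" for p
    by (simp add: space_PiM)
  show "past A s = past ?A t"
  proof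
    fix p
    have "restrict (\<lambda>u. fake u p) {0..t} \<in> ?A \<longleftrightarrow> restrict (\<lambda>u. fake u p) {0..s} \<in> A"
      using r[of p] sp[of p] by (simp only: vimage_eq Int_iff simp_thms)
    then show "past A s p = past ?A t p" by (simp only: past_def indicator_def)
  qed
qed

lemma fake_nonneg:
  assumes "p \<in> space base" "\<bar>start (fst p)\<bar> < radius_quantile (1/2) (fst (fst (snd p)))" shows "0 \<le> fake t p"
proof -
  obtain \<omega> h v \<omega>' where p: "p = (\<omega>, (h, v), \<omega>')" by (cases p) auto
  have z: "\<bar>rot_tanh r p\<bar> < 1" if "1/2 \<le> r" "r \<le> 1" for r
    unfolding p by (rule rot_tanh_abs) (use that assms p in auto)
  show ?thesis
    using z[of t] z[of 1] stoch_exp_pos[of t "fst p"] stoch_exp_pos[of 1 "fst p"]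
    by (auto simp: fake_def abs_less_iff intro!: divide_nonneg_nonneg mult_nonneg_nonneg)
qed

definition mart_step :: "real \<Rightarrow> real \<Rightarrow> bool" where
  "mart_step s t \<longleftrightarrow> (\<forall>A\<in>sets (PiM {0..s} (\<lambda>_. borel)).
     (\<integral>\<^sup>+p. past A s p * ennreal (fake t p) \<partial>fake_measure) = (\<integral>\<^sup>+p. past A s p * ennreal (fake s p) \<partial>fake_measure))"

text \<open>Events of the past at \<open>s\<close> are also events of the past at \<open>t\<close>,
  so steps over adjacent intervals can be chained.\<close>

lemma mart_step_trans:
  assumes st: "mart_step s t" and tr: "mart_step t r" and "s \<le> t" shows "mart_step s r"
  unfolding mart_step_def
proof
  fix A :: "(real \<Rightarrow> real) set" assume A: "A \<in> sets (PiM {0..s} (\<lambda>_. borel))"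
  obtain A' where A': "A' \<in> sets (PiM {0..t} (\<lambda>_. borel))" "past A s = past A' t"
    by (rule past_mono[OF A \<open>s \<le> t\<close>])
  have "(\<integral>\<^sup>+p. past A s p * ennreal (fake r p) \<partial>fake_measure) = (\<integral>\<^sup>+p. past A s p * ennreal (fake t p) \<partial>fake_measure)"
    unfolding A'(2) by (rule bspec[OF tr[unfolded mart_step_def] A'(1)])
  also have "\<dots> = (\<integral>\<^sup>+p. past A s p * ennreal (fake s p) \<partial>fake_measure)"
    by (rule bspec[OF st[unfolded mart_step_def] A])
  finally show "(\<integral>\<^sup>+p. past A s p * ennreal (fake r p) \<partial>fake_measure) = (\<integral>\<^sup>+p. past A s p * ennreal (fake s p) \<partial>fake_measure)" .
qed

lemma mart_step_initial: assumes "0 \<le> s" "s \<le> t" "t \<le> 1/2" shows "mart_step s t"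
  unfolding mart_step_def
proof
  fix A :: "(real \<Rightarrow> real) set" assume A: "A \<in> sets (PiM {0..s} (\<lambda>_. borel))"
  \<comment> \<open>The last two components are dummies: up to time 1/2 the process depends on the
    first path alone.\<close>
  define J where "J \<omega> = past A s (\<omega>, (0, 0), \<omega>)" for \<omega>
  have J: "J \<in> borel_measurable (F s)"
  proof -
    have "(\<lambda>\<omega>. past A s (\<omega>, (0, 0), undefined)) \<in> borel_measurable (F s)"
      by (rule past_measurable[OF A]) (rule fake_section1)
    moreover have "J = (\<lambda>\<omega>. past A s (\<omega>, (0, 0), undefined))"
      unfolding J_def past_def using assms
      by (intro ext arg_cong[where f = "indicator A"]) (auto simp: restrict_def fun_eq_iff fake_def)
    ultimately show ?thesis by simp
  qed
  have past_J: "past A s p = J (fst p)" for p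
    unfolding J_def past_def using assms
    by (intro arg_cong[where f = "indicator A"]) (auto simp: restrict_def fun_eq_iff fake_def)
  have X: "fake r p = stoch_exp r (fst p)" if "r \<le> 1/2" for r p using that by (simp add: fake_def)
  have "(\<integral>\<^sup>+p. past A s p * ennreal (fake r p) \<partial>fake_measure) = (\<integral>\<^sup>+\<omega>. J \<omega> * ennreal (stoch_exp r \<omega>) \<partial>M)" if "0 \<le> r" "r \<le> 1/2" for r
    unfolding past_J X[OF that(2)]
    using nn_integral_fake_measure_initial[of "\<lambda>\<omega>. J \<omega> * ennreal (stoch_exp r \<omega>)"] measurable_from_F[OF J] stoch_exp_measurable[OF that(1)]
    by simp
  then show "(\<integral>\<^sup>+p. past A s p * ennreal (fake t p) \<partial>fake_measure) = (\<integral>\<^sup>+p. past A s p * ennreal (fake s p) \<partial>fake_measure)"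
    using exp_martingale[OF assms(1,2) J] assms by simp
qed

lemma fake_times_one_minus_rot_tanh:
  assumes p: "p \<in> space base" and t: "1/2 \<le> t" "t \<le> 1"
  shows "ennreal (fake t p) * ennreal (weight (fst p) (fst (snd p)) * (1 + - 1 * rot_tanh t p))
    = ennreal (weight (fst p) (fst (snd p)) * (1 + 1 * rot_tanh t p))"
proof -
  obtain \<omega> h v \<omega>' where p': "p = (\<omega>, (h, v), \<omega>')" by (cases p) auto
  have \<omega>': "\<omega>' \<in> space M" using p by (auto simp: p' space_base)
  show ?thesis
  proof (cases "weight \<omega> (h, v) = 0")
    case False
    have z: "\<bar>rot_tanh t p\<bar> < 1"
      unfolding p' by (rule rot_tanh_abs[OF weight_nonzeroD[OF False]]) (use t in auto)
    have X: "fake t p = (1 + rot_tanh t p) / (1 - rot_tanh t p)" unfolding p' by (rule fake_half[OF \<omega>' t])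
    show ?thesis
      unfolding X using z weight_nonneg[of \<omega> "(h, v)"]
      by (subst ennreal_mult[symmetric]) (auto simp: p' abs_less_iff)
  qed (simp add: p')
qed

text \<open>Moving the density to the later time clears the denominator of the Moebius transform and
  leaves \<open>1 + Z\<close>, which is a martingale of the second path on its clock.\<close>

lemma mart_step_middle: assumes "1/2 \<le> s" "s \<le> t" "t \<le> 1" shows "mart_step s t"
  unfolding mart_step_def
proof
  fix A :: "(real \<Rightarrow> real) set" assume A: "A \<in> sets (PiM {0..s} (\<lambda>_. borel))"
  have [measurable]: "past A s \<in> borel_measurable base"
    using past_measurable[OF A, of "\<lambda>p. p" base] fake_measurable by simp
  have sec: "(\<lambda>\<omega>'. past A s (\<omega>, (h, v), \<omega>')) \<in> borel_measurable (F (rot_time r h))" if "s \<le> r" "r \<le> 1" for \<omega> h v r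
    by (rule past_measurable[OF A]) (use assms that in \<open>auto intro!: fake_section\<close>)
  have step: "(\<integral>\<^sup>+p. past A s p * ennreal (fake r p) \<partial>fake_measure)
     = (\<integral>\<^sup>+p. past A s p * ennreal (weight (fst p) (fst (snd p)) * (1 + 1 * rot_tanh r p)) \<partial>base)"
    if r: "s \<le> r" "r \<le> 1" for r
  proof -
    have [measurable]: "fake r \<in> borel_measurable base" using assms r by auto
    have "(\<integral>\<^sup>+p. past A s p * ennreal (fake r p) \<partial>fake_measure)
      = (\<integral>\<^sup>+p. past A s p * ennreal (fake r p) * ennreal (weight (fst p) (fst (snd p)) * (1 + - 1 * rot_tanh r p)) \<partial>base)"
    proof (rule nn_integral_fake_measure_tilt)
      fix \<omega> h v
      have "(\<lambda>\<omega>'. fake r (\<omega>, (h, v), \<omega>')) \<in> borel_measurable (F (rot_time r h))"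
        by (rule fake_section) (use r assms in auto)
      then show "(\<lambda>\<omega>'. past A s (\<omega>, (h, v), \<omega>') * ennreal (fake r (\<omega>, (h, v), \<omega>'))) \<in> borel_measurable (F (rot_time r h))"
        using sec[OF r] by measurable
    qed (use r assms in auto)
    also have "\<dots> = (\<integral>\<^sup>+p. past A s p * ennreal (weight (fst p) (fst (snd p)) * (1 + 1 * rot_tanh r p)) \<partial>base)"
      using r assms by (intro nn_integral_cong) (simp only: mult.assoc fake_times_one_minus_rot_tanh)
    finally show ?thesis .
  qed
  show "(\<integral>\<^sup>+p. past A s p * ennreal (fake t p) \<partial>fake_measure) = (\<integral>\<^sup>+p. past A s p * ennreal (fake s p) \<partial>fake_measure)"
    unfolding step[OF assms(2,3)] step[OF order_refl order_trans[OF assms(2,3)]]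
    by (rule tilt_base) (use assms sec[of s] in auto)
qed

text \<open>With \<open>(h, v)\<close> and the second path frozen, the past, the density and the
  division by \<open>stoch_exp 1\<close> are all known to the first path at time \<open>s\<close>.
  What remains is the exponential martingale.\<close>

lemma mart_step_final: assumes "1 \<le> s" "s \<le> t" shows "mart_step s t"
  unfolding mart_step_def
proof
  fix A :: "(real \<Rightarrow> real) set" assume A: "A \<in> sets (PiM {0..s} (\<lambda>_. borel))"
  have [measurable]: "past A s \<in> borel_measurable base"
    using past_measurable[OF A, of "\<lambda>p. p" base] fake_measurable by simp
  define Y where "Y \<theta> \<omega>' \<omega> = past A s (\<omega>, \<theta>, \<omega>') * ennreal (weight \<omega> \<theta> * (1 + - 1 * rot_tanh 1 (\<omega>, \<theta>, \<omega>'))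
     * ((1 + rot_tanh 1 (\<omega>, \<theta>, \<omega>')) / (1 - rot_tanh 1 (\<omega>, \<theta>, \<omega>')) / stoch_exp 1 \<omega>))" for \<theta> \<omega>' \<omega>
  have Y: "Y \<theta> \<omega>' \<in> borel_measurable (F s)" for \<theta> \<omega>'
  proof -
    have "(\<lambda>\<omega>. past A s (\<omega>, \<theta>, \<omega>')) \<in> borel_measurable (F s)"
      by (rule past_measurable[OF A]) (rule fake_section1)
    moreover have s: "1/2 \<le> s" using assms by simp
    ultimately show ?thesis
      unfolding Y_def using weight_section1[OF s, of \<theta>] rot_tanh_section1[OF s, of 1 \<theta> \<omega>'] stoch_exp_measurable_F[of 1 s] assms
      by simp
  qed
  have step: "(\<integral>\<^sup>+p. past A s p * ennreal (fake r p) \<partial>fake_measure)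
    = (\<integral>\<^sup>+\<theta>. \<integral>\<^sup>+\<omega>'. \<integral>\<^sup>+\<omega>. Y \<theta> \<omega>' \<omega> * ennreal (stoch_exp r \<omega>) \<partial>M \<partial>M \<partial>(U01 \<Otimes>\<^sub>M U01))" if r: "s \<le> r" for r
  proof -
    have [measurable]: "fake r \<in> borel_measurable base" "rot_tanh 1 \<in> borel_measurable base" using assms r by auto
    have "(\<integral>\<^sup>+p. past A s p * ennreal (fake r p) \<partial>fake_measure)
      = (\<integral>\<^sup>+\<theta>. \<integral>\<^sup>+\<omega>'. \<integral>\<^sup>+\<omega>. past A s (\<omega>, \<theta>, \<omega>') * ennreal (fake r (\<omega>, \<theta>, \<omega>'))
          * ennreal (weight \<omega> \<theta> * (1 + - 1 * rot_tanh 1 (\<omega>, \<theta>, \<omega>'))) \<partial>M \<partial>M \<partial>(U01 \<Otimes>\<^sub>M U01))"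
      by (subst nn_integral_fake_measure, simp, subst nn_integral_base_B) auto
    also have "\<dots> = (\<integral>\<^sup>+\<theta>. \<integral>\<^sup>+\<omega>'. \<integral>\<^sup>+\<omega>. Y \<theta> \<omega>' \<omega> * ennreal (stoch_exp r \<omega>) \<partial>M \<partial>M \<partial>(U01 \<Otimes>\<^sub>M U01))"
    proof (intro nn_integral_cong)
      fix \<theta> :: "real \<times> real" and \<omega>' \<omega> :: 'a
      obtain h v where \<theta>: "\<theta> = (h, v)" by (cases \<theta>)
      let ?z = "rot_tanh 1 (\<omega>, \<theta>, \<omega>')"
      have "ennreal (fake r (\<omega>, \<theta>, \<omega>')) * ennreal (weight \<omega> \<theta> * (1 + - 1 * ?z))
        = ennreal (weight \<omega> \<theta> * (1 + - 1 * ?z) * ((1 + ?z) / (1 - ?z) / stoch_exp 1 \<omega>)) * ennreal (stoch_exp r \<omega>)"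
      proof (cases "weight \<omega> \<theta> = 0")
        case False
        have z: "\<bar>?z\<bar> < 1"
          unfolding \<theta> by (rule rot_tanh_abs[OF weight_nonzeroD]) (use False \<theta> in auto)
        have X: "fake r (\<omega>, \<theta>, \<omega>') = (1 + ?z) / (1 - ?z) * (stoch_exp r \<omega> / stoch_exp 1 \<omega>)"
          unfolding \<theta> by (rule fake_one) (use r assms in auto)
        have "0 \<le> fake r (\<omega>, \<theta>, \<omega>')" "0 \<le> weight \<omega> \<theta> * (1 + - 1 * ?z)"
          unfolding X using z stoch_exp_pos[of 1 \<omega>] stoch_exp_pos[of r \<omega>] weight_nonneg[of \<omega> \<theta>] by (auto simp: abs_less_iff)
        then have "ennreal (fake r (\<omega>, \<theta>, \<omega>')) * ennreal (weight \<omega> \<theta> * (1 + - 1 * ?z)) = ennreal (fake r (\<omega>, \<theta>, \<omega>') * (weight \<omega> \<theta> * (1 + - 1 * ?z)))"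
          by (simp only: ennreal_mult)
        also have "fake r (\<omega>, \<theta>, \<omega>') * (weight \<omega> \<theta> * (1 + - 1 * ?z)) = weight \<omega> \<theta> * (1 + - 1 * ?z) * ((1 + ?z) / (1 - ?z) / stoch_exp 1 \<omega>) * stoch_exp r \<omega>"
          unfolding X by (simp add: mult_ac)
        finally show ?thesis using stoch_exp_pos[of r \<omega>] by (simp only: ennreal_mult''[OF less_imp_le])
      qed simp
      then show "past A s (\<omega>, \<theta>, \<omega>') * ennreal (fake r (\<omega>, \<theta>, \<omega>')) * ennreal (weight \<omega> \<theta> * (1 + - 1 * ?z)) = Y \<theta> \<omega>' \<omega> * ennreal (stoch_exp r \<omega>)"
        by (simp only: Y_def mult.assoc)
    qed
    finally show ?thesis .
  qed
  show "(\<integral>\<^sup>+p. past A s p * ennreal (fake t p) \<partial>fake_measure) = (\<integral>\<^sup>+p. past A s p * ennreal (fake s p) \<partial>fake_measure)"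
    unfolding step[OF assms(2)] step[OF order_refl]
    using exp_martingale[OF _ assms(2) Y] assms by simp
qed

lemma mart_step: assumes "0 \<le> s" "s \<le> t" shows "mart_step s t"
proof -
  have 1: "mart_step s t" if "s \<le> t" "1/2 \<le> s" for s t
  proof (cases "t \<le> 1")
    case False
    then show ?thesis
      using that mart_step_trans[OF mart_step_middle[of s 1] mart_step_final[of 1 t]] mart_step_final[of s t]
      by (cases "s \<le> 1") auto
  qed (use that mart_step_middle in auto)
  show ?thesis
  proof (cases "t \<le> 1/2")
    case False
    then show ?thesis
      using assms mart_step_trans[OF mart_step_initial[of s "1/2"] 1[of "1/2" t]] 1[of s t]
      by (cases "s \<le> 1/2") auto
  qed (use assms mart_step_initial in auto)
qed

end

section \<open>Marginal laws\<close>

context continuous_bm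
begin

lemma nn_integral_B_drift:
  assumes t: "0 < t" and g[measurable]: "g \<in> borel_measurable borel"
  shows "(\<integral>\<^sup>+\<omega>. g ((B t \<omega> - t / 2) / 2) \<partial>M)
    = (\<integral>\<^sup>+u. ennreal (normal_density (- t / 4) (sqrt t / 2) u) * g u \<partial>lborel)"
proof -
  have "(\<integral>\<^sup>+\<omega>. g ((B t \<omega> - t / 2) / 2) \<partial>M) = (\<integral>\<^sup>+x. g ((x - t / 2) / 2) \<partial>gauss t)"
    by (rule nn_integral_B[OF t]) measurable
  also have "\<dots> = (\<integral>\<^sup>+x. ennreal (normal_density 0 (sqrt t) x) * g ((x - t / 2) / 2) \<partial>lborel)"
    by (rule nn_integral_density) auto
  also have "\<dots> = ennreal \<bar>2\<bar> * (\<integral>\<^sup>+u. ennreal (normal_density 0 (sqrt t) (t / 2 + 2 * u)) * g ((t / 2 + 2 * u - t / 2) / 2) \<partial>lborel)"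
    by (rule nn_integral_real_affine) auto
  also have "\<dots> = (\<integral>\<^sup>+u. ennreal 2 * (ennreal (normal_density 0 (sqrt t) (t / 2 + 2 * u)) * g u) \<partial>lborel)"
    by (subst nn_integral_cmult) auto
  also have "\<dots> = (\<integral>\<^sup>+u. ennreal (normal_density (- t / 4) (sqrt t / 2) u) * g u \<partial>lborel)"
  proof (rule nn_integral_cong)
    fix u
    have "sqrt (2 * pi * (sqrt t / 2)\<^sup>2) = sqrt (2 * pi * t) / 2"
    proof -
      have "2 * pi * (sqrt t / 2)\<^sup>2 = 2 * pi * t / 2\<^sup>2" using t by (simp add: power_divide)
      then show ?thesis by (simp only: real_sqrt_divide real_sqrt_abs)
    qed
    moreover have "sqrt (2 * pi * (sqrt t)\<^sup>2) = sqrt (2 * pi * t)" using t by simp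
    moreover have "- (t / 2 + 2 * u - 0)\<^sup>2 / (2 * (sqrt t)\<^sup>2) = - (u - - t / 4)\<^sup>2 / (2 * (sqrt t / 2)\<^sup>2)"
      using t by (simp add: field_simps power2_eq_square)
    ultimately have "2 * normal_density 0 (sqrt t) (t / 2 + 2 * u) = normal_density (- t / 4) (sqrt t / 2) u"
      by (simp only: normal_density_def) simp
    then show "ennreal 2 * (ennreal (normal_density 0 (sqrt t) (t / 2 + 2 * u)) * g u)
       = ennreal (normal_density (- t / 4) (sqrt t / 2) u) * g u"
      by (metis ennreal_mult' mult.assoc zero_le_numeral)
  qed
  finally show ?thesis .
qed

lemma nn_integral_stoch_exp:
  assumes t: "0 < t" and f[measurable]: "f \<in> borel_measurable borel"
  shows "(\<integral>\<^sup>+\<omega>. f (stoch_exp t \<omega>) \<partial>M) = (\<integral>\<^sup>+u. ennreal (normal_density (- t / 4) (sqrt t / 2) u) * f (exp (2 * u)) \<partial>lborel)"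
proof -
  have "2 * ((B t \<omega> - t / 2) / 2) = B t \<omega> - t / 2" for \<omega> by simp
  then show ?thesis using nn_integral_B_drift[OF t, of "\<lambda>u. f (exp (2 * u))"] by (simp only: stoch_exp_def) simp
qed

lemma nn_integral_start:
  assumes g[measurable]: "g \<in> borel_measurable borel"
  shows "(\<integral>\<^sup>+\<omega>. g (start \<omega>) \<partial>M) = (\<integral>\<^sup>+u. ennreal (start_density u) * g u \<partial>lborel)"
  using nn_integral_B_drift[of "1/2" g] by (simp add: start_def start_density_def)

lemma swap_sign_swap:
  assumes g[measurable]: "case_prod g \<in> borel_measurable (borel \<Otimes>\<^sub>M borel)"
  shows "(\<integral>\<^sup>+\<omega>. g (swap_sign \<omega>) (start \<omega>) \<partial>M) = (\<integral>\<^sup>+\<omega>. g (- swap_sign \<omega>) (start \<omega>) \<partial>M)"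
proof -
  define g' where "g' x y = g (indicator {0<..} x - indicator {0<..} y) ((x + y - 1/4) / 2)" for x y :: real
  have [measurable]: "case_prod g' \<in> borel_measurable (borel \<Otimes>\<^sub>M borel)"
    unfolding g'_def by measurable
  have "(\<integral>\<^sup>+\<omega>. g (swap_sign \<omega>) (start \<omega>) \<partial>M) = (\<integral>\<^sup>+\<omega>. g' (B (1/4) \<omega>) (B (2 * (1/4)) \<omega> - B (1/4) \<omega>) \<partial>M)"
    by (intro nn_integral_cong) (simp add: g'_def swap_sign_def start_def)
  also have "\<dots> = (\<integral>\<^sup>+\<omega>. g' (B (2 * (1/4)) \<omega> - B (1/4) \<omega>) (B (1/4) \<omega>) \<partial>M)"
    by (rule swap_increments) auto
  also have "\<dots> = (\<integral>\<^sup>+\<omega>. g (- swap_sign \<omega>) (start \<omega>) \<partial>M)"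
    by (intro nn_integral_cong) (simp add: g'_def swap_sign_def start_def)
  finally show ?thesis .
qed

text \<open>Averaging with the exchanged increments removes the terms odd in the sign. The case
  \<open>l = 0\<close> shows that the tilt leaves the marginal laws alone; the case
  \<open>l = \<sigma>\<close> isolates the even term that separates the process laws.\<close>

lemma swap_sign_average:
  assumes k: "\<bar>k\<bar> \<le> 1" and l: "\<bar>l\<bar> \<le> 1" and g[measurable]: "g \<in> borel_measurable borel"
  shows "(\<integral>\<^sup>+\<omega>. ennreal ((1 + swap_sign \<omega> * k) * (1 + swap_sign \<omega> * l)) * g (start \<omega>) \<partial>M)
    = (\<integral>\<^sup>+\<omega>. ennreal (1 + (swap_sign \<omega>)\<^sup>2 * (k * l)) * g (start \<omega>) \<partial>M)"
    (is "?L = ?R")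
proof -
  let ?e = "\<lambda>x. (1 + x * k) * (1 + x * l)"
  have b: "0 \<le> 1 + x * k" if "\<bar>x\<bar> \<le> 1" "\<bar>k\<bar> \<le> 1" for x k :: real
  proof -
    have "\<bar>x * k\<bar> \<le> 1 * 1" unfolding abs_mult using that by (intro mult_mono) auto
    then show ?thesis by linarith
  qed
  have pos: "0 \<le> ?e (swap_sign \<omega>)" "0 \<le> ?e (- swap_sign \<omega>)" for \<omega>
    using b[of "swap_sign \<omega>" k] b[of "- swap_sign \<omega>" k] b[of "swap_sign \<omega>" l] b[of "- swap_sign \<omega>" l] swap_sign_bound[of \<omega>] k l
    by (auto intro!: mult_nonneg_nonneg)
  have "?L = (\<integral>\<^sup>+\<omega>. ennreal (?e (- swap_sign \<omega>)) * g (start \<omega>) \<partial>M)"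
    by (rule swap_sign_swap[of "\<lambda>x u. ennreal (?e x) * g u"]) measurable
  then have "2 * ?L = ?L + (\<integral>\<^sup>+\<omega>. ennreal (?e (- swap_sign \<omega>)) * g (start \<omega>) \<partial>M)"
    by (simp add: mult_2)
  also have "\<dots> = (\<integral>\<^sup>+\<omega>. ennreal (?e (swap_sign \<omega>)) * g (start \<omega>) + ennreal (?e (- swap_sign \<omega>)) * g (start \<omega>) \<partial>M)"
    by (rule nn_integral_add[symmetric]) measurable
  also have "\<dots> = (\<integral>\<^sup>+\<omega>. 2 * (ennreal (1 + (swap_sign \<omega>)\<^sup>2 * (k * l)) * g (start \<omega>)) \<partial>M)"
  proof (rule nn_integral_cong)
    fix \<omega>
    have "?e (swap_sign \<omega>) + ?e (- swap_sign \<omega>) = 2 * (1 + (swap_sign \<omega>)\<^sup>2 * (k * l))"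
      by (simp add: algebra_simps power2_eq_square)
    then have "ennreal (?e (swap_sign \<omega>)) + ennreal (?e (- swap_sign \<omega>)) = 2 * ennreal (1 + (swap_sign \<omega>)\<^sup>2 * (k * l))"
      using pos[of \<omega>] by (metis ennreal_mult' ennreal_numeral ennreal_plus zero_le_numeral)
    then show "ennreal (?e (swap_sign \<omega>)) * g (start \<omega>) + ennreal (?e (- swap_sign \<omega>)) * g (start \<omega>)
      = 2 * (ennreal (1 + (swap_sign \<omega>)\<^sup>2 * (k * l)) * g (start \<omega>))"
      by (simp add: distrib_right[symmetric] mult.assoc)
  qed
  also have "\<dots> = 2 * ?R" by (rule nn_integral_cmult) measurable
  finally show ?thesis
    by (simp add: ennreal_mult_cancel_left)
qed

text \<open>The second factor of \<open>weight\<close> as a function of the value of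
  \<open>start\<close>, separated from sign and angle.\<close>

definition start_weight :: "real \<Rightarrow> real \<Rightarrow> real" where
  "start_weight h u = indicator {\<bar>u\<bar><..} (radius_quantile (1/2) h) / (2 * tanh (radius_quantile (1/2) h) * (cosh u)\<^sup>2 * start_density u)"

lemma start_weight_nonneg: "0 \<le> start_weight h u"
  using radius_quantile_pos'[of "1/2" h] start_density_pos[of u] unfolding start_weight_def
  by (intro divide_nonneg_nonneg mult_nonneg_nonneg) auto

lemma start_weight_measurable[measurable]: "start_weight h \<in> borel_measurable borel"
proof -
  have "start_weight h = (\<lambda>u. indicator {0<..} (radius_quantile (1/2) h - \<bar>u\<bar>) / (2 * tanh (radius_quantile (1/2) h) * (cosh u)\<^sup>2 * start_density u))"
    by (auto simp: start_weight_def indicator_def fun_eq_iff)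
  then show ?thesis by simp
qed

lemma weight_eq: "weight \<omega> (h, v) = (1 + swap_sign \<omega> * cos (2 * pi * v)) * start_weight h (start \<omega>)"
  by (simp add: weight_def start_weight_def)

text \<open>The weight cancels \<open>start_density\<close>, and \<open>1 / cosh^2\<close> is the
  Jacobian of \<open>tanh\<close>. So for given \<open>h\<close> the sphere coordinate
  \<open>start_ratio\<close> is uniform on \<open>[-1, 1]\<close>.\<close>

lemma nn_integral_start_weight:
  fixes g :: "real \<Rightarrow> ennreal"
  assumes g[measurable]: "g \<in> borel_measurable borel"
  shows "(\<integral>\<^sup>+\<omega>. ennreal (start_weight h (start \<omega>)) * g (tanh (start \<omega>) / tanh (radius_quantile (1/2) h)) \<partial>M) = uniform_mean g"
proof -
  define U where "U = radius_quantile (1/2) h"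
  have U: "0 < U" unfolding U_def by (rule radius_quantile_pos') auto
  have [measurable]: "(\<lambda>z. g (z / tanh U)) \<in> borel_measurable borel" by measurable
  have "(\<integral>\<^sup>+\<omega>. ennreal (start_weight h (start \<omega>)) * g (tanh (start \<omega>) / tanh U) \<partial>M)
    = (\<integral>\<^sup>+u. ennreal (start_density u) * (ennreal (start_weight h u) * g (tanh u / tanh U)) \<partial>lborel)"
    by (rule nn_integral_start) measurable
  also have "\<dots> = (\<integral>\<^sup>+u. ennreal (1/2) * (ennreal (1 / tanh U) * (g (tanh u / tanh U) * ennreal (1 / (cosh u)\<^sup>2) * indicator {- U..U} u)) \<partial>lborel)"
  proof (rule nn_integral_cong_AE)
    have "AE u in lborel. u \<notin> {U, - U}"
      by (intro AE_not_in) (auto intro: finite_imp_null_set_lborel)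
    then show "AE u in lborel. ennreal (start_density u) * (ennreal (start_weight h u) * g (tanh u / tanh U))
      = ennreal (1/2) * (ennreal (1 / tanh U) * (g (tanh u / tanh U) * ennreal (1 / (cosh u)\<^sup>2) * indicator {- U..U} u))"
    proof eventually_elim
      case (elim u)
      show ?case
      proof (cases "\<bar>u\<bar> < U")
        case True
        have "ennreal (start_density u) * ennreal (start_weight h u) = ennreal (1/2) * (ennreal (1 / tanh U) * ennreal (1 / (cosh u)\<^sup>2))"
          using True start_density_pos[of u] U
          by (simp only: ennreal_mult'[symmetric] ennreal_mult[symmetric] start_weight_def U_def[symmetric] start_density_pos less_imp_le
                zero_le_divide_1_iff zero_le_power2 tanh_real_nonneg_iff)
             (use start_density_pos[of u] in \<open>simp add: mult_ac\<close>)
        moreover have "indicator {- U..U} u = (1 :: ennreal)" using True by (auto simp: indicator_def)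
        moreover have "ennreal (start_density u) * (ennreal (start_weight h u) * g (tanh u / tanh U)) = (ennreal (start_density u) * ennreal (start_weight h u)) * g (tanh u / tanh U)"
          by (simp only: mult.assoc)
        ultimately show ?thesis by (simp only: mult_1_right mult_1_left mult_ac)
      next
        case False
        then have "start_weight h u = 0" "u \<notin> {- U..U}" using elim by (auto simp: start_weight_def U_def[symmetric])
        then show ?thesis by simp
      qed
    qed
  qed
  also have "\<dots> = ennreal (1/2) * (ennreal (1 / tanh U) * (\<integral>\<^sup>+u. g (tanh u / tanh U) * ennreal (1 / (cosh u)\<^sup>2) * indicator {- U..U} u \<partial>lborel))"
    by (subst nn_integral_cmult, measurable, subst nn_integral_cmult, measurable)
  also have "\<dots> = uniform_mean g"
    unfolding uniform_mean_def using nn_integral_uniform_tanh[of "\<lambda>z. g (z / tanh U)" U] U by simp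
  finally show ?thesis unfolding U_def .
qed

text \<open>The first path is innermost and the angle next: averaging the path makes the sphere
  coordinate uniform, and averaging the angle then invokes rotation invariance for a frozen second
  path.\<close>

lemma nn_integral_base_C:
  assumes f: "f \<in> borel_measurable base"
  shows "(\<integral>\<^sup>+p. f p \<partial>base) = (\<integral>\<^sup>+h. \<integral>\<^sup>+\<omega>'. \<integral>\<^sup>+v. \<integral>\<^sup>+\<omega>. f (\<omega>, (h, v), \<omega>') \<partial>M \<partial>U01 \<partial>M \<partial>U01)"
proof -
  interpret U: prob_space U01 by (rule prob_space_U01)
  interpret P: pair_sigma_finite U01 M ..
  note [measurable] = f[unfolded base_def]
  have "(\<integral>\<^sup>+p. f p \<partial>base) = (\<integral>\<^sup>+h. \<integral>\<^sup>+v. \<integral>\<^sup>+\<omega>'. \<integral>\<^sup>+\<omega>. f (\<omega>, (h, v), \<omega>') \<partial>M \<partial>M \<partial>U01 \<partial>U01)"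
    unfolding nn_integral_base_B[OF f] by (rule U.nn_integral_fst[symmetric]) measurable
  also have "\<dots> = (\<integral>\<^sup>+h. \<integral>\<^sup>+\<omega>'. \<integral>\<^sup>+v. \<integral>\<^sup>+\<omega>. f (\<omega>, (h, v), \<omega>') \<partial>M \<partial>U01 \<partial>M \<partial>U01)"
  proof (rule nn_integral_cong)
    fix h assume h: "h \<in> space U01"
    show "(\<integral>\<^sup>+v. \<integral>\<^sup>+\<omega>'. \<integral>\<^sup>+\<omega>. f (\<omega>, (h, v), \<omega>') \<partial>M \<partial>M \<partial>U01)
      = (\<integral>\<^sup>+\<omega>'. \<integral>\<^sup>+v. \<integral>\<^sup>+\<omega>. f (\<omega>, (h, v), \<omega>') \<partial>M \<partial>U01 \<partial>M)"
      by (rule P.Fubini'[symmetric]) (use h in measurable)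
  qed
  finally show ?thesis .
qed

text \<open>Averaging over the first path removes the sign and makes the sphere coordinate uniform,
  averaging over \<open>v\<close> keeps it uniform after the rotation, averaging over
  \<open>h\<close> rebuilds the law of \<open>Z\<close> at time \<open>t\<close>, and the factor
  \<open>1 - z\<close> in \<open>g\<close> converts it to the law of \<open>P\<close>.\<close>

lemma marginal_middle:
  assumes t: "1/2 \<le> t" "t \<le> 1" and f[measurable]: "f \<in> borel_measurable borel"
  shows "(\<integral>\<^sup>+p. f (fake t p) \<partial>fake_measure) = (\<integral>\<^sup>+\<omega>. f (stoch_exp t \<omega>) \<partial>M)"
proof -
  define g where "g z = f ((1 + z) / (1 - z)) * ennreal (1 - z)" for z :: real
  have [measurable]: "g \<in> borel_measurable borel" unfolding g_def by measurable
  have [measurable]: "fake t \<in> borel_measurable base" "rot_tanh t \<in> borel_measurable base" using t by auto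
  have t0: "0 < t" using t by simp
  have "(\<integral>\<^sup>+p. f (fake t p) \<partial>fake_measure) = (\<integral>\<^sup>+p. f (fake t p) * ennreal (weight (fst p) (fst (snd p)) * (1 + - 1 * rot_tanh t p)) \<partial>base)"
  proof (rule nn_integral_fake_measure_tilt[OF t])
    fix \<omega> h v
    show "(\<lambda>\<omega>'. f (fake t (\<omega>, (h, v), \<omega>'))) \<in> borel_measurable (F (rot_time t h))"
      by (rule measurable_compose[OF fake_section f]) (use t in auto)
  qed measurable
  also have "\<dots> = (\<integral>\<^sup>+p. ennreal (weight (fst p) (fst (snd p))) * g (rot_tanh t p) \<partial>base)"
  proof (rule nn_integral_cong)
    fix p assume p: "p \<in> space base"
    obtain \<omega> h v \<omega>' where p': "p = (\<omega>, (h, v), \<omega>')" by (cases p) auto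
    have "\<omega>' \<in> space M" using p by (auto simp: p' space_base)
    from fake_half[OF this t, of \<omega> h v]
    show "f (fake t p) * ennreal (weight (fst p) (fst (snd p)) * (1 + - 1 * rot_tanh t p)) = ennreal (weight (fst p) (fst (snd p))) * g (rot_tanh t p)"
      by (simp add: p' g_def ennreal_mult'[OF weight_nonneg] mult_ac)
  qed
  also have "\<dots> = (\<integral>\<^sup>+h. \<integral>\<^sup>+\<omega>'. \<integral>\<^sup>+v. \<integral>\<^sup>+\<omega>. ennreal (weight \<omega> (h, v)) * g (rot_tanh t (\<omega>, (h, v), \<omega>')) \<partial>M \<partial>U01 \<partial>M \<partial>U01)"
    by (subst nn_integral_base_C) auto
  also have "\<dots> = (\<integral>\<^sup>+h. \<integral>\<^sup>+\<omega>'. \<integral>\<^sup>+v. uniform_mean (\<lambda>x. g (tanh (radius_quantile t h) * rot (B (rot_time t h) \<omega>') x v)) \<partial>U01 \<partial>M \<partial>U01)"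
  proof (intro nn_integral_cong)
    fix h \<omega>' v
    let ?g = "\<lambda>x. g (tanh (radius_quantile t h) * rot (B (rot_time t h) \<omega>') x v)"
    have "(\<integral>\<^sup>+\<omega>. ennreal (weight \<omega> (h, v)) * g (rot_tanh t (\<omega>, (h, v), \<omega>')) \<partial>M)
      = (\<integral>\<^sup>+\<omega>. ennreal ((1 + swap_sign \<omega> * cos (2 * pi * v)) * (1 + swap_sign \<omega> * 0))
           * (\<lambda>u. ennreal (start_weight h u) * ?g (tanh u / tanh (radius_quantile (1/2) h))) (start \<omega>) \<partial>M)"
      by (intro nn_integral_cong) (simp add: weight_eq ennreal_mult'[OF one_plus_swap_sign] rot_tanh_def start_ratio_def mult.assoc)
    also have "\<dots> = (\<integral>\<^sup>+\<omega>. ennreal (1 + (swap_sign \<omega>)\<^sup>2 * (cos (2 * pi * v) * 0))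
           * (\<lambda>u. ennreal (start_weight h u) * ?g (tanh u / tanh (radius_quantile (1/2) h))) (start \<omega>) \<partial>M)"
      by (rule swap_sign_average) auto
    also have "\<dots> = uniform_mean ?g"
      using nn_integral_start_weight[of ?g h] by simp
    finally show "(\<integral>\<^sup>+\<omega>. ennreal (weight \<omega> (h, v)) * g (rot_tanh t (\<omega>, (h, v), \<omega>')) \<partial>M) = uniform_mean ?g" .
  qed
  also have "\<dots> = (\<integral>\<^sup>+h. uniform_mean (\<lambda>x. g (tanh (radius_quantile t h) * x)) \<partial>U01)"
    by (intro nn_integral_cong) (subst nn_integral_rot[of "\<lambda>z. g (tanh (radius_quantile t _) * z)"], auto simp: emeasure_space_1)
  also have "\<dots> = (\<integral>\<^sup>+u. g (tanh u) * ennreal (2 * cosh u * killed_kernel t u) \<partial>lborel)"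
    by (rule nn_integral_radius_quantile[OF t0 t(2)]) measurable
  also have "\<dots> = (\<integral>\<^sup>+u. ennreal (normal_density (- t / 4) (sqrt t / 2) u) * f (exp (2 * u)) \<partial>lborel)"
  proof (rule nn_integral_cong)
    fix u :: real
    have b: "0 \<le> 1 - tanh u" using tanh_real_bounds[of u] by simp
    have "exp (2 * u) = (1 + tanh u) / (1 - tanh u)"
    proof -
      have "exp (2 * u) = exp u / exp (- u)" by (simp add: exp_diff[symmetric])
      moreover have "exp u = (1 + tanh u) * cosh u" "exp (- u) = (1 - tanh u) * cosh u"
        using cosh_real_pos[of u] by (simp_all add: tanh_def algebra_simps cosh_plus_sinh cosh_minus_sinh)
      ultimately show ?thesis using cosh_real_pos[of u] by simp
    qed
    then show "g (tanh u) * ennreal (2 * cosh u * killed_kernel t u) = ennreal (normal_density (- t / 4) (sqrt t / 2) u) * f (exp (2 * u))"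
      unfolding g_def normal_density_eq_killed_kernel[OF t0] ennreal_mult'[OF b] by (simp add: mult_ac)
  qed
  also have "\<dots> = (\<integral>\<^sup>+\<omega>. f (stoch_exp t \<omega>) \<partial>M)" by (rule nn_integral_stoch_exp[OF t0 f, symmetric])
  finally show ?thesis .
qed

text \<open>The factor \<open>e\<close> after time 1 is a function of an increment of the first
  path, and the density is known to that path at time 1. Hence under both measures the law at
  \<open>t\<close> arises from the law at 1 by the same kernel.\<close>

lemma marginal_final:
  assumes t: "1 < t" and f[measurable]: "f \<in> borel_measurable borel"
  shows "(\<integral>\<^sup>+p. f (fake t p) \<partial>fake_measure) = (\<integral>\<^sup>+\<omega>. f (stoch_exp t \<omega>) \<partial>M)"
proof -
  define e where "e d = exp (d - (t - 1) / 2)" for d :: real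
  have [measurable]: "e \<in> borel_measurable borel" unfolding e_def by measurable
  interpret G: prob_space "gauss (t - 1)" using t by (intro prob_space_gauss) simp
  define f' where "f' x = (\<integral>\<^sup>+d. f (x * e d) \<partial>gauss (t - 1))" for x
  have [measurable]: "f' \<in> borel_measurable borel" unfolding f'_def by measurable
  have Et: "stoch_exp t \<omega> = stoch_exp 1 \<omega> * e (B t \<omega> - B 1 \<omega>)" for \<omega>
  proof -
    have "B t \<omega> - t / 2 = (B 1 \<omega> - 1 / 2) + (B t \<omega> - B 1 \<omega> - (t - 1) / 2)" by (simp add: field_simps)
    then show ?thesis unfolding stoch_exp_def e_def exp_add[symmetric] by simp
  qed
  have Xt: "fake t p = fake 1 p * e (B t (fst p) - B 1 (fst p))" for p
  proof -
    obtain \<omega> h v \<omega>' where p': "p = (\<omega>, (h, v), \<omega>')" by (cases p) auto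
    show ?thesis using t stoch_exp_pos[of 1 \<omega>] by (simp add: p' fake_one Et)
  qed
  have [measurable]: "fake t \<in> borel_measurable base" "fake 1 \<in> borel_measurable base" "rot_tanh 1 \<in> borel_measurable base" using t by auto
  have "(\<integral>\<^sup>+p. f (fake t p) \<partial>fake_measure)
    = (\<integral>\<^sup>+\<theta>. \<integral>\<^sup>+\<omega>'. \<integral>\<^sup>+\<omega>. f (fake 1 (\<omega>, \<theta>, \<omega>') * e (B t \<omega> - B 1 \<omega>)) * ennreal (weight \<omega> \<theta> * (1 + - 1 * rot_tanh 1 (\<omega>, \<theta>, \<omega>'))) \<partial>M \<partial>M \<partial>(U01 \<Otimes>\<^sub>M U01))"
    by (subst nn_integral_fake_measure, measurable, subst nn_integral_base_B, measurable, simp only: Xt fst_conv snd_conv)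
  also have "\<dots> = (\<integral>\<^sup>+\<theta>. \<integral>\<^sup>+\<omega>'. \<integral>\<^sup>+\<omega>. f' (fake 1 (\<omega>, \<theta>, \<omega>')) * ennreal (weight \<omega> \<theta> * (1 + - 1 * rot_tanh 1 (\<omega>, \<theta>, \<omega>'))) \<partial>M \<partial>M \<partial>(U01 \<Otimes>\<^sub>M U01))"
  proof (rule nn_integral_cong, rule nn_integral_cong)
    fix \<theta> :: "real \<times> real" and \<omega>' :: 'a
    have m[measurable]: "(\<lambda>\<omega>. fake 1 (\<omega>, \<theta>, \<omega>')) \<in> borel_measurable (F 1)" "(\<lambda>\<omega>. rot_tanh 1 (\<omega>, \<theta>, \<omega>')) \<in> borel_measurable (F 1)"
      "(\<lambda>\<omega>. weight \<omega> \<theta>) \<in> borel_measurable (F 1)"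
      by (auto intro!: fake_section1 rot_tanh_section1 weight_section1)
    let ?d = "\<lambda>\<omega>. ennreal (weight \<omega> \<theta> * (1 + - 1 * rot_tanh 1 (\<omega>, \<theta>, \<omega>')))"
    have "(\<integral>\<^sup>+\<omega>. f (fake 1 (\<omega>, \<theta>, \<omega>') * e (B t \<omega> - B 1 \<omega>)) * ?d \<omega> \<partial>M)
      = (\<integral>\<^sup>+\<omega>. (\<lambda>(\<omega>, d). f (fake 1 (\<omega>, \<theta>, \<omega>') * e d) * ?d \<omega>) (\<omega>, B t \<omega> - B 1 \<omega>) \<partial>M)" by simp
    also have "\<dots> = (\<integral>\<^sup>+\<omega>. \<integral>\<^sup>+d. (\<lambda>(\<omega>, d). f (fake 1 (\<omega>, \<theta>, \<omega>') * e d) * ?d \<omega>) (\<omega>, d) \<partial>gauss (t - 1) \<partial>M)"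
      by (rule nn_integral_increment) (use t in auto)
    also have "\<dots> = (\<integral>\<^sup>+\<omega>. f' (fake 1 (\<omega>, \<theta>, \<omega>')) * ?d \<omega> \<partial>M)"
      unfolding f'_def prod.case by (intro nn_integral_cong nn_integral_multc) measurable
    finally show "(\<integral>\<^sup>+\<omega>. f (fake 1 (\<omega>, \<theta>, \<omega>') * e (B t \<omega> - B 1 \<omega>)) * ?d \<omega> \<partial>M) = (\<integral>\<^sup>+\<omega>. f' (fake 1 (\<omega>, \<theta>, \<omega>')) * ?d \<omega> \<partial>M)" .
  qed
  also have "\<dots> = (\<integral>\<^sup>+p. f' (fake 1 p) \<partial>fake_measure)"
    by (subst nn_integral_fake_measure, simp, subst nn_integral_base_B) auto
  also have "\<dots> = (\<integral>\<^sup>+\<omega>. f' (stoch_exp 1 \<omega>) \<partial>M)" by (rule marginal_middle) auto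
  also have "\<dots> = (\<integral>\<^sup>+\<omega>. f (stoch_exp t \<omega>) \<partial>M)"
  proof -
    note [measurable] = stoch_exp_measurable_F[of 1 1, simplified]
    have "(\<integral>\<^sup>+\<omega>. f (stoch_exp t \<omega>) \<partial>M) = (\<integral>\<^sup>+\<omega>. (\<lambda>(\<omega>, d). f (stoch_exp 1 \<omega> * e d)) (\<omega>, B t \<omega> - B 1 \<omega>) \<partial>M)"
      by (simp add: Et)
    also have "\<dots> = (\<integral>\<^sup>+\<omega>. \<integral>\<^sup>+d. (\<lambda>(\<omega>, d). f (stoch_exp 1 \<omega> * e d)) (\<omega>, d) \<partial>gauss (t - 1) \<partial>M)"
      by (rule nn_integral_increment) (use t in auto)
    finally show ?thesis by (simp add: f'_def)
  qed
  finally show ?thesis .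
qed

lemma marginal:
  assumes t: "0 \<le> t" and f[measurable]: "f \<in> borel_measurable borel"
  shows "(\<integral>\<^sup>+p. f (fake t p) \<partial>fake_measure) = (\<integral>\<^sup>+\<omega>. f (stoch_exp t \<omega>) \<partial>M)"
proof -
  consider "t \<le> 1/2" | "1/2 \<le> t" "t \<le> 1" | "1 < t" by linarith
  then show ?thesis
  proof cases
    case 1
    then show ?thesis
      using nn_integral_fake_measure_initial[of "\<lambda>\<omega>. f (stoch_exp t \<omega>)"] stoch_exp_measurable[OF t] by (simp add: fake_def)
  qed (auto intro: marginal_middle marginal_final)
qed

lemma distr_fake:
  assumes t: "0 \<le> t" shows "distr fake_measure borel (fake t) = distr M borel (stoch_exp t)"
proof (rule measure_eqI)
  fix A assume "A \<in> sets (distr fake_measure borel (fake t))"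
  then have [measurable]: "A \<in> sets borel" by simp
  have XQ: "fake t \<in> borel_measurable fake_measure" using fake_measurable[OF t] by (simp add: measurable_fake_measure)
  have "emeasure (distr fake_measure borel (fake t)) A = (\<integral>\<^sup>+p. indicator A (fake t p) \<partial>fake_measure)"
    by (subst nn_integral_indicator[symmetric], simp, rule nn_integral_distr[OF XQ], simp)
  also have "\<dots> = (\<integral>\<^sup>+\<omega>. indicator A (stoch_exp t \<omega>) \<partial>M)" by (rule marginal[OF t]) simp
  also have "\<dots> = emeasure (distr M borel (stoch_exp t)) A"
    by (subst nn_integral_indicator[symmetric], simp, rule nn_integral_distr[symmetric, OF stoch_exp_measurable[OF t]], simp)
  finally show "emeasure (distr fake_measure borel (fake t)) A = emeasure (distr M borel (stoch_exp t)) A" .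
qed simp

end

section \<open>Difference of the process laws\<close>

text \<open>Since \<open>cos (2 * pi * v)\<close> is \<open>2 * cos (pi * v) ^ 2 - 1\<close>, the
  integral combines the cosine moments 1, 0, 1/2, 0, 3/8 of orders 0 to 4. The term with
  \<open>e\<close> is the effect of the tilt on the second moment.\<close>

lemma nn_integral_U01_square:
  assumes e: "\<bar>e\<bar> \<le> 1" and K: "0 \<le> K"
  shows "(\<integral>\<^sup>+v. ennreal ((1 + e * cos (2 * pi * v)) * (K * (a + b * cos (pi * v))\<^sup>2)) \<partial>U01)
    = ennreal (K * (a\<^sup>2 + b\<^sup>2 / 2 + e * (b\<^sup>2 / 4)))"
proof -
  interpret U: prob_space U01 by (rule prob_space_U01)
  have i: "integrable U01 (\<lambda>v. cos (pi * v) ^ k)" for k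
    by (rule U.integrable_const_bound[where B = 1])
       (auto simp: power_abs power_le_one intro!: measurable_restrict_space1)
  have ma2: "cos_moment 2 = 1 / 2" using cos_moment_rec[of 0] cos_moment_0 by (simp add: numeral_2_eq_2)
  have ma3: "cos_moment 3 = 0" using cos_moment_odd[of 1] by (simp add: numeral_3_eq_3)
  have ma4: "cos_moment 4 = 3 / 8" using cos_moment_rec[of 2] ma2 by simp
  have nn: "0 \<le> 1 + e * cos x" for x
  proof -
    have "\<bar>e * cos x\<bar> \<le> 1 * 1" unfolding abs_mult using e by (intro mult_mono) auto
    then show ?thesis by linarith
  qed
  let ?p = "\<lambda>v. K * (((1 - e) * a\<^sup>2) * cos (pi * v) ^ 0 + (2 * a * b * (1 - e)) * cos (pi * v) ^ 1
     + ((1 - e) * b\<^sup>2 + 2 * e * a\<^sup>2) * cos (pi * v) ^ 2 + (4 * a * b * e) * cos (pi * v) ^ 3 + (2 * e * b\<^sup>2) * cos (pi * v) ^ 4)"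
  have eq: "(1 + e * cos (2 * pi * v)) * (K * (a + b * cos (pi * v))\<^sup>2) = ?p v" for v
  proof -
    have "cos (2 * pi * v) = 2 * (cos (pi * v))\<^sup>2 - 1"
      using cos_double_cos[of "pi * v"] by (simp add: mult.assoc)
    then show ?thesis by (simp only:) (simp add: power2_eq_square power3_eq_cube power4_eq_xxxx algebra_simps)
  qed
  have ip: "integrable U01 ?p" by (intro integrable_mult_right Bochner_Integration.integrable_add i)
  have p0: "0 \<le> ?p v" for v
    unfolding eq[symmetric] using nn K by (intro mult_nonneg_nonneg) auto
  have "(\<integral>\<^sup>+v. ennreal ((1 + e * cos (2 * pi * v)) * (K * (a + b * cos (pi * v))\<^sup>2)) \<partial>U01)
    = (\<integral>\<^sup>+v. ennreal (?p v) \<partial>U01)" by (simp only: eq)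
  also have "\<dots> = ennreal (\<integral>v. ?p v \<partial>U01)"
    by (rule nn_integral_eq_integral[OF ip]) (rule AE_I2, rule p0)
  also have "(\<integral>v. ?p v \<partial>U01) = K * (((1 - e) * a\<^sup>2) * cos_moment 0 + (2 * a * b * (1 - e)) * cos_moment 1
     + ((1 - e) * b\<^sup>2 + 2 * e * a\<^sup>2) * cos_moment 2 + (4 * a * b * e) * cos_moment 3 + (2 * e * b\<^sup>2) * cos_moment 4)"
    unfolding cos_moment_def
    by (simp only: integral_mult_right_zero Bochner_Integration.integral_add
        Bochner_Integration.integrable_add integrable_mult_right i)
  also have "\<dots> = K * (a\<^sup>2 + b\<^sup>2 / 2 + e * (b\<^sup>2 / 4))"
    unfolding cos_moment_0 cos_moment_1 ma2 ma3 ma4 by (simp add: field_simps)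
  finally show ?thesis .
qed

text \<open>The change of variable \<open>z = (x - 1) / (x + 1)\<close> and the density \<open>1 - z\<close> of the
  change of measure turn this function into \<open>z\<^sup>2\<close>.\<close>

definition test_fun :: "real \<Rightarrow> real" where
  "test_fun x = ((x - 1) / (x + 1))\<^sup>2 / (1 - (x - 1) / (x + 1))"

lemma test_fun_measurable[measurable]: "test_fun \<in> borel_measurable borel"
  unfolding test_fun_def by measurable

lemma test_fun_moebius: "\<bar>z\<bar> < 1 \<Longrightarrow> test_fun ((1 + z) / (1 - z)) = z\<^sup>2 / (1 - z)"
proof -
  assume z: "\<bar>z\<bar> < 1"
  then have "((1 + z) / (1 - z) - 1) / ((1 + z) / (1 - z) + 1) = z"
    by (simp add: field_simps)
  then show ?thesis by (simp add: test_fun_def)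
qed

text \<open>In the variable \<open>z\<close> the denominator is \<open>2 / (x + 1)\<close> and
  \<open>z^2\<close> is at most 1. Linear growth makes the test integrals finite.\<close>

lemma test_fun_bounds: assumes "0 < x" shows "0 \<le> test_fun x" "test_fun x \<le> (1 + x) / 2"
proof -
  have e: "1 - (x - 1) / (x + 1) = 2 / (x + 1)" using assms by (simp add: field_simps)
  have "((x - 1) / (x + 1))\<^sup>2 \<le> 1"
  proof -
    have "\<bar>(x - 1) / (x + 1)\<bar> \<le> 1" using assms by (auto simp: abs_le_iff divide_le_eq le_divide_eq)
    then show ?thesis by (simp only: abs_square_le_1)
  qed
  then have "((x - 1) / (x + 1))\<^sup>2 / (2 / (x + 1)) \<le> 1 / (2 / (x + 1))"
    using assms by (intro divide_right_mono) auto
  then show "test_fun x \<le> (1 + x) / 2" unfolding test_fun_def e using assms by (simp add: add.commute)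
  show "0 \<le> test_fun x" unfolding test_fun_def e using assms by simp
qed

context continuous_bm
begin

text \<open>Integrating out the increment over \<open>[1/2, 1]\<close> leaves a function of
  \<open>start\<close>, which is unaffected by the exchange that reverses the sign.\<close>

lemma swap_symmetry_stoch_exp:
  "(\<integral>\<^sup>+\<omega>. ennreal (test_fun (stoch_exp 1 \<omega>)) * ennreal (1 + 1 * swap_sign \<omega>) \<partial>M)
    = (\<integral>\<^sup>+\<omega>. ennreal (test_fun (stoch_exp 1 \<omega>)) * ennreal (1 + - 1 * swap_sign \<omega>) \<partial>M)"
proof -
  interpret G: prob_space "gauss (1 - 1/2)" by (intro prob_space_gauss) simp
  define H where "H u = (\<integral>\<^sup>+d. ennreal (test_fun (exp (2 * u - 1/4 + d))) \<partial>gauss (1 - 1/2))" for u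
  have [measurable]: "H \<in> borel_measurable borel" unfolding H_def by measurable
  note [measurable] = start_measurable[of "1/2", simplified] swap_sign_measurable[of "1/2", simplified]
  have step: "(\<integral>\<^sup>+\<omega>. ennreal (test_fun (stoch_exp 1 \<omega>)) * ennreal (1 + \<sigma> * swap_sign \<omega>) \<partial>M)
    = (\<integral>\<^sup>+\<omega>. H (start \<omega>) * ennreal (1 + \<sigma> * swap_sign \<omega>) \<partial>M)" for \<sigma>
  proof -
    let ?g = "\<lambda>(\<omega>, d). ennreal (test_fun (exp (2 * start \<omega> - 1/4 + d))) * ennreal (1 + \<sigma> * swap_sign \<omega>)"
    have e: "B 1 \<omega> - 1 / 2 = 2 * start \<omega> - 1/4 + (B 1 \<omega> - B (1/2) \<omega>)" for \<omega>
      unfolding start_def by (simp add: field_simps)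
    have "(\<integral>\<^sup>+\<omega>. ennreal (test_fun (stoch_exp 1 \<omega>)) * ennreal (1 + \<sigma> * swap_sign \<omega>) \<partial>M)
      = (\<integral>\<^sup>+\<omega>. ?g (\<omega>, B 1 \<omega> - B (1/2) \<omega>) \<partial>M)" by (simp only: stoch_exp_def e prod.case)
    also have "\<dots> = (\<integral>\<^sup>+\<omega>. \<integral>\<^sup>+d. ?g (\<omega>, d) \<partial>gauss (1 - 1/2) \<partial>M)"
      by (rule nn_integral_increment) auto
    also have "\<dots> = (\<integral>\<^sup>+\<omega>. H (start \<omega>) * ennreal (1 + \<sigma> * swap_sign \<omega>) \<partial>M)"
      unfolding H_def prod.case by (intro nn_integral_cong nn_integral_multc) measurable
    finally show ?thesis .
  qed
  show ?thesis
    unfolding step using swap_sign_swap[of "\<lambda>x u. H u * ennreal (1 + 1 * x)"] by simp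
qed

lemma expectation_test_fun_finite:
  "(\<integral>\<^sup>+\<omega>. ennreal (test_fun (stoch_exp 1 \<omega>)) * ennreal (1 + - 1 * swap_sign \<omega>) \<partial>M) < \<infinity>"
proof -
  have [measurable]: "stoch_exp 1 \<in> borel_measurable M" by (rule stoch_exp_measurable) simp
  have 1: "(\<integral>\<^sup>+\<omega>. ennreal (stoch_exp 1 \<omega>) \<partial>M) = 1"
  proof -
    have "(\<integral>\<^sup>+\<omega>. ennreal (stoch_exp 1 \<omega>) \<partial>M) = (\<integral>\<^sup>+\<omega>. ennreal (stoch_exp 0 \<omega>) \<partial>M)"
      using exp_martingale[of 0 1 "\<lambda>_. 1"] by simp
    also have "\<dots> = (\<integral>\<^sup>+\<omega>. 1 \<partial>M)" by (rule nn_integral_cong) (simp add: stoch_exp_0)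
    finally show ?thesis by (simp add: emeasure_space_1)
  qed
  have "(\<integral>\<^sup>+\<omega>. ennreal (test_fun (stoch_exp 1 \<omega>)) * ennreal (1 + - 1 * swap_sign \<omega>) \<partial>M) \<le> (\<integral>\<^sup>+\<omega>. 1 + ennreal (stoch_exp 1 \<omega>) \<partial>M)"
  proof (rule nn_integral_mono)
    fix \<omega>
    have "test_fun (stoch_exp 1 \<omega>) * (1 + - 1 * swap_sign \<omega>) \<le> (1 + stoch_exp 1 \<omega>) / 2 * 2"
      using test_fun_bounds[OF stoch_exp_pos[of 1 \<omega>]] swap_sign_bound[of \<omega>] stoch_exp_pos[of 1 \<omega>]
      by (intro mult_mono) (auto simp: abs_le_iff)
    then have "ennreal (test_fun (stoch_exp 1 \<omega>) * (1 + - 1 * swap_sign \<omega>)) \<le> ennreal (1 + stoch_exp 1 \<omega>)"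
      by (intro ennreal_leI) simp
    then show "ennreal (test_fun (stoch_exp 1 \<omega>)) * ennreal (1 + - 1 * swap_sign \<omega>) \<le> 1 + ennreal (stoch_exp 1 \<omega>)"
      using test_fun_bounds(1)[OF stoch_exp_pos[of 1 \<omega>]] stoch_exp_pos[of 1 \<omega>]
      by (simp add: ennreal_mult' ennreal_plus less_imp_le)
  qed
  also have "\<dots> = 1 + 1" by (subst nn_integral_add) (auto simp: 1 emeasure_space_1)
  finally show ?thesis by (auto simp: less_top[symmetric] top_unique)
qed

text \<open>With \<open>sin_coeff\<close>, the coefficients of \<open>Z\<close> at time 1 as an
  affine function of \<open>cos (pi * v)\<close>: the contributions of the first and of the second
  coordinate of the rotated point.\<close>

definition cos_coeff :: "real \<Rightarrow> 'a \<Rightarrow> 'a \<Rightarrow> real" where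
  "cos_coeff h \<omega>' \<omega> = tanh (radius_quantile 1 h) * (start_ratio \<omega> h * cos (B (rot_time 1 h) \<omega>'))"

definition sin_coeff :: "real \<Rightarrow> 'a \<Rightarrow> 'a \<Rightarrow> real" where
  "sin_coeff h \<omega>' \<omega> = tanh (radius_quantile 1 h) * (sqrt (1 - (start_ratio \<omega> h)\<^sup>2) * sin (B (rot_time 1 h) \<omega>'))"

lemma rot_tanh_one: "rot_tanh 1 (\<omega>, (h, v), \<omega>') = cos_coeff h \<omega>' \<omega> + sin_coeff h \<omega>' \<omega> * cos (pi * v)"
  by (simp add: rot_tanh_def rot_def cos_coeff_def sin_coeff_def algebra_simps)

lemma radial_measurable:
  assumes h[measurable]: "hc \<in> borel_measurable L" and w[measurable]: "wc \<in> measurable L M" "oc \<in> measurable L M"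
  shows "(\<lambda>x. cos_coeff (hc x) (wc x) (oc x)) \<in> borel_measurable L" "(\<lambda>x. sin_coeff (hc x) (wc x) (oc x)) \<in> borel_measurable L"
    "(\<lambda>x. start_weight (hc x) (start (oc x))) \<in> borel_measurable L"
proof -
  have [measurable]: "radius_quantile 1 \<in> borel_measurable borel" "radius_quantile (1/2) \<in> borel_measurable borel" "rot_time 1 \<in> borel_measurable borel"
    by (auto intro!: radius_quantile_measurable rot_time_measurable)
  have [measurable]: "(\<lambda>x. B (rot_time 1 (hc x)) (wc x)) \<in> borel_measurable L"
    by (rule B_time_measurable[OF _ w(1)]) (auto intro!: rot_time_nonneg)
  show "(\<lambda>x. cos_coeff (hc x) (wc x) (oc x)) \<in> borel_measurable L" "(\<lambda>x. sin_coeff (hc x) (wc x) (oc x)) \<in> borel_measurable L"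
    unfolding cos_coeff_def sin_coeff_def start_ratio_def by measurable
  have "(\<lambda>x. start_weight (hc x) (start (oc x))) = (\<lambda>x. indicator {0<..} (radius_quantile (1/2) (hc x) - \<bar>start (oc x)\<bar>)
      / (2 * tanh (radius_quantile (1/2) (hc x)) * (cosh (start (oc x)))\<^sup>2 * start_density (start (oc x))))"
    by (auto simp: start_weight_def indicator_def fun_eq_iff)
  then show "(\<lambda>x. start_weight (hc x) (start (oc x))) \<in> borel_measurable L" by simp
qed

text \<open>The test function cancels the density and leaves \<open>Z\<close> squared. The first
  path is averaged at a fixed angle, so that only the square of the sign survives; then the angle is
  moved innermost and integrated out.\<close>

lemma nn_integral_fake_measure_test_fun:
  assumes \<sigma>: "\<bar>\<sigma>\<bar> \<le> 1"
  shows "(\<integral>\<^sup>+p. ennreal (test_fun (fake 1 p)) * ennreal (1 + \<sigma> * swap_sign (fst p)) \<partial>fake_measure)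
    = (\<integral>\<^sup>+h. \<integral>\<^sup>+\<omega>'. \<integral>\<^sup>+\<omega>. ennreal (start_weight h (start \<omega>) *
        ((cos_coeff h \<omega>' \<omega>)\<^sup>2 + (sin_coeff h \<omega>' \<omega>)\<^sup>2 / 2 + (\<sigma> * (swap_sign \<omega>)\<^sup>2) * ((sin_coeff h \<omega>' \<omega>)\<^sup>2 / 4))) \<partial>M \<partial>M \<partial>U01)"
proof -
  interpret U: prob_space U01 by (rule prob_space_U01)
  interpret P: pair_sigma_finite U01 M ..
  have [measurable]: "fake 1 \<in> borel_measurable base" "rot_tanh 1 \<in> borel_measurable base" by auto
  have [measurable]: "(\<lambda>p. swap_sign (fst p)) \<in> borel_measurable base"
    using measurable_compose[OF coordinates_measurable(3) swap_sign_measurable_M] by (simp add: first_path_def)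
  have nn: "0 \<le> 1 + \<sigma> * swap_sign \<omega>" for \<omega>
  proof -
    have "\<bar>\<sigma> * swap_sign \<omega>\<bar> \<le> 1 * 1" unfolding abs_mult using \<sigma> swap_sign_bound by (intro mult_mono) auto
    then show ?thesis by linarith
  qed
  let ?Z = "\<lambda>h \<omega>' u v. tanh (radius_quantile 1 h) * rot (B (rot_time 1 h) \<omega>') (tanh u / tanh (radius_quantile (1/2) h)) v"
  have rot_tanh: "rot_tanh 1 (\<omega>, (h, v), \<omega>') = ?Z h \<omega>' (start \<omega>) v" for \<omega> h v \<omega>' by (simp add: rot_tanh_def start_ratio_def)
  have "(\<integral>\<^sup>+p. ennreal (test_fun (fake 1 p)) * ennreal (1 + \<sigma> * swap_sign (fst p)) \<partial>fake_measure)
    = (\<integral>\<^sup>+p. ennreal (weight (fst p) (fst (snd p)) * (rot_tanh 1 p)\<^sup>2 * (1 + \<sigma> * swap_sign (fst p))) \<partial>base)"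
  proof (subst nn_integral_fake_measure, measurable, rule nn_integral_cong)
    fix p assume p: "p \<in> space base"
    obtain \<omega> h v \<omega>' where p': "p = (\<omega>, (h, v), \<omega>')" by (cases p) auto
    have \<omega>': "\<omega>' \<in> space M" using p by (auto simp: p' space_base)
    show "ennreal (test_fun (fake 1 p)) * ennreal (1 + \<sigma> * swap_sign (fst p)) * ennreal (weight (fst p) (fst (snd p)) * (1 + - 1 * rot_tanh 1 p))
      = ennreal (weight (fst p) (fst (snd p)) * (rot_tanh 1 p)\<^sup>2 * (1 + \<sigma> * swap_sign (fst p)))"
    proof (cases "weight \<omega> (h, v) = 0")
      case False
      have z: "\<bar>rot_tanh 1 p\<bar> < 1"
        unfolding p' by (rule rot_tanh_abs[OF weight_nonzeroD[OF False]]) auto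
      have X: "test_fun (fake 1 p) = (rot_tanh 1 p)\<^sup>2 / (1 - rot_tanh 1 p)"
        unfolding p' using test_fun_moebius[OF z] fake_half[OF \<omega>', of 1 \<omega> h v] by (simp add: p')
      have c: "0 \<le> weight (fst p) (fst (snd p)) * (1 + - 1 * rot_tanh 1 p)" using z weight_nonneg by (auto simp: abs_less_iff)
      have t: "0 \<le> (rot_tanh 1 p)\<^sup>2 / (1 - rot_tanh 1 p)" using z by (auto simp: abs_less_iff)
      have "ennreal (test_fun (fake 1 p)) * ennreal (1 + \<sigma> * swap_sign (fst p)) * ennreal (weight (fst p) (fst (snd p)) * (1 + - 1 * rot_tanh 1 p))
        = ennreal ((rot_tanh 1 p)\<^sup>2 / (1 - rot_tanh 1 p) * (1 + \<sigma> * swap_sign (fst p)) * (weight (fst p) (fst (snd p)) * (1 + - 1 * rot_tanh 1 p)))"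
        unfolding X by (simp only: ennreal_mult'[OF t] ennreal_mult'[OF mult_nonneg_nonneg[OF t nn]])
      also have "(rot_tanh 1 p)\<^sup>2 / (1 - rot_tanh 1 p) * (1 + \<sigma> * swap_sign (fst p)) * (weight (fst p) (fst (snd p)) * (1 + - 1 * rot_tanh 1 p))
         = weight (fst p) (fst (snd p)) * (rot_tanh 1 p)\<^sup>2 * (1 + \<sigma> * swap_sign (fst p))"
        using z by (simp add: field_simps abs_less_iff)
      finally show ?thesis .
    qed (simp add: p')
  qed
  also have "\<dots> = (\<integral>\<^sup>+h. \<integral>\<^sup>+\<omega>'. \<integral>\<^sup>+v. \<integral>\<^sup>+\<omega>. ennreal (weight \<omega> (h, v) * (rot_tanh 1 (\<omega>, (h, v), \<omega>'))\<^sup>2 * (1 + \<sigma> * swap_sign \<omega>)) \<partial>M \<partial>U01 \<partial>M \<partial>U01)"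
    by (subst nn_integral_base_C) auto
  also have "\<dots> = (\<integral>\<^sup>+h. \<integral>\<^sup>+\<omega>'. \<integral>\<^sup>+v. \<integral>\<^sup>+\<omega>. ennreal (1 + (swap_sign \<omega>)\<^sup>2 * (cos (2 * pi * v) * \<sigma>)) * ennreal (start_weight h (start \<omega>) * (?Z h \<omega>' (start \<omega>) v)\<^sup>2) \<partial>M \<partial>U01 \<partial>M \<partial>U01)"
  proof (rule nn_integral_cong, rule nn_integral_cong, rule nn_integral_cong)
    fix h \<omega>' v
    let ?g = "\<lambda>u. ennreal (start_weight h u * (?Z h \<omega>' u v)\<^sup>2)"
    have "(\<integral>\<^sup>+\<omega>. ennreal (weight \<omega> (h, v) * (rot_tanh 1 (\<omega>, (h, v), \<omega>'))\<^sup>2 * (1 + \<sigma> * swap_sign \<omega>)) \<partial>M)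
      = (\<integral>\<^sup>+\<omega>. ennreal ((1 + swap_sign \<omega> * cos (2 * pi * v)) * (1 + swap_sign \<omega> * \<sigma>)) * ?g (start \<omega>) \<partial>M)"
    proof (rule nn_integral_cong)
      fix \<omega>
      have "0 \<le> (1 + swap_sign \<omega> * cos (2 * pi * v)) * (1 + swap_sign \<omega> * \<sigma>)"
        using one_plus_swap_sign[of \<omega> "2 * pi * v"] nn[of \<omega>] by (intro mult_nonneg_nonneg) (simp_all only: mult.commute)
      then show "ennreal (weight \<omega> (h, v) * (rot_tanh 1 (\<omega>, (h, v), \<omega>'))\<^sup>2 * (1 + \<sigma> * swap_sign \<omega>))
        = ennreal ((1 + swap_sign \<omega> * cos (2 * pi * v)) * (1 + swap_sign \<omega> * \<sigma>)) * ?g (start \<omega>)"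
        by (simp only: ennreal_mult'[symmetric] weight_eq rot_tanh) (simp add: mult_ac)
    qed
    also have "\<dots> = (\<integral>\<^sup>+\<omega>. ennreal (1 + (swap_sign \<omega>)\<^sup>2 * (cos (2 * pi * v) * \<sigma>)) * ?g (start \<omega>) \<partial>M)"
      by (rule swap_sign_average) (use \<sigma> in auto)
    finally show "(\<integral>\<^sup>+\<omega>. ennreal (weight \<omega> (h, v) * (rot_tanh 1 (\<omega>, (h, v), \<omega>'))\<^sup>2 * (1 + \<sigma> * swap_sign \<omega>)) \<partial>M)
      = (\<integral>\<^sup>+\<omega>. ennreal (1 + (swap_sign \<omega>)\<^sup>2 * (cos (2 * pi * v) * \<sigma>)) * ?g (start \<omega>) \<partial>M)" .
  qed
  also have "\<dots> = (\<integral>\<^sup>+h. \<integral>\<^sup>+\<omega>'. \<integral>\<^sup>+\<omega>. \<integral>\<^sup>+v. ennreal (1 + (swap_sign \<omega>)\<^sup>2 * (cos (2 * pi * v) * \<sigma>)) * ennreal (start_weight h (start \<omega>) * (?Z h \<omega>' (start \<omega>) v)\<^sup>2) \<partial>U01 \<partial>M \<partial>M \<partial>U01)"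
  proof (rule nn_integral_cong, rule nn_integral_cong, rule P.Fubini'[symmetric])
    fix h \<omega>'
    have v: "(\<lambda>p. fst p) \<in> borel_measurable (U01 \<Otimes>\<^sub>M M)" by (rule measurable_compose[OF measurable_fst id_U01])
    have w: "(\<lambda>p. snd p) \<in> measurable (U01 \<Otimes>\<^sub>M M) M" by simp
    have [measurable]: "(\<lambda>p. swap_sign (snd p)) \<in> borel_measurable (U01 \<Otimes>\<^sub>M M)" "(\<lambda>p. start (snd p)) \<in> borel_measurable (U01 \<Otimes>\<^sub>M M)"
      by (rule measurable_compose[OF w swap_sign_measurable_M], rule measurable_compose[OF w start_measurable_M])
    note [measurable] = v
    show "(\<lambda>(v, \<omega>). ennreal (1 + (swap_sign \<omega>)\<^sup>2 * (cos (2 * pi * v) * \<sigma>)) * ennreal (start_weight h (start \<omega>) * (?Z h \<omega>' (start \<omega>) v)\<^sup>2)) \<in> borel_measurable (U01 \<Otimes>\<^sub>M M)"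
      unfolding split_beta' by measurable
  qed
  also have "\<dots> = (\<integral>\<^sup>+h. \<integral>\<^sup>+\<omega>'. \<integral>\<^sup>+\<omega>. ennreal (start_weight h (start \<omega>) *
        ((cos_coeff h \<omega>' \<omega>)\<^sup>2 + (sin_coeff h \<omega>' \<omega>)\<^sup>2 / 2 + (\<sigma> * (swap_sign \<omega>)\<^sup>2) * ((sin_coeff h \<omega>' \<omega>)\<^sup>2 / 4))) \<partial>M \<partial>M \<partial>U01)"
  proof (intro nn_integral_cong)
    fix h \<omega>' \<omega>
    have e: "\<bar>\<sigma> * (swap_sign \<omega>)\<^sup>2\<bar> \<le> 1"
    proof -
      have "\<bar>\<sigma>\<bar> * (swap_sign \<omega>)\<^sup>2 \<le> 1 * 1" using \<sigma> swap_sign_bound[of \<omega>] by (intro mult_mono) (auto simp: abs_square_le_1)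
      then show ?thesis by (simp add: abs_mult)
    qed
    have "(\<integral>\<^sup>+v. ennreal (1 + (swap_sign \<omega>)\<^sup>2 * (cos (2 * pi * v) * \<sigma>)) * ennreal (start_weight h (start \<omega>) * (?Z h \<omega>' (start \<omega>) v)\<^sup>2) \<partial>U01)
      = (\<integral>\<^sup>+v. ennreal ((1 + (\<sigma> * (swap_sign \<omega>)\<^sup>2) * cos (2 * pi * v)) * (start_weight h (start \<omega>) * (cos_coeff h \<omega>' \<omega> + sin_coeff h \<omega>' \<omega> * cos (pi * v))\<^sup>2)) \<partial>U01)"
    proof (rule nn_integral_cong)
      fix v
      have z: "?Z h \<omega>' (start \<omega>) v = cos_coeff h \<omega>' \<omega> + sin_coeff h \<omega>' \<omega> * cos (pi * v)"
        using rot_tanh[of \<omega> h v \<omega>'] rot_tanh_one[of \<omega> h v \<omega>'] by simp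
      have "0 \<le> start_weight h (start \<omega>) * (cos_coeff h \<omega>' \<omega> + sin_coeff h \<omega>' \<omega> * cos (pi * v))\<^sup>2" using start_weight_nonneg by simp
      note m = ennreal_mult''[OF this]
      have k: "1 + (swap_sign \<omega>)\<^sup>2 * (cos (2 * pi * v) * \<sigma>) = 1 + (\<sigma> * (swap_sign \<omega>)\<^sup>2) * cos (2 * pi * v)" by simp
      show "ennreal (1 + (swap_sign \<omega>)\<^sup>2 * (cos (2 * pi * v) * \<sigma>)) * ennreal (start_weight h (start \<omega>) * (?Z h \<omega>' (start \<omega>) v)\<^sup>2)
        = ennreal ((1 + (\<sigma> * (swap_sign \<omega>)\<^sup>2) * cos (2 * pi * v)) * (start_weight h (start \<omega>) * (cos_coeff h \<omega>' \<omega> + sin_coeff h \<omega>' \<omega> * cos (pi * v))\<^sup>2))"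
        by (simp only: z k m)
    qed
    also have "\<dots> = ennreal (start_weight h (start \<omega>) *
        ((cos_coeff h \<omega>' \<omega>)\<^sup>2 + (sin_coeff h \<omega>' \<omega>)\<^sup>2 / 2 + (\<sigma> * (swap_sign \<omega>)\<^sup>2) * ((sin_coeff h \<omega>' \<omega>)\<^sup>2 / 4)))"
      by (rule nn_integral_U01_square[OF e start_weight_nonneg])
    finally show "(\<integral>\<^sup>+v. ennreal (1 + (swap_sign \<omega>)\<^sup>2 * (cos (2 * pi * v) * \<sigma>)) * ennreal (start_weight h (start \<omega>) * (?Z h \<omega>' (start \<omega>) v)\<^sup>2) \<partial>U01)
      = ennreal (start_weight h (start \<omega>) * ((cos_coeff h \<omega>' \<omega>)\<^sup>2 + (sin_coeff h \<omega>' \<omega>)\<^sup>2 / 2 + (\<sigma> * (swap_sign \<omega>)\<^sup>2) * ((sin_coeff h \<omega>' \<omega>)\<^sup>2 / 4)))" .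
  qed
  finally show ?thesis .
qed

end

section \<open>Strict positivity of the term caused by the sign\<close>

lemma gauss_interval_pos:
  assumes v: "0 < v" and lr: "l < r" shows "emeasure (gauss v) {l<..<r} \<noteq> 0"
proof
  assume "emeasure (gauss v) {l<..<r} = 0"
  then have "(\<integral>\<^sup>+x. ennreal (normal_density 0 (sqrt v) x) * indicator {l<..<r} x \<partial>lborel) = 0"
    by (simp add: emeasure_density)
  then have "AE x in lborel. ennreal (normal_density 0 (sqrt v) x) * indicator {l<..<r} x = 0"
    by (subst (asm) nn_integral_0_iff_AE) auto
  moreover have "ennreal (normal_density 0 (sqrt v) x) \<noteq> 0" for x
    using normal_density_pos[of "sqrt v" 0 x] v by (simp add: ennreal_eq_0_iff not_le)
  ultimately have "AE x in lborel. x \<notin> {l<..<r}"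
    by (auto simp: indicator_def elim!: eventually_mono)
  then have "{l<..<r} \<in> null_sets lborel" by (subst AE_iff_null_sets) auto
  then show False using lr by (auto dest: null_setsD1)
qed

lemma (in prob_space) AE_obtain:
  assumes "AE x in M. P x" shows "\<exists>x\<in>space M. P x"
proof (rule ccontr)
  assume neg: "\<not> (\<exists>x\<in>space M. P x)"
  from assms AE_space have "AE x in M. False"
  proof eventually_elim
    case (elim x)
    then show ?case using neg by blast
  qed
  then show False by simp
qed

lemma AE_gauss_sin_nonzero: "AE x in gauss v. sin x \<noteq> 0"
proof -
  have "countable {x :: real. sin x = 0}"
  proof -
    have "{x :: real. sin x = 0} \<subseteq> (\<lambda>i :: int. of_int i * pi) ` UNIV"
      by (auto simp: sin_zero_iff_int2)
    then show ?thesis by (rule countable_subset) simp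
  qed
  then have "AE x in lborel. x \<notin> {x :: real. sin x = 0}"
    by (intro AE_not_in countable_imp_null_set_lborel)
  then show ?thesis by (subst AE_density) (auto elim!: eventually_mono)
qed

context continuous_bm
begin

lemma swap_sign_not_null:
  assumes U: "0 < U" shows "\<not> (AE \<omega> in M. \<bar>start \<omega>\<bar> < U \<longrightarrow> swap_sign \<omega> = 0)"
proof
  assume AE: "AE \<omega> in M. \<bar>start \<omega>\<bar> < U \<longrightarrow> swap_sign \<omega> = 0"
  interpret G: prob_space "gauss (1/4)" by (intro prob_space_gauss) simp
  \<comment> \<open>With the first increment in \<open>?I\<close> and the second in
    \<open>?J\<close>, their sum is within \<open>U\<close> of 1/4, so
    \<open>\<bar>start \<omega>\<bar> < U / 2\<close>, while the sign equals 1.\<close>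
  let ?I = "{1/4<..<1/4 + U}" and ?J = "{- U<..<0 :: real}"
  let ?g = "\<lambda>x y. indicator ?I x * indicator ?J y :: ennreal"
  have "(\<integral>\<^sup>+\<omega>. ?g (B (1/4) \<omega>) (B (2 * (1/4)) \<omega> - B (1/4) \<omega>) \<partial>M) = 0"
  proof (subst nn_integral_0_iff_AE)
    have [measurable]: "B (1/4) \<in> borel_measurable M" "B (2 * (1/4)) \<in> borel_measurable M"
      by (auto intro!: B_measurable)
    show "(\<lambda>\<omega>. ?g (B (1/4) \<omega>) (B (2 * (1/4)) \<omega> - B (1/4) \<omega>)) \<in> borel_measurable M" by measurable
    show "AE \<omega> in M. ?g (B (1/4) \<omega>) (B (2 * (1/4)) \<omega> - B (1/4) \<omega>) = 0"
      using AE
    proof eventually_elim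
      case (elim \<omega>)
      show ?case
      proof (rule ccontr)
        assume "\<not> ?case"
        then have x: "1/4 < B (1/4) \<omega>" "B (1/4) \<omega> < 1/4 + U" and y: "- U < B (1/2) \<omega> - B (1/4) \<omega>" "B (1/2) \<omega> - B (1/4) \<omega> < 0"
          by (auto simp: indicator_def split: if_splits)
        have "\<bar>start \<omega>\<bar> < U" using x y U unfolding start_def by (simp add: abs_less_iff)
        then have "swap_sign \<omega> = 0" using elim by simp
        then show False using x y by (simp add: swap_sign_def)
      qed
    qed
  qed
  moreover have "(\<integral>\<^sup>+\<omega>. ?g (B (1/4) \<omega>) (B (2 * (1/4)) \<omega> - B (1/4) \<omega>) \<partial>M)
    = (\<integral>\<^sup>+x. \<integral>\<^sup>+y. ?g x y \<partial>gauss (1/4) \<partial>gauss (1/4))"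
    by (rule nn_integral_two_increments) auto
  moreover have "\<dots> = emeasure (gauss (1/4)) ?I * emeasure (gauss (1/4)) ?J"
    by (simp add: nn_integral_cmult nn_integral_multc)
  ultimately show False
    using gauss_interval_pos[of "1/4" "1/4" "1/4 + U"] gauss_interval_pos[of "1/4" "- U" 0] U by simp
qed

text \<open>If the integral were 0, one \<open>h\<close> and one second path with nonzero sine could
  be selected, because the clock at time 1 is positive. For these the sign would vanish almost
  surely on an interval of values of \<open>start\<close>, contrary to
  \<open>swap_sign_not_null\<close>.\<close>

lemma rotation_excess_not_null:
  "(\<integral>\<^sup>+h. \<integral>\<^sup>+\<omega>'. \<integral>\<^sup>+\<omega>. ennreal (start_weight h (start \<omega>) * ((swap_sign \<omega>)\<^sup>2 * ((sin_coeff h \<omega>' \<omega>)\<^sup>2 / 2))) \<partial>M \<partial>M \<partial>U01) \<noteq> 0"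
proof
  assume zero: "(\<integral>\<^sup>+h. \<integral>\<^sup>+\<omega>'. \<integral>\<^sup>+\<omega>. ennreal (start_weight h (start \<omega>) * ((swap_sign \<omega>)\<^sup>2 * ((sin_coeff h \<omega>' \<omega>)\<^sup>2 / 2))) \<partial>M \<partial>M \<partial>U01) = 0"
  let ?f = "\<lambda>h \<omega>' \<omega>. ennreal (start_weight h (start \<omega>) * ((swap_sign \<omega>)\<^sup>2 * ((sin_coeff h \<omega>' \<omega>)\<^sup>2 / 2)))"
  interpret U: prob_space U01 by (rule prob_space_U01)
  interpret P: pair_prob_space M M ..
  have m: "(\<lambda>x. ?f (hc x) (wc x) (oc x)) \<in> borel_measurable L"
    if "hc \<in> borel_measurable L" "wc \<in> measurable L M" "oc \<in> measurable L M" for hc wc oc and L :: "'z measure"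
    using radial_measurable[OF that] measurable_compose[OF that(3) swap_sign_measurable_M] by measurable
  have m1: "(\<lambda>(h, \<omega>'). \<integral>\<^sup>+\<omega>. ?f h \<omega>' \<omega> \<partial>M) \<in> borel_measurable (U01 \<Otimes>\<^sub>M M)"
  proof -
    have "(\<lambda>x. ?f (fst (fst x)) (snd (fst x)) (snd x)) \<in> borel_measurable ((U01 \<Otimes>\<^sub>M M) \<Otimes>\<^sub>M M)"
      by (rule m) (auto intro!: measurable_compose[OF _ id_U01, of "\<lambda>x. fst (fst x)"])
    then have "(\<lambda>x. \<integral>\<^sup>+\<omega>. ?f (fst x) (snd x) \<omega> \<partial>M) \<in> borel_measurable (U01 \<Otimes>\<^sub>M M)"
      using borel_measurable_nn_integral_fst[of "\<lambda>x. ?f (fst (fst x)) (snd (fst x)) (snd x)"] by simp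
    then show ?thesis by (simp add: split_beta')
  qed
  have "AE h in U01. (\<integral>\<^sup>+\<omega>'. \<integral>\<^sup>+\<omega>. ?f h \<omega>' \<omega> \<partial>M \<partial>M) = 0"
    using zero borel_measurable_nn_integral_fst[OF m1] by (subst (asm) nn_integral_0_iff_AE) auto
  moreover have "AE h in U01. h \<in> {0<..<1}"
    by (rule AE_I2) (simp add: space_restrict_space)
  ultimately have "AE h in U01. 0 < h \<and> h < 1 \<and> (\<integral>\<^sup>+\<omega>'. \<integral>\<^sup>+\<omega>. ?f h \<omega>' \<omega> \<partial>M \<partial>M) = 0"
    by eventually_elim auto
  then obtain h where h: "0 < h" "h < 1" and hz: "(\<integral>\<^sup>+\<omega>'. \<integral>\<^sup>+\<omega>. ?f h \<omega>' \<omega> \<partial>M \<partial>M) = 0"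
    using U.AE_obtain by blast
  have m2: "(\<lambda>\<omega>'. \<integral>\<^sup>+\<omega>. ?f h \<omega>' \<omega> \<partial>M) \<in> borel_measurable M"
  proof -
    have "(\<lambda>x. ?f h (fst x) (snd x)) \<in> borel_measurable (M \<Otimes>\<^sub>M M)" by (rule m) auto
    then show ?thesis using borel_measurable_nn_integral_fst[of "\<lambda>x. ?f h (fst x) (snd x)"] by simp
  qed
  have "AE \<omega>' in M. (\<integral>\<^sup>+\<omega>. ?f h \<omega>' \<omega> \<partial>M) = 0"
    using hz m2 by (subst (asm) nn_integral_0_iff_AE) auto
  moreover have "AE \<omega>' in M. sin (B (rot_time 1 h) \<omega>') \<noteq> 0"
  proof -
    have "AE x in distr M borel (B (rot_time 1 h)). sin x \<noteq> 0"
      unfolding distr_B[OF rot_time_pos[OF h]] by (rule AE_gauss_sin_nonzero)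
    then show ?thesis using B_measurable[of "rot_time 1 h"] rot_time_pos[OF h] by (subst (asm) AE_distr_iff) auto
  qed
  ultimately have "AE \<omega>' in M. (\<integral>\<^sup>+\<omega>. ?f h \<omega>' \<omega> \<partial>M) = 0 \<and> sin (B (rot_time 1 h) \<omega>') \<noteq> 0"
    by eventually_elim auto
  then obtain \<omega>' where z: "(\<integral>\<^sup>+\<omega>. ?f h \<omega>' \<omega> \<partial>M) = 0" and s: "sin (B (rot_time 1 h) \<omega>') \<noteq> 0" and \<omega>': "\<omega>' \<in> space M"
    using AE_obtain by blast
  have m3: "(\<lambda>\<omega>. ?f h \<omega>' \<omega>) \<in> borel_measurable M" by (rule m) (use \<omega>' in auto)
  have "AE \<omega> in M. ?f h \<omega>' \<omega> = 0"
    using z m3 by (subst (asm) nn_integral_0_iff_AE) auto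
  then have "AE \<omega> in M. \<bar>start \<omega>\<bar> < radius_quantile (1/2) h \<longrightarrow> swap_sign \<omega> = 0"
  proof eventually_elim
    case (elim \<omega>)
    show ?case
    proof (rule impI, rule ccontr)
      assume u: "\<bar>start \<omega>\<bar> < radius_quantile (1/2) h" and e: "swap_sign \<omega> \<noteq> 0"
      have k: "0 < start_weight h (start \<omega>)"
        using u start_density_pos[of "start \<omega>"] radius_quantile_pos'[of "1/2" h] cosh_real_pos[of "start \<omega>"] by (simp add: start_weight_def)
      have "\<bar>start_ratio \<omega> h\<bar>\<^sup>2 < 1" using start_ratio_abs[OF u] by (simp only: abs_square_less_1 power2_abs)
      then have "sin_coeff h \<omega>' \<omega> \<noteq> 0" using s radius_quantile_pos'[of 1 h] by (simp add: sin_coeff_def)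
      then have "0 < start_weight h (start \<omega>) * ((swap_sign \<omega>)\<^sup>2 * ((sin_coeff h \<omega>' \<omega>)\<^sup>2 / 2))" using k e by simp
      then show False using elim by (metis ennreal_eq_0_iff not_le)
    qed
  qed
  then show False using swap_sign_not_null[OF radius_quantile_pos'[of "1/2" h]] by simp
qed

text \<open>The two integrals differ by the excess that has just been shown to be nonzero;
  finiteness permits cancellation in the extended reals.\<close>

lemma asymmetry_fake_measure:
  defines "I \<equiv> \<lambda>\<sigma>. (\<integral>\<^sup>+p. ennreal (test_fun (fake 1 p)) * ennreal (1 + \<sigma> * swap_sign (fst p)) \<partial>fake_measure)"
  assumes fin: "I (- 1) < \<infinity>"
  shows "I 1 \<noteq> I (- 1)"
proof -
  interpret U: prob_space U01 by (rule prob_space_U01)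
  let ?t = "\<lambda>\<sigma> h \<omega>' \<omega>. start_weight h (start \<omega>) * ((cos_coeff h \<omega>' \<omega>)\<^sup>2 + (sin_coeff h \<omega>' \<omega>)\<^sup>2 / 2 + (\<sigma> * (swap_sign \<omega>)\<^sup>2) * ((sin_coeff h \<omega>' \<omega>)\<^sup>2 / 4))"
  let ?x = "\<lambda>h \<omega>' \<omega>. start_weight h (start \<omega>) * ((swap_sign \<omega>)\<^sup>2 * ((sin_coeff h \<omega>' \<omega>)\<^sup>2 / 2))"
  let ?X = "\<integral>\<^sup>+h. \<integral>\<^sup>+\<omega>'. \<integral>\<^sup>+\<omega>. ennreal (?x h \<omega>' \<omega>) \<partial>M \<partial>M \<partial>U01"
  let ?R = "U01 \<Otimes>\<^sub>M (M \<Otimes>\<^sub>M M)"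
  have I: "I \<sigma> = (\<integral>\<^sup>+h. \<integral>\<^sup>+\<omega>'. \<integral>\<^sup>+\<omega>. ennreal (?t \<sigma> h \<omega>' \<omega>) \<partial>M \<partial>M \<partial>U01)" if "\<bar>\<sigma>\<bar> \<le> 1" for \<sigma>
    unfolding I_def by (rule nn_integral_fake_measure_test_fun[OF that])
  interpret P: pair_prob_space M M ..
  have hc: "(\<lambda>r. fst r) \<in> borel_measurable ?R"
    by (rule measurable_compose[OF measurable_fst id_U01])
  have wc: "(\<lambda>r. fst (snd r)) \<in> measurable ?R M" "(\<lambda>r. snd (snd r)) \<in> measurable ?R M"
    by measurable
  note [measurable] = radial_measurable[OF hc wc] measurable_compose[OF wc(2) swap_sign_measurable_M]
  \<comment> \<open>Merging the iterated integrals into one over the product makes additivity a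
    single application.\<close>
  have flat: "(\<integral>\<^sup>+h. \<integral>\<^sup>+\<omega>'. \<integral>\<^sup>+\<omega>. f h \<omega>' \<omega> \<partial>M \<partial>M \<partial>U01) = (\<integral>\<^sup>+r. f (fst r) (fst (snd r)) (snd (snd r)) \<partial>?R)"
    if f: "(\<lambda>r. f (fst r) (fst (snd r)) (snd (snd r))) \<in> borel_measurable ?R" for f
  proof -
    have "(\<integral>\<^sup>+h. \<integral>\<^sup>+\<omega>'. \<integral>\<^sup>+\<omega>. f h \<omega>' \<omega> \<partial>M \<partial>M \<partial>U01) = (\<integral>\<^sup>+h. \<integral>\<^sup>+r. f h (fst r) (snd r) \<partial>(M \<Otimes>\<^sub>M M) \<partial>U01)"
    proof (rule nn_integral_cong)
      fix h assume h: "h \<in> space U01"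
      have "(\<lambda>r. f h (fst r) (snd r)) \<in> borel_measurable (M \<Otimes>\<^sub>M M)"
        using measurable_compose[OF measurable_Pair1'[OF h] f] by simp
      from nn_integral_fst[OF this] show "(\<integral>\<^sup>+\<omega>'. \<integral>\<^sup>+\<omega>. f h \<omega>' \<omega> \<partial>M \<partial>M) = (\<integral>\<^sup>+r. f h (fst r) (snd r) \<partial>(M \<Otimes>\<^sub>M M))"
        by simp
    qed
    then show ?thesis using P.nn_integral_fst[OF f] by simp
  qed
  have "I 1 = I (- 1) + ?X"
  proof -
    have "I 1 = (\<integral>\<^sup>+r. ennreal (?t 1 (fst r) (fst (snd r)) (snd (snd r))) \<partial>?R)"
      by (subst I, simp, subst flat) auto
    also have "\<dots> = (\<integral>\<^sup>+r. ennreal (?t (- 1) (fst r) (fst (snd r)) (snd (snd r))) + ennreal (?x (fst r) (fst (snd r)) (snd (snd r))) \<partial>?R)"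
    proof (rule nn_integral_cong)
      fix r :: "real \<times> 'a \<times> 'a"
      obtain h \<omega>' \<omega> where r: "r = (h, \<omega>', \<omega>)" by (cases r) auto
      have e: "(swap_sign \<omega>)\<^sup>2 \<le> 1" using swap_sign_bound[of \<omega>] by (simp add: abs_square_le_1)
      have "(swap_sign \<omega>)\<^sup>2 * ((sin_coeff h \<omega>' \<omega>)\<^sup>2 / 4) \<le> 1 * ((sin_coeff h \<omega>' \<omega>)\<^sup>2 / 4)" by (intro mult_right_mono e) auto
      moreover have "0 \<le> (cos_coeff h \<omega>' \<omega>)\<^sup>2" "0 \<le> (sin_coeff h \<omega>' \<omega>)\<^sup>2" by auto
      ultimately have "0 \<le> (cos_coeff h \<omega>' \<omega>)\<^sup>2 + (sin_coeff h \<omega>' \<omega>)\<^sup>2 / 2 + (- 1 * (swap_sign \<omega>)\<^sup>2) * ((sin_coeff h \<omega>' \<omega>)\<^sup>2 / 4)"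
        by linarith
      then have "0 \<le> ?t (- 1) h \<omega>' \<omega>" by (intro mult_nonneg_nonneg start_weight_nonneg)
      moreover have "0 \<le> ?x h \<omega>' \<omega>" using start_weight_nonneg by simp
      moreover have "?t 1 h \<omega>' \<omega> = ?t (- 1) h \<omega>' \<omega> + ?x h \<omega>' \<omega>" by (simp add: algebra_simps)
      ultimately show "ennreal (?t 1 (fst r) (fst (snd r)) (snd (snd r)))
        = ennreal (?t (- 1) (fst r) (fst (snd r)) (snd (snd r))) + ennreal (?x (fst r) (fst (snd r)) (snd (snd r)))"
        unfolding r fst_conv snd_conv by (simp only: ennreal_plus)
    qed
    also have "\<dots> = (\<integral>\<^sup>+r. ennreal (?t (- 1) (fst r) (fst (snd r)) (snd (snd r))) \<partial>?R) + (\<integral>\<^sup>+r. ennreal (?x (fst r) (fst (snd r)) (snd (snd r))) \<partial>?R)"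
      by (rule nn_integral_add) measurable
    also have "\<dots> = I (- 1) + ?X"
      by (subst I, simp, subst (1 2) flat) auto
    finally show ?thesis .
  qed
  then show ?thesis
    using fin rotation_excess_not_null ennreal_add_left_cancel[of "I (- 1)" ?X 0] by auto
qed

section \<open>Continuity of the paths and transfer to path space\<close>

lemma rot_tanh_continuous:
  assumes h: "0 < h" "h < 1" and \<omega>': "\<omega>' \<in> space M"
  shows "continuous_on {1/2..1} (\<lambda>t. rot_tanh t (\<omega>, (h, v), \<omega>'))"
proof -
  have B: "continuous_on {1/2..1} (\<lambda>t. B (rot_time t h) \<omega>')"
    by (rule continuous_on_compose2[OF B_cont[OF \<omega>'] rot_time_continuous[OF h]]) (auto intro: rot_time_nonneg)
  show ?thesis unfolding rot_tanh_def rot_def prod.case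
    by (intro continuous_intros B radius_quantile_continuous_half h) auto
qed

lemma fake_continuous:
  assumes p: "p \<in> space base" and u: "\<bar>start (first_path p)\<bar> < radius_quantile (1/2) (radius_coord p)"
  shows "continuous_on {0..} (\<lambda>t. fake t p)"
proof -
  obtain \<omega> h v \<omega>' where p': "p = (\<omega>, (h, v), \<omega>')" by (cases p) auto
  have \<omega>: "\<omega> \<in> space M" "\<omega>' \<in> space M" and h: "0 < h" "h < 1" using p by (auto simp: p' space_base)
  have sup: "\<bar>start \<omega>\<bar> < radius_quantile (1/2) h" using u by (simp add: p' first_path_def radius_coord_def)
  have z: "rot_tanh t p < 1" if "t \<in> {1/2..1}" for t
    unfolding p' using rot_tanh_abs[OF sup, of t v \<omega>'] that by auto
  have "continuous_on {0..1/2} (\<lambda>t. fake t p)"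
  proof (subst continuous_on_cong[OF refl])
    show "continuous_on {0..1/2} (\<lambda>t. stoch_exp t \<omega>)" by (rule continuous_on_subset[OF stoch_exp_cont[OF \<omega>(1)]]) auto
  qed (simp add: fake_def p')
  moreover have "continuous_on {1/2..1} (\<lambda>t. fake t p)"
  proof (subst continuous_on_cong[OF refl])
    show "continuous_on {1/2..1} (\<lambda>t. (1 + rot_tanh t p) / (1 - rot_tanh t p))"
      unfolding p' using z by (intro continuous_intros rot_tanh_continuous h \<omega>) (force simp: p')
  qed (use fake_half[OF \<omega>(2), of _ \<omega> h v] in \<open>simp add: p'\<close>)
  moreover have "continuous_on {1..} (\<lambda>t. fake t p)"
  proof (subst continuous_on_cong[OF refl])
    show "continuous_on {1..} (\<lambda>t. (1 + rot_tanh 1 p) / (1 - rot_tanh 1 p) * (stoch_exp t \<omega> / stoch_exp 1 \<omega>))"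
      using stoch_exp_pos[of 1 \<omega>] by (intro continuous_intros continuous_on_subset[OF stoch_exp_cont[OF \<omega>(1)]]) auto
  qed (use fake_one[of _ \<omega> h v \<omega>'] in \<open>simp add: p'\<close>)
  ultimately have "continuous_on (({0..1/2} \<union> {1/2..1}) \<union> {1..}) (\<lambda>t. fake t p)"
    by (intro continuous_on_closed_Un) auto
  moreover have "({0..1/2} \<union> {1/2..1}) \<union> {1..} = {0 :: real..}" by auto
  ultimately show ?thesis by simp
qed

lemma exists_fake:
  "\<exists>(M' :: (real \<Rightarrow> real) measure) F' P'. martingale M' F' P'
    \<and> (\<forall>\<omega>\<in>space M'. continuous_on {0..} (\<lambda>t. P' t \<omega>))
    \<and> (\<forall>t\<ge>0. distr M' borel (P' t) = distr M borel (stoch_exp t))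
    \<and> process_law M' P' = process_law fake_measure fake"
proof -
  define S where "S = {p \<in> space base. \<bar>start (first_path p)\<bar> < radius_quantile (1/2) (radius_coord p)}"
  have [measurable]: "radius_quantile (1/2) \<in> borel_measurable borel" by (auto intro!: radius_quantile_measurable)
  have S: "S \<in> sets fake_measure" unfolding S_def fake_measure_def by simp
  have AE_S: "AE p in fake_measure. p \<in> S"
  proof -
    have [measurable]: "rot_tanh 1 \<in> borel_measurable base" by simp
    have "AE p in base. 0 < ennreal (weight (fst p) (fst (snd p)) * (1 - rot_tanh 1 p)) \<longrightarrow> p \<in> S"
    proof (rule AE_I2, rule impI)
      fix p assume p: "p \<in> space base" "0 < ennreal (weight (fst p) (fst (snd p)) * (1 - rot_tanh 1 p))"
      obtain \<omega> h v \<omega>' where p': "p = (\<omega>, (h, v), \<omega>')" by (cases p) auto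
      have "weight \<omega> (h, v) \<noteq> 0" using p by (auto simp: p')
      from weight_nonzeroD[OF this] show "p \<in> S" using p(1) by (simp add: S_def p' first_path_def radius_coord_def)
    qed
    then show ?thesis unfolding fake_measure_def by (subst AE_density) auto
  qed
  have "\<exists>(M' :: (real \<Rightarrow> real) measure) F' P'. martingale M' F' P'
    \<and> (\<forall>\<omega>\<in>space M'. continuous_on {0..} (\<lambda>t. P' t \<omega>))
    \<and> (\<forall>t\<ge>0. distr M' borel (P' t) = distr fake_measure borel (fake t))
    \<and> process_law M' P' = process_law fake_measure fake"
  proof (rule martingale_on_path_space[OF prob_space_fake_measure _ S AE_S])
    show "fake t \<in> borel_measurable fake_measure" if "0 \<le> t" for t using that by (simp add: measurable_fake_measure)
    show "continuous_on {0..} (\<lambda>t. fake t p)" if "p \<in> S" for p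
      using that by (intro fake_continuous) (auto simp: S_def)
    show "0 \<le> fake t p" if "p \<in> S" for t p
      using that by (intro fake_nonneg) (auto simp: S_def first_path_def radius_coord_def)
    show "(\<integral>\<^sup>+p. ennreal (fake t p) \<partial>fake_measure) < \<infinity>" if t: "0 \<le> t" for t
    proof -
      have "(\<integral>\<^sup>+p. ennreal (fake t p) \<partial>fake_measure) = (\<integral>\<^sup>+\<omega>. ennreal (stoch_exp t \<omega>) \<partial>M)"
        by (rule marginal[OF t]) simp
      also have "\<dots> = (\<integral>\<^sup>+\<omega>. ennreal (stoch_exp 0 \<omega>) \<partial>M)"
        using exp_martingale[of 0 t "\<lambda>_. 1"] t by simp
      also have "\<dots> = (\<integral>\<^sup>+\<omega>. 1 \<partial>M)" by (rule nn_integral_cong) (simp add: stoch_exp_0)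
      finally show ?thesis by (simp add: emeasure_space_1)
    qed
    show "(\<integral>\<^sup>+p. indicator A (restrict (\<lambda>u. fake u p) {0..s}) * ennreal (fake t p) \<partial>fake_measure)
      = (\<integral>\<^sup>+p. indicator A (restrict (\<lambda>u. fake u p) {0..s}) * ennreal (fake s p) \<partial>fake_measure)"
      if "0 \<le> s" "s \<le> t" "A \<in> sets (PiM {0..s} (\<lambda>_. borel))" for s t A
      using mart_step[OF that(1,2)] that(3) unfolding mart_step_def past_def by blast
  qed
  then show ?thesis using distr_fake by metis
qed

text \<open>Adding \<open>t / 2\<close> to the logarithm recovers the Brownian path, whence the
  shifts 1/8 at time 1/4 and 1/4 at time 1/2. The sign thereby becomes a function of the
  process.\<close>

definition path_sign :: "real \<Rightarrow> real \<Rightarrow> real" where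
  "path_sign x y = indicator {0<..} (ln x + 1/8) - indicator {0<..} (ln y + 1/4 - (ln x + 1/8))"

lemma path_sign_stoch_exp: "path_sign (stoch_exp (1/4) \<omega>) (stoch_exp (1/2) \<omega>) = swap_sign \<omega>"
  by (simp add: path_sign_def stoch_exp_def swap_sign_def)

lemma nn_integral_process_law:
  fixes X :: "real \<Rightarrow> 'b \<Rightarrow> real"
  assumes X: "\<And>t. 0 \<le> t \<Longrightarrow> X t \<in> borel_measurable Q"
  shows "(\<integral>\<^sup>+f. ennreal (test_fun (f 1)) * ennreal (1 + \<sigma> * path_sign (f (1/4)) (f (1/2))) \<partial>process_law Q X)
    = (\<integral>\<^sup>+\<omega>. ennreal (test_fun (X 1 \<omega>)) * ennreal (1 + \<sigma> * path_sign (X (1/4) \<omega>) (X (1/2) \<omega>)) \<partial>Q)"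
proof -
  have c[measurable]: "(\<lambda>f. f t) \<in> borel_measurable (PiM {0..} (\<lambda>_. borel :: real measure))" if "0 \<le> t" for t :: real
    using that by (intro measurable_component_singleton) auto
  have "(\<lambda>f :: real \<Rightarrow> real. ennreal (test_fun (f 1)) * ennreal (1 + \<sigma> * path_sign (f (1/4)) (f (1/2)))) \<in> borel_measurable (PiM {0..} (\<lambda>_. borel :: real measure))"
    using c[of 1] c[of "1/4"] c[of "1/2"] unfolding path_sign_def by simp
  then show ?thesis
    unfolding process_law_def using X
    by (subst nn_integral_distr) (auto intro!: measurable_restrict)
qed

text \<open>The integrals of the test function against \<open>1 \<plusminus> swap_sign\<close> agree for exponential Brownian motion, by
  exchanging its increments over \<open>[0, 1/4]\<close> and \<open>[1/4, 1/2]\<close>, but not under \<open>fake_measure\<close>.\<close>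

lemma process_law_fake_measure_neq:
  assumes "\<And>\<sigma>. (\<integral>\<^sup>+f. ennreal (test_fun (f 1)) * ennreal (1 + \<sigma> * path_sign (f (1/4)) (f (1/2))) \<partial>L)
    = (\<integral>\<^sup>+f. ennreal (test_fun (f 1)) * ennreal (1 + \<sigma> * path_sign (f (1/4)) (f (1/2))) \<partial>process_law M stoch_exp)"
  shows "process_law fake_measure fake \<noteq> L"
proof
  assume eq: "process_law fake_measure fake = L"
  have X: "fake t \<in> borel_measurable fake_measure" if "0 \<le> t" for t using that by (simp add: measurable_fake_measure)
  have s: "path_sign (fake (1/4) p) (fake (1/2) p) = swap_sign (fst p)" for p
    by (simp add: fake_def path_sign_stoch_exp)
  have J: "(\<integral>\<^sup>+p. ennreal (test_fun (fake 1 p)) * ennreal (1 + \<sigma> * swap_sign (fst p)) \<partial>fake_measure)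
    = (\<integral>\<^sup>+\<omega>. ennreal (test_fun (stoch_exp 1 \<omega>)) * ennreal (1 + \<sigma> * swap_sign \<omega>) \<partial>M)" for \<sigma>
    using assms[of \<sigma>] nn_integral_process_law[of fake fake_measure \<sigma>, OF X] nn_integral_process_law[of stoch_exp M \<sigma>, OF stoch_exp_measurable]
    unfolding eq s path_sign_stoch_exp by simp
  show False
    using asymmetry_fake_measure expectation_test_fun_finite swap_symmetry_stoch_exp unfolding J by blast
qed

end

section \<open>The density of the marginal laws, and null sets\<close>

text \<open>Substitution on the compact intervals from \<open>exp (- n)\<close> to
  \<open>exp n\<close>, with monotone convergence on both sides.\<close>

lemma nn_integral_substitution_exp:
  fixes f :: "real \<Rightarrow> ennreal"
  assumes f[measurable]: "f \<in> borel_measurable borel"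
  shows "(\<integral>\<^sup>+x. f x * indicator {0<..} x \<partial>lborel) = (\<integral>\<^sup>+y. f (exp y) * ennreal (exp y) \<partial>lborel)"
proof (rule LIMSEQ_unique)
  let ?a = "\<lambda>n :: nat. \<integral>\<^sup>+x. f x * indicator {exp (- real n)..exp (real n)} x \<partial>lborel"
  show "?a \<longlonglongrightarrow> (\<integral>\<^sup>+x. f x * indicator {0<..} x \<partial>lborel)"
  proof (rule nn_integral_LIMSEQ)
    have sub: "{exp (- real m)..exp (real m)} \<subseteq> {exp (- real n)..exp (real n)}" if "m \<le> n" for m n
      using that by simp
    have "indicator {exp (- real m)..exp (real m)} x \<le> (indicator {exp (- real n)..exp (real n)} x :: ennreal)"
      if "m \<le> n" for m n x using sub[OF that] subsetD[OF sub[OF that], of x] by (cases "x \<in> {exp (- real m)..exp (real m)}") simp_all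
    then show "incseq (\<lambda>n x. f x * indicator {exp (- real n)..exp (real n)} x)"
      unfolding incseq_def le_fun_def by (intro allI impI mult_left_mono) auto
    fix x :: real
    show "(\<lambda>n. f x * indicator {exp (- real n)..exp (real n)} x) \<longlonglongrightarrow> f x * indicator {0<..} x"
    proof (cases "0 < x")
      case True
      obtain N where N: "\<bar>ln x\<bar> \<le> real N" using real_arch_simple by blast
      have "x \<in> {exp (- real n)..exp (real n)}" if "N \<le> n" for n
      proof -
        have "- real n \<le> ln x" "ln x \<le> real n" using N that by auto
        then have "exp (- real n) \<le> exp (ln x)" "exp (ln x) \<le> exp (real n)" by (simp_all only: exp_le_cancel_iff)
        then show ?thesis using True by simp
      qed
      then have "eventually (\<lambda>n. f x * indicator {exp (- real n)..exp (real n)} x = f x * indicator {0<..} x) sequentially"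
        using True by (auto simp: eventually_sequentially intro!: exI[of _ N])
      then show ?thesis by (rule tendsto_eventually)
    next
      case False
      then have "x \<notin> {exp (- real n)..exp (real n)}" for n
        using exp_gt_zero[of "- real n"] by (auto simp del: exp_gt_zero)
      then show ?thesis using False by simp
    qed
  qed measurable
  have a: "?a n = (\<integral>\<^sup>+y. f (exp y) * ennreal (exp y) * indicator {- real n..real n} y \<partial>lborel)" for n
  \<comment> \<open>For \<open>n = 0\<close> both intervals are single points, which the
    substitution rule excludes.\<close>
  proof (cases "n = 0")
    case True
    have "(\<integral>\<^sup>+x. g x * indicator {c..c} x \<partial>lborel) = (\<integral>\<^sup>+x. 0 \<partial>(lborel :: real measure))" for g :: "real \<Rightarrow> ennreal" and c
    proof (rule nn_integral_cong_AE)
      have "AE x in lborel. x \<noteq> c" by (rule AE_lborel_singleton)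
      then show "AE x in lborel. g x * indicator {c..c} x = 0" by eventually_elim simp
    qed
    from this[of f 1] this[of "\<lambda>y. f (exp y) * ennreal (exp y)" 0] show ?thesis by (simp add: True)
  next
    case False
    then show ?thesis
      by (intro nn_integral_substitution_aux) (auto intro!: derivative_eq_intros continuous_intros)
  qed
  show "?a \<longlonglongrightarrow> (\<integral>\<^sup>+y. f (exp y) * ennreal (exp y) \<partial>lborel)"
    unfolding a
  proof (rule nn_integral_LIMSEQ)
    show "incseq (\<lambda>n y. f (exp y) * ennreal (exp y) * indicator {- real n..real n} y)"
      unfolding incseq_def le_fun_def
      by (intro allI impI mult_left_mono) (auto simp: indicator_def)
    fix y :: real
    obtain N where "\<bar>y\<bar> \<le> real N" using real_arch_simple by blast
    then have "eventually (\<lambda>n. f (exp y) * ennreal (exp y) * indicator {- real n..real n} y = f (exp y) * ennreal (exp y)) sequentially"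
      by (auto simp: eventually_sequentially indicator_def intro!: exI[of _ N])
    then show "(\<lambda>n. f (exp y) * ennreal (exp y) * indicator {- real n..real n} y) \<longlonglongrightarrow> f (exp y) * ennreal (exp y)"
      by (rule tendsto_eventually)
  qed measurable
qed

text \<open>Change of variables \<open>x = exp (2 * u)\<close> with Jacobian
  \<open>2 * exp (2 * u)\<close>; the new variable is half of \<open>ln P\<close>.\<close>

lemma exp_bm_density_exp:
  assumes t: "0 < t"
  shows "2 * (exp_bm_density t (exp (2 * u)) * exp (2 * u)) = normal_density (- t / 4) (sqrt t / 2) u"
proof -
  have p: "exp (2 * u) powr (3 / 2) = exp (3 * u)" by (simp add: powr_def)
  have s: "sqrt (2 * pi * (sqrt t / 2)\<^sup>2) = sqrt (2 * pi) * sqrt t / 2"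
  proof -
    have "2 * pi * (sqrt t / 2)\<^sup>2 = 2 * pi * t / 2\<^sup>2" using t by (simp add: power_divide)
    then show ?thesis by (simp only: real_sqrt_divide real_sqrt_abs real_sqrt_mult)
  qed
  have e: "exp (- (u - - t / 4)\<^sup>2 / (2 * (sqrt t / 2)\<^sup>2)) = exp (- t / 8) * (exp (- (2 * u)\<^sup>2 / (2 * t)) * exp (- u))"
  proof -
    have "- (u - - t / 4)\<^sup>2 / (2 * (sqrt t / 2)\<^sup>2) = - t / 8 + (- (2 * u)\<^sup>2 / (2 * t) + - u)"
      using t by (simp add: field_simps power2_eq_square)
    then show ?thesis by (simp only: exp_add)
  qed
  have u: "exp (- u) = exp (2 * u) / exp (3 * u)" by (simp add: exp_diff[symmetric])
  show ?thesis
    unfolding normal_density_def s e u exp_bm_density_def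
    using t by (simp add: p powr_half_sqrt)
qed

context continuous_bm
begin

lemma distr_stoch_exp:
  assumes t: "0 < t" shows "distr M borel (stoch_exp t) = density lborel (\<lambda>x. ennreal (exp_bm_density t x))"
proof (rule measure_eqI)
  fix A assume "A \<in> sets (distr M borel (stoch_exp t))"
  then have A[measurable]: "A \<in> sets borel" by simp
  have [measurable]: "exp_bm_density t \<in> borel_measurable borel"
    unfolding exp_bm_density_def by measurable
  let ?f = "\<lambda>x. ennreal (exp_bm_density t x) * indicator A x"
  have "emeasure (density lborel (\<lambda>x. ennreal (exp_bm_density t x))) A = (\<integral>\<^sup>+x. ?f x * indicator {0<..} x \<partial>lborel)"
    by (subst emeasure_density) (auto intro!: nn_integral_cong simp: exp_bm_density_def indicator_def)
  also have "\<dots> = (\<integral>\<^sup>+y. ?f (exp y) * ennreal (exp y) \<partial>lborel)"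
    by (rule nn_integral_substitution_exp) measurable
  also have "\<dots> = ennreal \<bar>2\<bar> * (\<integral>\<^sup>+u. ?f (exp (0 + 2 * u)) * ennreal (exp (0 + 2 * u)) \<partial>lborel)"
    by (rule nn_integral_real_affine) auto
  also have "\<dots> = (\<integral>\<^sup>+u. ennreal 2 * (?f (exp (2 * u)) * ennreal (exp (2 * u))) \<partial>lborel)"
    by (subst nn_integral_cmult) auto
  also have "\<dots> = (\<integral>\<^sup>+u. ennreal (normal_density (- t / 4) (sqrt t / 2) u) * indicator A (exp (2 * u)) \<partial>lborel)"
  proof (rule nn_integral_cong)
    fix u
    have d: "0 \<le> exp_bm_density t (exp (2 * u))"
      using t by (simp add: exp_bm_density_def)
    have "ennreal (normal_density (- t / 4) (sqrt t / 2) u) = ennreal 2 * (ennreal (exp_bm_density t (exp (2 * u))) * ennreal (exp (2 * u)))"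
      unfolding exp_bm_density_exp[OF t, symmetric] using d
      by (subst ennreal_mult, simp, simp, subst ennreal_mult) auto
    then show "ennreal 2 * (?f (exp (2 * u)) * ennreal (exp (2 * u))) = ennreal (normal_density (- t / 4) (sqrt t / 2) u) * indicator A (exp (2 * u))"
      by (simp only: mult_ac)
  qed
  also have "\<dots> = (\<integral>\<^sup>+\<omega>. indicator A (stoch_exp t \<omega>) \<partial>M)"
    by (rule nn_integral_stoch_exp[OF t, symmetric]) simp
  also have "\<dots> = emeasure (distr M borel (stoch_exp t)) A"
    using t by (subst nn_integral_indicator[symmetric], simp, intro nn_integral_distr[symmetric] stoch_exp_measurable) auto
  finally show "emeasure (distr M borel (stoch_exp t)) A = emeasure (density lborel (\<lambda>x. ennreal (exp_bm_density t x))) A" by simp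
qed simp

end

section \<open>Restriction to a set of full measure\<close>

lemma distr_restrict_full:
  assumes \<Omega>: "\<Omega> \<in> sets M" and AE: "AE \<omega> in M. \<omega> \<in> \<Omega>" and X: "X \<in> measurable M L"
  shows "distr (restrict_space M \<Omega>) L X = distr M L X"
proof (rule measure_eqI)
  fix A assume "A \<in> sets (distr (restrict_space M \<Omega>) L X)"
  then have A: "A \<in> sets L" by simp
  have \<Omega>s: "\<Omega> \<subseteq> space M" using sets.sets_into_space[OF \<Omega>] .
  have "emeasure (distr (restrict_space M \<Omega>) L X) A = emeasure M (X -` A \<inter> \<Omega>)"
    using A X \<Omega> \<Omega>s
    by (subst emeasure_distr) (auto simp: space_restrict_space emeasure_restrict_space measurable_restrict_space1 Int_absorb2)
  also have "\<dots> = emeasure M (X -` A \<inter> space M)"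
  proof (rule emeasure_eq_AE)
    show "AE \<omega> in M. (\<omega> \<in> X -` A \<inter> \<Omega>) = (\<omega> \<in> X -` A \<inter> space M)"
      using AE AE_space by eventually_elim auto
    show "X -` A \<inter> space M \<in> sets M" using X A by (rule measurable_sets)
    then have "(X -` A \<inter> space M) \<inter> \<Omega> \<in> sets M" using \<Omega> by auto
    moreover have "(X -` A \<inter> space M) \<inter> \<Omega> = X -` A \<inter> \<Omega>" using \<Omega>s by auto
    ultimately show "X -` A \<inter> \<Omega> \<in> sets M" by simp
  qed
  also have "\<dots> = emeasure (distr M L X) A" using X A by (simp add: emeasure_distr)
  finally show "emeasure (distr (restrict_space M \<Omega>) L X) A = emeasure (distr M L X) A" .
qed simp

lemma measure_restrict_full:
  assumes \<Omega>: "\<Omega> \<in> sets M" and AE: "AE \<omega> in M. \<omega> \<in> \<Omega>" and A: "A \<in> sets M"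
  shows "measure (restrict_space M \<Omega>) (A \<inter> \<Omega>) = measure M A"
proof -
  have "measure (restrict_space M \<Omega>) (A \<inter> \<Omega>) = measure M (A \<inter> \<Omega>)"
    using \<Omega> sets.sets_into_space[OF \<Omega>] by (intro measure_restrict_space) (auto simp: Int_absorb2)
  also have "\<dots> = measure M A"
    by (rule measure_eq_AE) (use AE A \<Omega> in \<open>auto elim!: eventually_mono\<close>)
  finally show ?thesis .
qed

text \<open>Intersecting with a set of full measure changes no probability, so Gaussian increments,
  independence and convergence in probability survive. The filtration passes to its traces, so
  \<open>\<Omega>\<close> may lie outside every \<open>F t\<close>.\<close>

lemma exponential_bm_restrict:
  assumes ebm: "exponential_brownian_motion M F B P"
    and \<Omega>: "\<Omega> \<in> sets M" and AE: "AE \<omega> in M. \<omega> \<in> \<Omega>"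
  shows "exponential_brownian_motion (restrict_space M \<Omega>) (\<lambda>t. restrict_space (F t) \<Omega>) B P"
proof -
  let ?M = "restrict_space M \<Omega>" and ?F = "\<lambda>t. restrict_space (F t) \<Omega>"
  have bm: "standard_brownian_motion M F B" and Pad: "adapted F P"
    and ito: "\<And>t. 0 \<le> t \<Longrightarrow> has_ito_integral M B P t (\<lambda>\<omega>. P t \<omega> - P 0 \<omega>)"
    using ebm by (auto simp: exponential_brownian_motion_def)
  interpret M: prob_space M using bm by (simp add: standard_brownian_motion_def)
  have \<Omega>s: "\<Omega> \<subseteq> space M" using sets.sets_into_space[OF \<Omega>] .
  have spF: "space (F t) = space M" and sF: "sets (F t) \<subseteq> sets M" and mF: "s \<le> t \<Longrightarrow> sets (F s) \<subseteq> sets (F t)" for s t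
    using bm by (auto simp: standard_brownian_motion_def filtration_on_def subalgebra_def filtration_def)
  have FM: "f \<in> measurable (F t) L \<Longrightarrow> f \<in> measurable M L" for f t L
    using sF[of t] spF[of t] by (auto simp: measurable_def)
  have Bad: "adapted F B" using bm by (auto simp: standard_brownian_motion_def)
  have Bm: "B t \<in> borel_measurable M" "P t \<in> borel_measurable M" if "0 \<le> t" for t
    using Bad Pad that FM[of "B t" t borel] FM[of "P t" t borel] by (auto simp: adapted_def)
  have sp: "space ?M = \<Omega>" using \<Omega>s by (auto simp: space_restrict_space)
  have \<Omega>1: "emeasure M \<Omega> = 1"
    using M.prob_eq_1[OF \<Omega>] AE by (simp add: M.emeasure_eq_measure)
  have prob: "prob_space ?M"
    by (rule prob_spaceI) (use \<Omega> \<Omega>1 \<Omega>s in \<open>simp add: sp emeasure_restrict_space Int_absorb2\<close>)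
  interpret R: prob_space ?M by (rule prob)
  have AEr: "(AE \<omega> in ?M. Q \<omega>)" if "AE \<omega> in M. Q \<omega>" for Q
    using that \<Omega> \<Omega>s by (subst AE_restrict_space_iff) (auto simp: Int_absorb2 elim!: eventually_mono)
  have setsF: "sets (?F t) = (\<lambda>A. A \<inter> \<Omega>) ` sets (F t)" for t
    by (auto simp: sets_restrict_space Int_commute)
  have setsM: "sets ?M = (\<lambda>A. A \<inter> \<Omega>) ` sets M"
    by (auto simp: sets_restrict_space Int_commute)
  have filt: "filtration_on ?M ?F"
    unfolding filtration_on_def filtration_def subalgebra_def
  proof (intro conjI allI impI)
    show "space (?F i) = space ?M" for i by (simp add: space_restrict_space spF)
    show "space (?F i) = space ?M" for i by (simp add: space_restrict_space spF)
    show "sets (?F t) \<subseteq> sets ?M" for t unfolding setsF setsM using sF[of t] by (rule image_mono)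
    show "sets (?F s) \<subseteq> sets (?F t)" if "s \<le> t" for s t unfolding setsF using mF[OF that] by (rule image_mono)
  qed
  have ad: "adapted ?F B" "adapted ?F P"
    using Bad Pad by (auto simp: adapted_def intro: measurable_restrict_space1)
  have "standard_brownian_motion ?M ?F B"
    unfolding standard_brownian_motion_def
  proof (intro conjI allI impI)
    show "AE \<omega> in ?M. B 0 \<omega> = 0" "AE \<omega> in ?M. continuous_on {0..} (\<lambda>t. B t \<omega>)"
      using bm by (auto simp: standard_brownian_motion_def intro!: AEr)
    fix s t :: real assume "0 \<le> s \<and> s < t"
    then have st: "0 \<le> s" "s < t" by auto
    let ?X = "\<lambda>\<omega>. B t \<omega> - B s \<omega>"
    have X: "?X \<in> borel_measurable M" using st Bm by simp
    have d: "distributed M lborel ?X (normal_density 0 (sqrt (t - s)))"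
      and ind: "M.indep_set (sets (F s)) (sets (vimage_algebra (space M) ?X borel))"
      using bm st by (auto simp: standard_brownian_motion_def)
    show "distributed ?M lborel ?X (normal_density 0 (sqrt (t - s)))"
      using d distr_restrict_full[OF \<Omega> AE, of ?X lborel] X
      by (auto simp: distributed_def measurable_restrict_space1)
    have V: "sets (vimage_algebra (space M) ?X borel) = {?X -` C \<inter> space M | C. C \<in> sets borel}"
      "sets (vimage_algebra (space ?M) ?X borel) = {?X -` C \<inter> space ?M | C. C \<in> sets borel}"
      by (auto intro!: sets_vimage_algebra2)
    show "R.indep_set (sets (?F s)) (sets (vimage_algebra (space ?M) ?X borel))"
      unfolding R.indep_set_def R.indep_sets2_eq[unfolded R.indep_set_def]
    proof (intro conjI ballI)
      show "sets (?F s) \<subseteq> R.events" unfolding setsF setsM using sF[of s] by (rule image_mono)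
      have XR: "?X \<in> borel_measurable ?M" using X by (rule measurable_restrict_space1)
      show "sets (vimage_algebra (space ?M) ?X borel) \<subseteq> R.events"
        unfolding V using measurable_sets[OF XR] by auto
      fix a b assume "a \<in> sets (?F s)" "b \<in> sets (vimage_algebra (space ?M) ?X borel)"
      then obtain a' C where a: "a' \<in> sets (F s)" "a = a' \<inter> \<Omega>" and b: "C \<in> sets borel" "b = ?X -` C \<inter> \<Omega>"
        unfolding setsF V(2)[unfolded sp] sp by auto
      let ?b = "?X -` C \<inter> space M"
      have bV: "?b \<in> sets (vimage_algebra (space M) ?X borel)" unfolding V using b by auto
      have b': "b = ?b \<inter> \<Omega>" "a \<inter> b = (a' \<inter> ?b) \<inter> \<Omega>" using b a \<Omega>s by auto
      have m: "a' \<in> sets M" "?b \<in> sets M" using a sF measurable_sets[OF X b(1)] by auto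
      show "R.prob (a \<inter> b) = R.prob a * R.prob b"
        unfolding b'(2) unfolding a(2) b'(1)
        using measure_restrict_full[OF \<Omega> AE] m M.indep_setD[OF ind a(1) bV] by simp
    qed
  qed (use prob filt ad in auto)
  moreover have "has_ito_integral ?M B P t (\<lambda>\<omega>. P t \<omega> - P 0 \<omega>)" if t: "0 \<le> t" for t
    unfolding has_ito_integral_def
  proof (intro conjI allI impI)
    show "(\<lambda>\<omega>. P t \<omega> - P 0 \<omega>) \<in> borel_measurable ?M"
      by (rule measurable_restrict_space1) (use Bm t in simp)
    fix \<epsilon> :: real assume "0 < \<epsilon>"
    then obtain \<delta> where \<delta>: "0 < \<delta>" and b: "\<And>n p. partition_mesh_less t \<delta> n p \<Longrightarrow> measure M {\<omega> \<in> space M.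
        \<epsilon> < \<bar>(\<Sum>i<n. P (p i) \<omega> * (B (p (Suc i)) \<omega> - B (p i) \<omega>)) - (P t \<omega> - P 0 \<omega>)\<bar>} < \<epsilon>"
      using ito[OF t] unfolding has_ito_integral_def by blast
    show "\<exists>\<delta>>0. \<forall>n p. partition_mesh_less t \<delta> n p \<longrightarrow> measure ?M {\<omega> \<in> space ?M.
        \<epsilon> < \<bar>(\<Sum>i<n. P (p i) \<omega> * (B (p (Suc i)) \<omega> - B (p i) \<omega>)) - (P t \<omega> - P 0 \<omega>)\<bar>} < \<epsilon>"
    proof (intro exI[of _ \<delta>] conjI allI impI \<delta>)
      fix n p assume part: "partition_mesh_less t \<delta> n p"
      \<comment> \<open>Partition points increase from 0, so \<open>B\<close> and \<open>P\<close>
        are measurable at each of them.\<close>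
      have p: "0 \<le> p i" if "i \<le> n" for i
        using that part by (induction i) (auto simp: partition_mesh_less_def intro: order_trans)
      let ?A = "{\<omega> \<in> space M. \<epsilon> < \<bar>(\<Sum>i<n. P (p i) \<omega> * (B (p (Suc i)) \<omega> - B (p i) \<omega>)) - (P t \<omega> - P 0 \<omega>)\<bar>}"
      have [measurable]: "P t \<in> borel_measurable M" "P 0 \<in> borel_measurable M" using t Bm by auto
      have [measurable]: "(\<lambda>\<omega>. \<Sum>i<n. P (p i) \<omega> * (B (p (Suc i)) \<omega> - B (p i) \<omega>)) \<in> borel_measurable M"
        using Bm p by (intro borel_measurable_sum borel_measurable_times borel_measurable_diff) auto
      have "?A \<in> sets M" by measurable
      moreover have "{\<omega> \<in> space ?M. \<epsilon> < \<bar>(\<Sum>i<n. P (p i) \<omega> * (B (p (Suc i)) \<omega> - B (p i) \<omega>)) - (P t \<omega> - P 0 \<omega>)\<bar>} = ?A \<inter> \<Omega>"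
        using \<Omega>s by (auto simp: sp)
      ultimately show "measure ?M {\<omega> \<in> space ?M. \<epsilon> < \<bar>(\<Sum>i<n. P (p i) \<omega> * (B (p (Suc i)) \<omega> - B (p i) \<omega>)) - (P t \<omega> - P 0 \<omega>)\<bar>} < \<epsilon>"
        using measure_restrict_full[OF \<Omega> AE] b[OF part] by simp
    qed
  qed
  ultimately show ?thesis
    using ebm ad unfolding exponential_brownian_motion_def by (auto intro: AEr)
qed

context exponential_bm_paths
begin

lemma distr_P_stoch_exp: "0 \<le> t \<Longrightarrow> distr M borel (P t) = distr M borel (stoch_exp t)"
  using P_eq_stoch_exp[of t] P_measurable[of t] stoch_exp_measurable[of t] by (intro distr_cong_AE) auto

text \<open>Only three times enter the functional, so the almost sure equality of \<open>P\<close>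
  and \<open>stoch_exp\<close> at each fixed time is enough.\<close>

lemma nn_integral_process_law_P:
  "(\<integral>\<^sup>+f. ennreal (test_fun (f 1)) * ennreal (1 + \<sigma> * path_sign (f (1/4)) (f (1/2))) \<partial>process_law M P)
    = (\<integral>\<^sup>+f. ennreal (test_fun (f 1)) * ennreal (1 + \<sigma> * path_sign (f (1/4)) (f (1/2))) \<partial>process_law M stoch_exp)"
proof -
  have "AE \<omega> in M. P 1 \<omega> = stoch_exp 1 \<omega>" "AE \<omega> in M. P (1/4) \<omega> = stoch_exp (1/4) \<omega>" "AE \<omega> in M. P (1/2) \<omega> = stoch_exp (1/2) \<omega>"
    by (auto intro!: P_eq_stoch_exp)
  then have "AE \<omega> in M. ennreal (test_fun (P 1 \<omega>)) * ennreal (1 + \<sigma> * path_sign (P (1/4) \<omega>) (P (1/2) \<omega>))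
    = ennreal (test_fun (stoch_exp 1 \<omega>)) * ennreal (1 + \<sigma> * path_sign (stoch_exp (1/4) \<omega>) (stoch_exp (1/2) \<omega>))"
    by eventually_elim simp
  from nn_integral_cong_AE[OF this] show ?thesis
    using nn_integral_process_law[of P M \<sigma>, OF P_measurable] nn_integral_process_law[of stoch_exp M \<sigma>, OF stoch_exp_measurable]
    by simp
qed

lemma process_law_fake_measure_neq_P: "process_law fake_measure fake \<noteq> process_law M P"
  by (rule process_law_fake_measure_neq) (rule nn_integral_process_law_P)

end

theorem mainTheorem1:
  fixes M :: "'a measure" and F :: "real \<Rightarrow> 'a measure"
    and B P :: "real \<Rightarrow> 'a \<Rightarrow> real"
    and \<nu> :: "real \<Rightarrow> real measure"
  assumes P: "exponential_brownian_motion M F B P"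
    and \<nu>: "\<And>t. 0 \<le> t \<Longrightarrow> \<nu> t = distr M borel (P t)"
  shows "\<nu> 0 = return borel 1
    \<and> (\<forall>t>0. \<nu> t = density lborel (\<lambda>x. ennreal (exp_bm_density t x)))
    \<and> (\<exists>(M' :: (real \<Rightarrow> real) measure) F' P'.
         martingale M' F' P'
         \<and> (\<forall>\<omega>\<in>space M'. continuous_on {0..} (\<lambda>t. P' t \<omega>))
         \<and> (\<forall>t\<ge>0. distr M' borel (P' t) = \<nu> t)
         \<and> process_law M' P' \<noteq> process_law M P)"
proof -
  have bm: "standard_brownian_motion M F B" and Pad: "adapted F P"
    using P by (auto simp: exponential_brownian_motion_def)
  interpret M: prob_space M using bm by (simp add: standard_brownian_motion_def)
  have PM: "P t \<in> borel_measurable M" if "0 \<le> t" for t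
  proof -
    have "P t \<in> borel_measurable (F t)" "subalgebra M (F t)"
      using Pad bm that by (auto simp: adapted_def standard_brownian_motion_def filtration_on_def)
    then show ?thesis by (auto simp: subalgebra_def measurable_def)
  qed
  define nice where "nice \<omega> \<longleftrightarrow> B 0 \<omega> = 0 \<and> P 0 \<omega> = 1 \<and> continuous_on {0..} (\<lambda>t. B t \<omega>) \<and> continuous_on {0..} (\<lambda>t. P t \<omega>)" for \<omega>
  have "AE \<omega> in M. nice \<omega>"
    using P bm unfolding nice_def exponential_brownian_motion_def standard_brownian_motion_def by auto
  \<comment> \<open>The exceptional points need not form a measurable set; they are covered by a
    measurable null set, whose complement becomes the new sample space.\<close>
  then obtain N where N: "{\<omega> \<in> space M. \<not> nice \<omega>} \<subseteq> N" "emeasure M N = 0" "N \<in> sets M"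
    by (rule AE_E)
  define \<Omega> where "\<Omega> = space M - N"
  have \<Omega>: "\<Omega> \<in> sets M" using N by (auto simp: \<Omega>_def)
  have "AE \<omega> in M. \<omega> \<notin> N" using N by (intro AE_not_in) (auto simp: null_sets_def)
  then have AE: "AE \<omega> in M. \<omega> \<in> \<Omega>" using AE_space by eventually_elim (auto simp: \<Omega>_def)
  have sp: "space (restrict_space M \<Omega>) = \<Omega>" by (auto simp: space_restrict_space \<Omega>_def)
  have nice: "nice \<omega>" if "\<omega> \<in> \<Omega>" for \<omega> using that N by (auto simp: \<Omega>_def)
  have ebm: "exponential_brownian_motion (restrict_space M \<Omega>) (\<lambda>t. restrict_space (F t) \<Omega>) B P"
    by (rule exponential_bm_restrict[OF P \<Omega> AE])
  interpret R: exponential_bm_paths "restrict_space M \<Omega>" "\<lambda>t. restrict_space (F t) \<Omega>" B P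
    by unfold_locales (use ebm nice in \<open>auto simp: sp nice_def exponential_brownian_motion_def\<close>)
  have dR: "\<nu> t = distr (restrict_space M \<Omega>) borel (R.stoch_exp t)" if "0 \<le> t" for t
    using distr_restrict_full[OF \<Omega> AE PM[OF that]] R.distr_P_stoch_exp[OF that] \<nu>[OF that] by simp
  have law: "process_law M P = process_law (restrict_space M \<Omega>) P"
    unfolding process_law_def using PM
    by (intro distr_restrict_full[OF \<Omega> AE, symmetric] measurable_restrict) auto
  have "\<nu> 0 = return borel 1"
  proof -
    have "AE \<omega> in M. P 0 \<omega> = 1" using P by (auto simp: exponential_brownian_motion_def)
    then have "\<nu> 0 = distr M borel (\<lambda>_. 1)"
      unfolding \<nu>[OF order_refl] using PM by (intro distr_cong_AE) auto
    then show ?thesis by (simp add: M.distr_const)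
  qed
  moreover have "\<nu> t = density lborel (\<lambda>x. ennreal (exp_bm_density t x))" if "0 < t" for t
    using dR[of t] R.distr_stoch_exp[OF that] that by simp
  moreover obtain M' :: "(real \<Rightarrow> real) measure" and F' P' where
    "martingale M' F' P'" "\<forall>\<omega>\<in>space M'. continuous_on {0..} (\<lambda>t. P' t \<omega>)"
    "\<forall>t\<ge>0. distr M' borel (P' t) = distr (restrict_space M \<Omega>) borel (R.stoch_exp t)"
    "process_law M' P' = process_law R.fake_measure R.fake"
    using R.exists_fake by blast
  then have "\<exists>(M' :: (real \<Rightarrow> real) measure) F' P'.
         martingale M' F' P'
         \<and> (\<forall>\<omega>\<in>space M'. continuous_on {0..} (\<lambda>t. P' t \<omega>))
         \<and> (\<forall>t\<ge>0. distr M' borel (P' t) = \<nu> t)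
         \<and> process_law M' P' \<noteq> process_law M P"
    using R.process_law_fake_measure_neq_P dR law by (intro exI[of _ M'] exI[of _ F'] exI[of _ P']) auto
  ultimately show ?thesis by blast
qed

end
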